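(* Let $d\geq 3$ and let $(M,g)$ be the Kasner spacetime $M=(0,\infty)\times\mathbb{R}^d$ with metric $g=-dt^2+\sum_{i=1}^d t^{2p_i}\,dx_i^2$, where the Kasner exponents $p_1,\dots,p_d\in\mathbb{R}$ satisfy $\sum_{i=1}^d p_i=1$ and $\sum_{i=1}^d p_i^2=1$, and where at least one $p_i$ is negative. Then $(M,g)$ is $C^0$-inextendible.
   Context: $(M,g)$ is time-oriented by declaring $\partial_t$ future directed. A $C^0$-extension of a time-oriented Lorentzian manifold $(M,g)$ with smooth metric is a smooth isometric embedding $\iota:M\hookrightarrow\tilde M$ into a Lorentzian manifold $(\tilde M,\tilde g)$ of the same dimension with a continuous Lorentzian metric $\tilde g$, such that the topological boundary $\partial\iota(M)$ of $\iota(M)$ in $\tilde M$ is non-empty. $(M,g)$ is $C^0$-inextendible if no $C^0$-extension exists. Manifolds are Hausdorff, second countable, smooth and connected. *)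

theory Defs
  imports "HOL-Analysis.Analysis"
begin

type_synonym 'n spt = "real \<times> (real ^ 'n)"

fun Ck_on :: "nat \<Rightarrow> 'a::euclidean_space set \<Rightarrow> ('a \<Rightarrow> 'b::euclidean_space) \<Rightarrow> bool" where
  "Ck_on 0 S f = continuous_on S f"
| "Ck_on (Suc k) S f =
     ((\<forall>x\<in>S. f differentiable (at x)) \<and>
      (\<forall>v. Ck_on k S (\<lambda>x. frechet_derivative f (at x) v)))"

definition smooth_on :: "'a::euclidean_space set \<Rightarrow> ('a \<Rightarrow> 'b::euclidean_space) \<Rightarrow> bool" where
  "smooth_on S f \<longleftrightarrow> (\<forall>k. Ck_on k S f)"

definition lorentz_form :: "('v::euclidean_space \<Rightarrow> 'v \<Rightarrow> real) \<Rightarrow> bool" where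
  "lorentz_form B \<longleftrightarrow> bilinear B \<and> (\<forall>u v. B u v = B v u) \<and>
     (\<exists>e. B e e < 0) \<and>
     (\<exists>W. subspace W \<and> dim W = DIM('v) - 1 \<and> (\<forall>w\<in>W. w \<noteq> 0 \<longrightarrow> B w w > 0))"

definition smooth_manifold :: "'a topology \<Rightarrow> ('a set \<times> ('a \<Rightarrow> 'v::euclidean_space)) set \<Rightarrow> bool" where
  "smooth_manifold T A \<longleftrightarrow>
     Hausdorff_space T \<and> second_countable T \<and> connected_space T \<and>
     (\<forall>(U,\<phi>)\<in>A. openin T U \<and> open (\<phi> ` U) \<and>
        homeomorphic_map (subtopology T U) (top_of_set (\<phi> ` U)) \<phi>) \<and>
     \<Union>(fst ` A) = topspace T \<and>
     (\<forall>(U,\<phi>)\<in>A. \<forall>(V,\<psi>)\<in>A. smooth_on (\<phi> ` (U \<inter> V)) (\<psi> \<circ> inv_into U \<phi>))"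

text \<open>A continuous Lorentzian metric on (T, A): in each chart (U, \<phi>) its coordinate
  expression G (U,\<phi>) y u v (at y \<in> \<phi> ` U, on coordinate vectors u, v), continuous,
  Lorentzian, and transforming as a (0,2)-tensor under chart changes.\<close>
definition continuous_lorentzian_metric ::
  "'a topology \<Rightarrow> ('a set \<times> ('a \<Rightarrow> 'v::euclidean_space)) set \<Rightarrow>
   ('a set \<times> ('a \<Rightarrow> 'v) \<Rightarrow> 'v \<Rightarrow> 'v \<Rightarrow> 'v \<Rightarrow> real) \<Rightarrow> bool" where
  "continuous_lorentzian_metric T A G \<longleftrightarrow>
     (\<forall>(U,\<phi>)\<in>A.
        (\<forall>y\<in>\<phi> ` U. lorentz_form (G (U,\<phi>) y)) \<and>
        (\<forall>u v. continuous_on (\<phi> ` U) (\<lambda>y. G (U,\<phi>) y u v))) \<and>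
     (\<forall>(U,\<phi>)\<in>A. \<forall>(V,\<psi>)\<in>A. \<forall>y\<in>\<phi> ` (U \<inter> V). \<forall>u v.
        G (U,\<phi>) y u v =
        G (V,\<psi>) ((\<psi> \<circ> inv_into U \<phi>) y)
          (frechet_derivative (\<psi> \<circ> inv_into U \<phi>) (at y) u)
          (frechet_derivative (\<psi> \<circ> inv_into U \<phi>) (at y) v))"

text \<open>C^0-extension of a spacetime given globally in coordinates: an open set
  M \<subseteq> 'v with (smooth) coordinate metric g.  The extension is (T, A, G) and the
  map \<iota> is a smooth isometric embedding with nonempty topological boundary of \<iota>(M).\<close>
definition is_C0_extension ::
  "'v::euclidean_space set \<Rightarrow> ('v \<Rightarrow> 'v \<Rightarrow> 'v \<Rightarrow> real) \<Rightarrow>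
   'a topology \<Rightarrow> ('a set \<times> ('a \<Rightarrow> 'v)) set \<Rightarrow>
   ('a set \<times> ('a \<Rightarrow> 'v) \<Rightarrow> 'v \<Rightarrow> 'v \<Rightarrow> 'v \<Rightarrow> real) \<Rightarrow> ('v \<Rightarrow> 'a) \<Rightarrow> bool" where
  "is_C0_extension M g T A G \<iota> \<longleftrightarrow>
     smooth_manifold T A \<and> continuous_lorentzian_metric T A G \<and>
     embedding_map (top_of_set M) T \<iota> \<and>
     (\<forall>(U,\<phi>)\<in>A. smooth_on (M \<inter> \<iota> -` U) (\<phi> \<circ> \<iota>) \<and>
        (\<forall>z\<in>M \<inter> \<iota> -` U. inj (frechet_derivative (\<phi> \<circ> \<iota>) (at z)) \<and>
           (\<forall>u v. g z u v =
              G (U,\<phi>) (\<phi> (\<iota> z)) (frechet_derivative (\<phi> \<circ> \<iota>) (at z) u)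
                                 (frechet_derivative (\<phi> \<circ> \<iota>) (at z) v)))) \<and>
     T frontier_of (\<iota> ` M) \<noteq> {}"

definition kasner_M :: "'n::finite spt set" where
  "kasner_M = {z. fst z > 0}"

definition kasner_g :: "('n::finite \<Rightarrow> real) \<Rightarrow> 'n spt \<Rightarrow> 'n spt \<Rightarrow> 'n spt \<Rightarrow> real" where
  "kasner_g p z u v =
     - (fst u * fst v) + (\<Sum>i\<in>UNIV. fst z powr (2 * p i) * (snd u $ i) * (snd v $ i))"

end

theory Submission
  imports Defs
begin

text \<open>Suppose an extension exists. A straight segment in a chart of the extension, timelike for the
  extended metric, leaves the image of the Kasner spacetime through a boundary point q. Near q the
  continuous metric is pinched between two constant cones, and Kasner time is monotone along the
  segment. Two homotopy arguments link the chart with Kasner coordinates: timelike curves with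
  common endpoints can be deformed into one another, in the chart without leaving the image of the
  spacetime (because causal diamonds of Kasner are compact) and in Kasner coordinates without
  leaving the chart (because wide coordinate cones in the chart are compact).

  If t increases towards q, then t tends to infinity. Starting the segment slightly earlier gives
  enough slack to slow down the curve by a constant factor in the time variable t powr (1 + m),
  where all exponents are at least -m > -1; this produces timelike curves of arbitrarily large
  length between points of the chart whose coordinate distance is bounded, a contradiction.

  If t decreases towards q, then t tends to 0. The slices of constant t are graphs of uniformly
  bounded slope in the chart, so their spatial diameter is bounded. Comoving lines starting close to
  q stay in the chart all the way to t = 0: otherwise another boundary point, causally but not
  trivially related to q, would have the same endpoint on t = 0. Hence two comoving lines that differ
  in a direction x_j with p_j < 0 remain in the chart, although their distance grows like
  t powr p_j.\<close>

section \<open>Curves with one-sided derivatives in a cone\<close>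

text \<open>A merely continuous metric offers neither geodesics nor curvature, so only inclusions of
  cones pass between the two coordinate systems: the slope \<open>\<kappa>\<close> gives chart cones
  inside every Kasner cone, the slope \<open>K\<close> chart cones containing all of them. The
  obstacle is that such an inclusion controls a curve only while it stays in the region seen by the
  chart. The homotopies remove it: the set of good homotopy parameters is open, and it is closed
  because a curve with controlled ends is trapped in a compact set. On the Kasner side compactness
  comes from \<open>p i < 1\<close>, which makes \<open>t powr (- p i)\<close> integrable at 0; the
  lower bound \<open>- 1 < p i\<close> makes the length gained in the future case unbounded. Which
  of the two cases occurs is decided by the time orientation of the segment at the boundary point;
  changing the sign of \<open>w\<close> lets one locale serve both.\<close>

lemma convex_cone_increment:
  fixes f :: "real \<Rightarrow> 'b::real_normed_vector"
  assumes ab: "a \<le> b" and cont: "continuous_on {a..b} f"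
    and C: "closed C" "0 \<in> C" "\<And>x y. x \<in> C \<Longrightarrow> y \<in> C \<Longrightarrow> x + y \<in> C"
    and step: "\<And>t. a \<le> t \<Longrightarrow> t < b \<Longrightarrow> eventually (\<lambda>t'. f t' - f t \<in> C) (at_right t)"
  shows "f b - f a \<in> C"
proof -
  \<comment> \<open>Induction along the interval: closedness of \<open>C\<close> makes the largest
    good time \<open>m\<close> exist, and \<open>step\<close> together with closure under sums moves
    past any \<open>m < b\<close>. Only right neighbourhoods occur, so corners of the curve are
    harmless.\<close>
  define S where "S = {t \<in> {a..b}. f t - f a \<in> C}"
  have "closed S"
    unfolding S_def
    using continuous_closed_preimage[of "{a..b}" "\<lambda>t. f t - f a" C] cont C(1)
    by (simp add: continuous_on_diff vimage_def Int_def)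
  moreover have "bounded S" unfolding S_def by (rule bounded_subset[of "{a..b}"]) auto
  ultimately have cS: "compact S" by (simp add: compact_eq_bounded_closed)
  have aS: "a \<in> S" using ab C(2) by (simp add: S_def)
  obtain m where m: "m \<in> S" "\<And>t. t \<in> S \<Longrightarrow> t \<le> m"
    using compact_attains_sup[OF cS] aS by blast
  have "m = b"
  proof (rule ccontr)
    assume "m \<noteq> b"
    with m have mb: "a \<le> m" "m < b" by (auto simp: S_def)
    from step[OF this] obtain d where d: "d > m" "\<And>t'. m < t' \<Longrightarrow> t' < d \<Longrightarrow> f t' - f m \<in> C"
      by (auto simp: eventually_at_right_field)
    define t' where "t' = (m + min b d) / 2"
    have t': "m < t'" "t' < d" "t' \<le> b" using mb d by (auto simp: t'_def)
    have "f t' - f m + (f m - f a) \<in> C" using C(3)[OF d(2)[OF t'(1,2)], of "f m - f a"] m(1) by (simp add: S_def)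
    then have "t' \<in> S" using t' mb by (auto simp: S_def)
    with m(2) t' show False by force
  qed
  with m show ?thesis by (simp add: S_def)
qed

text \<open>The difference quotients converge to \<open>v\<close> and so enter the open set
  \<open>U\<close>; multiplying by the positive time step lands in \<open>C\<close>. Openness is
  what turns a statement about velocities into one about increments.\<close>

lemma right_derivative_eventually:
  fixes f :: "real \<Rightarrow> 'b::real_normed_vector"
  assumes f: "(f has_vector_derivative v) (at t within {t..})"
    and U: "open U" "v \<in> U" and C: "\<And>x r. x \<in> U \<Longrightarrow> r > 0 \<Longrightarrow> r *\<^sub>R x \<in> C"
  shows "eventually (\<lambda>t'. f t' - f t \<in> C) (at_right t)"
proof -
  have "((\<lambda>x. (f x - f t) /\<^sub>R (x - t)) \<longlongrightarrow> v) (at_right t)"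
  proof -
    have "((\<lambda>y. (1 / norm (y - t)) *\<^sub>R (f y - (f t + (y - t) *\<^sub>R v))) \<longlongrightarrow> 0) (at_right t)"
      using f unfolding has_vector_derivative_def has_derivative_within
      by (simp add: at_within_Ici_at_right)
    then have "((\<lambda>y. (1 / norm (y - t)) *\<^sub>R (f y - (f t + (y - t) *\<^sub>R v)) + v) \<longlongrightarrow> 0 + v) (at_right t)"
      by (intro tendsto_intros)
    moreover have "\<forall>\<^sub>F y in at_right t. (1 / norm (y - t)) *\<^sub>R (f y - (f t + (y - t) *\<^sub>R v)) + v
        = (f y - f t) /\<^sub>R (y - t)"
      using eventually_at_right_less[of t]
      by eventually_elim (simp add: diff_diff_eq[symmetric] scaleR_diff_right divide_inverse)
    ultimately show ?thesis using tendsto_cong by fastforce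
  qed
  then have "eventually (\<lambda>x. (f x - f t) /\<^sub>R (x - t) \<in> U) (at_right t)"
    using U by (rule topological_tendstoD)
  then show ?thesis
    using eventually_at_right_less[of t]
  proof eventually_elim
    case (elim x)
    have "(x - t) *\<^sub>R ((f x - f t) /\<^sub>R (x - t)) \<in> C"
      by (rule C) (use elim in auto)
    then show ?case using elim by simp
  qed
qed

lemma increment_pos_right_derivative:
  fixes f :: "real \<Rightarrow> real"
  assumes "a \<le> b" "continuous_on {a..b} f"
    and "\<And>t. a \<le> t \<Longrightarrow> t < b \<Longrightarrow> \<exists>d>0. (f has_vector_derivative d) (at t within {t..})"
  shows "f a \<le> f b"
proof -
  have "f b - f a \<in> {0..}"
  proof (rule convex_cone_increment[OF assms(1,2)])
    fix t assume "a \<le> t" "t < b"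
    from assms(3)[OF this] obtain d where d: "d > 0" "(f has_vector_derivative d) (at t within {t..})"
      by blast
    show "eventually (\<lambda>t'. f t' - f t \<in> {0..}) (at_right t)"
      by (rule right_derivative_eventually[OF d(2), of "{0<..}"]) (use d in auto)
  qed auto
  then show ?thesis by simp
qed

section \<open>Timelike vectors and curves in Kasner coordinates\<close>

text \<open>Only the time coordinate of the base point enters, since the Kasner metric is invariant
  under translations in x.\<close>

definition future_timelike :: "('n::finite \<Rightarrow> real) \<Rightarrow> real \<Rightarrow> 'n spt \<Rightarrow> bool" where
  "future_timelike p t a \<longleftrightarrow> fst a > 0 \<and> (\<Sum>i\<in>UNIV. t powr (2 * p i) * (snd a $ i)\<^sup>2) < (fst a)\<^sup>2"

lemma kasner_g_diag:
  "kasner_g p z a a = - (fst a)\<^sup>2 + (\<Sum>i\<in>UNIV. fst z powr (2 * p i) * (snd a $ i)\<^sup>2)"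
  by (simp add: kasner_g_def power2_eq_square mult.assoc)

lemma future_timelike_iff_kasner_g: "future_timelike p (fst z) a \<longleftrightarrow> fst a > 0 \<and> kasner_g p z a a < 0"
  by (simp add: future_timelike_def kasner_g_diag)

lemma kasner_g_neg_fst: "kasner_g p z a a < 0 \<Longrightarrow> fst a \<noteq> 0"
  using sum_nonneg[of UNIV "\<lambda>i. fst z powr (2 * p i) * (snd a $ i)\<^sup>2"]
  by (auto simp: kasner_g_diag)

lemma kasner_g_scale: "kasner_g p z (c *\<^sub>R a) (c *\<^sub>R a) = c\<^sup>2 * kasner_g p z a a"
  by (simp add: kasner_g_diag power_mult_distrib algebra_simps sum_distrib_left)

lemma future_timelike_component:
  assumes "future_timelike p t a" "t > 0"
  shows "\<bar>snd a $ i\<bar> < t powr (- p i) * fst a"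
proof -
  have "(t powr p i * \<bar>snd a $ i\<bar>)\<^sup>2 = t powr (2 * p i) * (snd a $ i)\<^sup>2"
    using assms(2) powr_add[of t "p i" "p i"] by (simp add: power_mult_distrib power2_eq_square[of "t powr p i"])
  also have "\<dots> \<le> (\<Sum>i\<in>UNIV. t powr (2 * p i) * (snd a $ i)\<^sup>2)"
    by (rule member_le_sum) auto
  also have "\<dots> < (fst a)\<^sup>2" using assms by (simp add: future_timelike_def)
  finally have "t powr p i * \<bar>snd a $ i\<bar> < fst a"
    by (rule power2_less_imp_less) (use assms in \<open>simp add: future_timelike_def\<close>)
  then show ?thesis using assms(2) by (simp add: powr_minus field_simps)
qed

text \<open>For velocities normalised to time component 1 the future cone is a sublevel set of a
  convex quadratic form. This makes straight-line homotopies between graphs over Kasner time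
  possible.\<close>

lemma future_timelike_convex:
  assumes "future_timelike p t (1, b)" "future_timelike p t (1, b')" "0 \<le> r" "r \<le> 1"
  shows "future_timelike p t (1, b + r *\<^sub>R (b' - b))"
proof -
  have conv: "(x + r * (y - x))\<^sup>2 \<le> (1 - r) * x\<^sup>2 + r * y\<^sup>2" for x y :: real
  proof -
    have "(1 - r) * x\<^sup>2 + r * y\<^sup>2 - (x + r * (y - x))\<^sup>2 = r * (1 - r) * (x - y)\<^sup>2"
      by (simp add: power2_eq_square algebra_simps)
    moreover have "0 \<le> r * (1 - r) * (x - y)\<^sup>2" using assms by simp
    ultimately show ?thesis by linarith
  qed
  have "(\<Sum>i\<in>UNIV. t powr (2 * p i) * ((b + r *\<^sub>R (b' - b)) $ i)\<^sup>2)
     \<le> (\<Sum>i\<in>UNIV. t powr (2 * p i) * ((1 - r) * (b $ i)\<^sup>2 + r * (b' $ i)\<^sup>2))"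
    by (intro sum_mono mult_left_mono) (use conv in auto)
  also have "\<dots> = (1 - r) * (\<Sum>i\<in>UNIV. t powr (2 * p i) * (b $ i)\<^sup>2)
      + r * (\<Sum>i\<in>UNIV. t powr (2 * p i) * (b' $ i)\<^sup>2)"
    by (simp add: sum.distrib sum_distrib_left algebra_simps sum_subtractf)
  also have "\<dots> < 1"
    using assms convex_bound_lt[of "\<Sum>i\<in>UNIV. t powr (2 * p i) * (b $ i)\<^sup>2" 1
        "\<Sum>i\<in>UNIV. t powr (2 * p i) * (b' $ i)\<^sup>2" "1 - r" r]
    by (simp add: future_timelike_def)
  finally show ?thesis by (simp add: future_timelike_def)
qed

text \<open>Since all exponents are below one, t powr (- p i) has the primitive
  t powr (1 - p i) / (1 - p i), which bounds the coordinate displacement along causal curves.\<close>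
definition causal_bound :: "('n::finite \<Rightarrow> real) \<Rightarrow> 'n spt \<Rightarrow> 'n spt \<Rightarrow> bool" where
  "causal_bound p z z' \<longleftrightarrow> fst z \<le> fst z' \<and>
     (\<forall>i. \<bar>snd z' $ i - snd z $ i\<bar> \<le> (fst z' powr (1 - p i) - fst z powr (1 - p i)) / (1 - p i))"

lemma causal_bound_along_curve:
  fixes c :: "real \<Rightarrow> 'n::finite spt"
  assumes p: "\<And>i. p i < 1" and ab: "a \<le> b" and cont: "continuous_on {a..b} c"
    and pos: "\<And>t. t \<in> {a..b} \<Longrightarrow> fst (c t) > 0"
    and der: "\<And>t. a \<le> t \<Longrightarrow> t < b \<Longrightarrow> \<exists>v. (c has_vector_derivative v) (at t within {t..}) \<and> future_timelike p (fst (c t)) v"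
  shows "causal_bound p (c a) (c b)"
proof -
  have "fst (c a) \<le> fst (c b)"
  proof (rule increment_pos_right_derivative[OF ab])
    show "continuous_on {a..b} (\<lambda>t. fst (c t))" by (intro continuous_intros cont)
    fix t assume "a \<le> t" "t < b"
    from der[OF this] obtain v where v: "(c has_vector_derivative v) (at t within {t..})" "future_timelike p (fst (c t)) v"
      by blast
    have "((\<lambda>t. fst (c t)) has_vector_derivative fst v) (at t within {t..})"
      by (rule bounded_linear.has_vector_derivative[OF bounded_linear_fst v(1)])
    then show "\<exists>d>0. ((\<lambda>t. fst (c t)) has_vector_derivative d) (at t within {t..})"
      using v(2) by (auto simp: future_timelike_def)
  qed
  moreover have "\<bar>snd (c b) $ i - snd (c a) $ i\<bar> \<le> (fst (c b) powr (1 - p i) - fst (c a) powr (1 - p i)) / (1 - p i)"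
    for i
  proof -
    have q: "1 - p i > 0" using p[of i] by simp
    \<comment> \<open>The choices \<open>e = 1\<close> and \<open>e = -1\<close> give the two halves
      of the absolute value. Both functions increase because each spatial component of the velocity
      is, in modulus, smaller than \<open>t powr (- p i)\<close> times its time component.\<close>
    have mono: "fst (c a) powr (1 - p i) / (1 - p i) + e * snd (c a) $ i
       \<le> fst (c b) powr (1 - p i) / (1 - p i) + e * snd (c b) $ i" if e: "\<bar>e\<bar> = 1" for e :: real
    proof (rule increment_pos_right_derivative[OF ab])
      show "continuous_on {a..b} (\<lambda>t. fst (c t) powr (1 - p i) / (1 - p i) + e * snd (c t) $ i)"
        using q pos by (intro continuous_intros cont) force+
      fix t assume t: "a \<le> t" "t < b"
      from der[OF this] obtain v where v: "(c has_vector_derivative v) (at t within {t..})" "future_timelike p (fst (c t)) v"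
        by blast
      have ct: "fst (c t) > 0" using pos t by auto
      have 1: "((\<lambda>t. fst (c t)) has_real_derivative fst v) (at t within {t..})"
        using bounded_linear.has_vector_derivative[OF bounded_linear_fst v(1)]
        by (simp add: has_real_derivative_iff_has_vector_derivative)
      have 2: "((\<lambda>t. snd (c t) $ i) has_real_derivative snd v $ i) (at t within {t..})"
        using bounded_linear.has_vector_derivative[OF bounded_linear_compose[OF bounded_linear_vec_nth bounded_linear_snd] v(1)]
        by (simp add: has_real_derivative_iff_has_vector_derivative)
      have 3: "((\<lambda>t. fst (c t) powr (1 - p i)) has_real_derivative
          (1 - p i) * fst (c t) powr (1 - p i - 1) * fst v) (at t within {t..})"
        by (rule DERIV_chain2[OF has_real_derivative_powr[OF ct] 1])
      have "((\<lambda>t. fst (c t) powr (1 - p i) / (1 - p i) + e * snd (c t) $ i) has_real_derivative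
          (1 - p i) * fst (c t) powr (1 - p i - 1) * fst v / (1 - p i) + e * snd v $ i) (at t within {t..})"
        by (intro DERIV_add DERIV_cdivide[OF 3] DERIV_cmult[OF 2])
      then have "((\<lambda>t. fst (c t) powr (1 - p i) / (1 - p i) + e * snd (c t) $ i) has_vector_derivative
          fst (c t) powr (- p i) * fst v + e * snd v $ i) (at t within {t..})"
        using q by (simp add: has_real_derivative_iff_has_vector_derivative)
      moreover have "fst (c t) powr (- p i) * fst v + e * snd v $ i > 0"
        using future_timelike_component[OF v(2) ct, of i] e by (cases "e = 1") (auto simp: abs_if split: if_splits)
      ultimately show "\<exists>d>0. ((\<lambda>t. fst (c t) powr (1 - p i) / (1 - p i) + e * snd (c t) $ i)
           has_vector_derivative d) (at t within {t..})" by blast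
    qed
    from mono[of 1] mono[of "-1"] show ?thesis by (simp add: diff_divide_distrib)
  qed
  ultimately show ?thesis by (simp add: causal_bound_def)
qed

lemma spatial_box_compact:
  fixes A :: real
  assumes "t1 > 0"
  shows "compact ({t1..t2} \<times> cball (y::real^'n::finite) A)" "{t1..t2} \<times> cball y A \<subseteq> kasner_M"
  using assms by (auto simp: kasner_M_def intro: compact_Times)

text \<open>Since \<open>1 - p i > 0\<close>, dropping the contribution of the starting time leaves
  a bound that depends on \<open>T\<close> only, uniform for starting times near 0.\<close>

lemma causal_bound_bounded_spatial:
  assumes p: "\<And>i. p i < 1" and j: "causal_bound p z z'" and pos: "fst z > 0" and le: "fst z' \<le> T"
  shows "norm (snd z' - snd z) \<le> (\<Sum>i\<in>UNIV. T powr (1 - p i) / (1 - p i))"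
proof -
  have "norm (snd z' - snd z) \<le> (\<Sum>i\<in>UNIV. \<bar>(snd z' - snd z) $ i\<bar>)"
    by (rule norm_le_l1_cart)
  also have "\<dots> \<le> (\<Sum>i\<in>UNIV. T powr (1 - p i) / (1 - p i))"
  proof (rule sum_mono)
    fix i
    have q: "1 - p i > 0" using p[of i] by simp
    have "\<bar>(snd z' - snd z) $ i\<bar> \<le> (fst z' powr (1 - p i) - fst z powr (1 - p i)) / (1 - p i)"
      using j by (simp add: causal_bound_def)
    also have "\<dots> \<le> T powr (1 - p i) / (1 - p i)"
    proof (rule divide_right_mono)
      have "fst z' powr (1 - p i) \<le> T powr (1 - p i)"
        by (rule powr_mono2) (use q pos j le in \<open>auto simp: causal_bound_def\<close>)
      then show "fst z' powr (1 - p i) - fst z powr (1 - p i) \<le> T powr (1 - p i)"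
        using powr_ge_zero[of "fst z" "1 - p i"] by linarith
    qed (use q in simp)
    finally show "\<bar>(snd z' - snd z) $ i\<bar> \<le> T powr (1 - p i) / (1 - p i)" .
  qed
  finally show ?thesis .
qed

text \<open>The unit sum of squares gives modulus at most one. Equality forces the other exponents
  to vanish, and the unit sum then makes the remaining one equal to 1, so that none is
  negative.\<close>

lemma kasner_exponent_bounds:
  fixes p :: "'n::finite \<Rightarrow> real"
  assumes "(\<Sum>i\<in>UNIV. p i) = 1" "(\<Sum>i\<in>UNIV. (p i)\<^sup>2) = 1" "\<exists>i. p i < 0"
  shows "p i < 1" "- 1 < p i"
proof -
  obtain j where j: "p j < 0" using assms by blast
  have sq: "(p i)\<^sup>2 \<le> 1" for i
    using member_le_sum[of i UNIV "\<lambda>i. (p i)\<^sup>2"] assms by simp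
  have zero: "p k = 0" if "(p i)\<^sup>2 = 1" "k \<noteq> i" for i k
  proof -
    have "(\<Sum>i\<in>UNIV. (p i)\<^sup>2) = (p i)\<^sup>2 + (\<Sum>i\<in>UNIV - {i}. (p i)\<^sup>2)"
      by (simp add: sum.remove)
    then have "(\<Sum>i\<in>UNIV - {i}. (p i)\<^sup>2) = 0" using assms that by simp
    then have "\<forall>k\<in>UNIV-{i}. (p k)\<^sup>2 = 0" by (subst (asm) sum_nonneg_eq_0_iff) auto
    then show ?thesis using that by auto
  qed
  have ne: "(p i)\<^sup>2 \<noteq> 1"
  proof
    assume 1: "(p i)\<^sup>2 = 1"
    have "(\<Sum>k\<in>UNIV. p k) = p i + (\<Sum>k\<in>UNIV - {i}. p k)" by (simp add: sum.remove)
    also have "(\<Sum>k\<in>UNIV - {i}. p k) = 0" by (rule sum.neutral) (use zero[OF 1] in auto)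
    finally have "p i = 1" using assms by simp
    then show False using j zero[OF 1, of j] by (cases "j = i") auto
  qed
  have "\<bar>p i\<bar> < 1" using sq[of i] ne by (metis abs_square_less_1 order_less_le)
  then show "p i < 1" "- 1 < p i" by auto
qed

text \<open>A form of the tube lemma; it provides openness in the homotopy parameter, uniformly in
  the curve parameter.\<close>

lemma open_Ball_compact:
  fixes H :: "'a::metric_space \<Rightarrow> 'b::metric_space \<Rightarrow> 'c::topological_space"
  assumes C: "compact C" and V: "open V" and H: "continuous_on (UNIV \<times> C) (\<lambda>(x, s). H x s)"
  shows "open {x. \<forall>s\<in>C. H x s \<in> V}"
proof -
  have "closed {x. \<exists>s\<in>C. H x s \<notin> V}"
    unfolding closed_sequential_limits
  proof (intro allI impI, elim conjE)
    fix X l assume X: "\<forall>n. X n \<in> {x. \<exists>s\<in>C. H x s \<notin> V}" and lim: "X \<longlonglongrightarrow> l"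
    then obtain S where S: "\<And>n. S n \<in> C" "\<And>n. H (X n) (S n) \<notin> V" by simp metis
    obtain r s where r: "s \<in> C" "strict_mono (r::nat\<Rightarrow>nat)" "(S \<circ> r) \<longlonglongrightarrow> s"
      using C S(1) by (metis compact_def)
    have "((\<lambda>n. (X (r n), S (r n))) \<longlongrightarrow> (l, s)) sequentially"
      using LIMSEQ_subseq_LIMSEQ[OF lim r(2)] r(3) by (auto intro!: tendsto_Pair simp: o_def)
    then have "((\<lambda>n. H (X (r n)) (S (r n))) \<longlongrightarrow> H l s) sequentially"
      using continuous_on_tendsto_compose[OF H, of "\<lambda>n. (X (r n), S (r n))" "(l, s)" sequentially] r S by auto
    moreover have "closed (- V)" using V by auto
    ultimately have "H l s \<in> - V"
      using closed_sequentially[of "- V" "\<lambda>n. H (X (r n)) (S (r n))"] S by auto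
    then show "l \<in> {x. \<exists>s\<in>C. H x s \<notin> V}" using r by auto
  qed
  then have "open (- {x. \<exists>s\<in>C. H x s \<notin> V})" by auto
  moreover have "- {x. \<exists>s\<in>C. H x s \<notin> V} = {x. \<forall>s\<in>C. H x s \<in> V}" by auto
  ultimately show ?thesis by simp
qed

lemma unit_interval_clopen:
  fixes S :: "real set"
  assumes "0 \<in> S" and op: "open S"
    and cl: "\<And>X x. (\<And>n. X n \<in> S \<inter> {0..1}) \<Longrightarrow> X \<longlonglongrightarrow> x \<Longrightarrow> x \<in> {0..1} \<Longrightarrow> x \<in> S"
  shows "{0..1} \<subseteq> S"
proof -
  have "closed (S \<inter> {0..1})" unfolding closed_sequential_limits
  proof (intro allI impI, elim conjE)
    fix X l assume X: "\<forall>n. X n \<in> S \<inter> {0..1}" "X \<longlonglongrightarrow> l"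
    then have "l \<in> {0..1}" by (metis IntD2 closed_atLeastAtMost closed_sequentially)
    with cl X show "l \<in> S \<inter> {0..1}" by blast
  qed
  then have "closedin (top_of_set {0..1}) ({0..1} \<inter> S)"
    by (metis closed_Int closed_atLeastAtMost closed_subset inf_commute inf_le1)
  moreover have "openin (top_of_set {0..1}) ({0..1} \<inter> S)" using op by (rule openin_open_Int)
  ultimately have "{0..1} \<inter> S = {} \<or> {0..1} \<inter> S = {0..1::real}"
    using connected_clopen[of "{0..1::real}"] by (meson connected_Icc)
  moreover have "0 \<in> {0..1::real} \<inter> S" using assms(1) by simp
  ultimately show ?thesis by blast
qed

section \<open>Timelike curves as graphs over Kasner time\<close>

lemma future_timelike_scale: "c > 0 \<Longrightarrow> future_timelike p t a \<Longrightarrow> future_timelike p t (c *\<^sub>R a)"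
  by (simp add: future_timelike_def power_mult_distrib mult.left_commute[of _ "c\<^sup>2"] flip: sum_distrib_left)

text \<open>Derivatives are taken from the right on the half-open interval so that pieces can be
  glued at a corner; the time component is normalised to 1 for the sake of
  \<open>future_timelike_convex\<close>.\<close>

definition timelike_graph :: "('n::finite \<Rightarrow> real) \<Rightarrow> (real \<Rightarrow> real^'n) \<Rightarrow> real \<Rightarrow> real \<Rightarrow> bool" where
  "timelike_graph p y a b \<longleftrightarrow> continuous_on {a..b} y \<and>
     (\<forall>t. a \<le> t \<and> t < b \<longrightarrow> (\<exists>v. (y has_vector_derivative v) (at t within {t..}) \<and> future_timelike p t (1, v)))"

lemma timelike_graph_subset: "timelike_graph p y a b \<Longrightarrow> a \<le> a' \<Longrightarrow> b' \<le> b \<Longrightarrow> timelike_graph p y a' b'"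
  by (auto simp: timelike_graph_def intro: continuous_on_subset)

lemma timelike_graph_const: "timelike_graph p (\<lambda>_. y) a b"
  by (auto simp: timelike_graph_def future_timelike_def intro!: exI[of _ 0])

lemma timelike_graph_has_derivative:
  assumes "timelike_graph p y a b" "a \<le> t" "t < b"
  shows "\<exists>v. ((\<lambda>t. (t, y t)) has_vector_derivative (1, v)) (at t within {t..}) \<and> future_timelike p t (1, v)"
  using assms by (auto simp: timelike_graph_def intro!: has_vector_derivative_Pair derivative_intros)

lemma timelike_graph_concat:
  assumes "timelike_graph p y a b" "timelike_graph p y' b c" "y b = y' b" "a \<le> b" "b \<le> c"
  shows "timelike_graph p (\<lambda>t. if t < b then y t else y' t) a c"
  unfolding timelike_graph_def
proof (intro conjI allI impI)
  have "continuous_on ({a..b} \<union> {b..c}) (\<lambda>t. if t < b then y t else y' t)"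
    by (rule continuous_on_cases) (use assms in \<open>auto simp: timelike_graph_def\<close>)
  moreover have "{a..b} \<union> {b..c} = {a..c}" using assms by auto
  ultimately show "continuous_on {a..c} (\<lambda>t. if t < b then y t else y' t)" by simp
next
  fix t assume t: "a \<le> t \<and> t < c"
  show "\<exists>v. ((\<lambda>t. if t < b then y t else y' t) has_vector_derivative v) (at t within {t..}) \<and> future_timelike p t (1, v)"
  proof (cases "t < b")
    case True
    with assms(1) t obtain v where v: "(y has_vector_derivative v) (at t within {t..})" "future_timelike p t (1, v)"
      by (auto simp: timelike_graph_def)
    have "((\<lambda>t. if t < b then y t else y' t) has_vector_derivative v) (at t within {t..})"
      by (rule has_vector_derivative_transform_within[OF v(1), of "b - t"]) (use True in \<open>auto simp: dist_real_def\<close>)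
    with v show ?thesis by blast
  next
    case False
    with t have "b \<le> t \<and> t < c" by simp
    with assms(2) obtain v where v: "(y' has_vector_derivative v) (at t within {t..})" "future_timelike p t (1, v)"
      by (auto simp: timelike_graph_def)
    have "((\<lambda>t. if t < b then y t else y' t) has_vector_derivative v) (at t within {t..})"
      by (rule has_vector_derivative_transform_within[OF v(1), of 1]) (use False in \<open>auto simp: dist_real_def\<close>)
    with v show ?thesis by blast
  qed
qed

lemma timelike_graph_convex:
  assumes y: "timelike_graph p y a b" and y': "timelike_graph p y' a b" and r: "0 \<le> r" "r \<le> 1"
  shows "timelike_graph p (\<lambda>t. y t + r *\<^sub>R (y' t - y t)) a b"
  unfolding timelike_graph_def
proof (intro conjI allI impI)
  show "continuous_on {a..b} (\<lambda>t. y t + r *\<^sub>R (y' t - y t))"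
    using assms by (auto simp: timelike_graph_def intro!: continuous_intros)
next
  fix t assume t: "a \<le> t \<and> t < b"
  obtain v where v: "(y has_vector_derivative v) (at t within {t..})" "future_timelike p t (1, v)"
    using y t by (auto simp: timelike_graph_def)
  obtain v' where v': "(y' has_vector_derivative v') (at t within {t..})" "future_timelike p t (1, v')"
    using y' t by (auto simp: timelike_graph_def)
  have "((\<lambda>t. y t + r *\<^sub>R (y' t - y t)) has_vector_derivative v + r *\<^sub>R (v' - v)) (at t within {t..})"
    by (intro has_vector_derivative_add v v' has_vector_derivative_diff
        bounded_linear.has_vector_derivative[OF bounded_linear_scaleR_right])
  with future_timelike_convex[OF v(2) v'(2) r]
  show "\<exists>v. ((\<lambda>t. y t + r *\<^sub>R (y' t - y t)) has_vector_derivative v) (at t within {t..}) \<and> future_timelike p t (1, v)"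
    by blast
qed

lemma timelike_graph_shift:
  assumes "timelike_graph p y a b" shows "timelike_graph p (\<lambda>t. y t - e) a b"
  unfolding timelike_graph_def
proof (intro conjI allI impI)
  show "continuous_on {a..b} (\<lambda>t. y t - e)"
    using assms by (auto simp: timelike_graph_def intro!: continuous_intros)
  fix t assume "a \<le> t \<and> t < b"
  with assms obtain v where v: "(y has_vector_derivative v) (at t within {t..})" "future_timelike p t (1, v)"
    by (auto simp: timelike_graph_def)
  have "((\<lambda>t. y t - e) has_vector_derivative v - 0) (at t within {t..})"
    by (intro has_vector_derivative_diff v has_vector_derivative_const)
  with v show "\<exists>v. ((\<lambda>t. y t - e) has_vector_derivative v) (at t within {t..}) \<and> future_timelike p t (1, v)" by auto
qed

lemma timelike_graph_causal_bound:
  assumes "\<And>i. p i < 1" "timelike_graph p y a b" "a \<le> b" "0 < a"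
  shows "causal_bound p (a, y a) (b, y b)"
proof (rule causal_bound_along_curve[of p a b "\<lambda>t. (t, y t)"])
  show "continuous_on {a..b} (\<lambda>t. (t, y t))" using assms by (auto simp: timelike_graph_def intro!: continuous_intros)
  fix t assume "a \<le> t" "t < b"
  from timelike_graph_has_derivative[OF assms(2) this] show
    "\<exists>v. ((\<lambda>t. (t, y t)) has_vector_derivative v) (at t within {t..}) \<and> future_timelike p (fst (t, y t)) v" by auto
qed (use assms in auto)

section \<open>A chart around a boundary point\<close>

text \<open>The map Psi is the embedding read in a chart of the extension, translated such that the boundary
  point under consideration is 0. The vector w is timelike for the extended metric at 0, l is the
  coefficient of w in the orthogonal splitting with respect to that metric, and the chart is
  restricted to the box of size h. The set W may be smaller than the preimage of the box: it contains
  only the points where w and the Kasner time direction have the same time orientation.\<close>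
locale kasner_chart =
  fixes p :: "'n::finite \<Rightarrow> real" and W :: "'n spt set"
    and Psi :: "'n spt \<Rightarrow> 'n spt" and dPsi :: "'n spt \<Rightarrow> 'n spt \<Rightarrow> 'n spt"
    and l :: "'n spt \<Rightarrow> real" and w :: "'n spt" and h b1 b2 b3 b4 :: real
  assumes p_less: "\<And>i. p i < 1" and p_gt: "\<And>i. - 1 < p i"
    and W_open: "open W" and W_sub: "W \<subseteq> kasner_M"
    and inj_Psi: "inj_on Psi W"
    and dPsi: "\<And>z. z \<in> W \<Longrightarrow> (Psi has_derivative dPsi z) (at z)"
    and inj_dPsi: "\<And>z. z \<in> W \<Longrightarrow> inj (dPsi z)"
    and lin_l: "bounded_linear l" and l_w: "l w = 1"
    and pos: "h > 0" "b1 > 0" "b2 > 0" "b3 > 0" "b4 > 0"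
    and box: "\<And>z. z \<in> W \<Longrightarrow> \<bar>l (Psi z)\<bar> < h \<and> norm (Psi z - l (Psi z) *\<^sub>R w) < h"
    and limit_in_W: "\<And>Z z y. (\<And>k::nat. Z k \<in> W) \<Longrightarrow> Z \<longlonglongrightarrow> z \<Longrightarrow> z \<in> kasner_M \<Longrightarrow>
        (\<lambda>k. Psi (Z k)) \<longlonglongrightarrow> y \<Longrightarrow> \<bar>l y\<bar> < h \<Longrightarrow> norm (y - l y *\<^sub>R w) < h \<Longrightarrow> z \<in> W"
    and g_upper: "\<And>z a. z \<in> W \<Longrightarrow> kasner_g p z a a
        \<le> - (b1 * (l (dPsi z a))\<^sup>2) + b2 * (norm (dPsi z a - l (dPsi z a) *\<^sub>R w))\<^sup>2"
    and g_lower: "\<And>z a. z \<in> W \<Longrightarrow> - (b3 * (l (dPsi z a))\<^sup>2) + b4 * (norm (dPsi z a - l (dPsi z a) *\<^sub>R w))\<^sup>2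
        \<le> kasner_g p z a a"
    and orient: "\<And>z. z \<in> W \<Longrightarrow> l (dPsi z (1, 0)) > 0"
    and boundary: "0 \<notin> Psi ` W"
begin

definition Pr :: "'n spt \<Rightarrow> 'n spt" where "Pr v = v - l v *\<^sub>R w"
definition Om :: "'n spt set" where "Om = {x. \<bar>l x\<bar> < h \<and> norm (Pr x) < h}"
definition Ob :: "'n spt set" where "Ob = Psi ` W"
definition Phi :: "'n spt \<Rightarrow> 'n spt" where "Phi = inv_into W Psi"
definition dPhi :: "'n spt \<Rightarrow> 'n spt \<Rightarrow> 'n spt" where "dPhi y = inv (dPsi (Phi y))"
text \<open>\<open>K\<close> and \<open>\<kappa>\<close> are the slopes of the two comparison cones,
  see \<open>wide_cone\<close> and \<open>narrow_cone\<close>. The factor 2 under the root makes the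
  closed narrow cone strictly timelike; the cap at 1 keeps sideways displacements below the height
  of a segment.\<close>

definition K :: real where "K = sqrt (b3 / b4)"
definition \<kappa> :: real where "\<kappa> = min 1 (sqrt (b1 / (2 * b2)))"

section \<open>Splitting, inverse chart and comparison of cones\<close>

sublocale l: bounded_linear l by (rule lin_l)

lemma bounded_linear_Pr: "bounded_linear Pr"
  unfolding Pr_def
  by (intro bounded_linear_sub bounded_linear_ident bounded_linear_scaleR_const lin_l)

sublocale Pr: bounded_linear Pr by (rule bounded_linear_Pr)

lemma Pr_w [simp]: "Pr w = 0" by (simp add: Pr_def l_w)
lemma l_Pr [simp]: "l (Pr v) = 0" by (simp add: Pr_def l.diff l.scaleR l_w)
lemma Pr_Pr [simp]: "Pr (Pr v) = Pr v" by (simp add: Pr_def[of "Pr v"])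
lemma l_w' [simp]: "l w = 1" by (rule l_w)
lemma Pr_eq: "l v = 0 \<Longrightarrow> Pr v = v" by (simp add: Pr_def)
lemma decomp: "v = l v *\<^sub>R w + Pr v" by (simp add: Pr_def)

lemmas lP_simps = l.add l.diff l.scaleR l.zero l.neg Pr.add Pr.diff Pr.scaleR Pr.zero Pr.neg

lemma K_pos: "K > 0" using pos by (simp add: K_def)
lemma kappa_pos: "\<kappa> > 0" using pos by (simp add: \<kappa>_def)
lemma kappa_le: "\<kappa> \<le> 1" by (simp add: \<kappa>_def)

lemma continuous_l [continuous_intros]: "continuous_on S f \<Longrightarrow> continuous_on S (\<lambda>x. l (f x))"
  by (rule l.continuous_on)
lemma continuous_Pr [continuous_intros]: "continuous_on S f \<Longrightarrow> continuous_on S (\<lambda>x. Pr (f x))"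
  by (rule Pr.continuous_on)

lemma continuous_Psi: "continuous_on W Psi"
  by (meson continuous_at_imp_continuous_on dPsi has_derivative_continuous)

lemma open_Ob: "open Ob"
  unfolding Ob_def by (rule invariance_of_domain[OF continuous_Psi W_open inj_Psi])

lemma Phi_W: "y \<in> Ob \<Longrightarrow> Phi y \<in> W"
  by (auto simp: Ob_def Phi_def inv_into_into)
lemma Psi_Phi: "y \<in> Ob \<Longrightarrow> Psi (Phi y) = y"
  by (auto simp: Ob_def Phi_def f_inv_into_f)
lemma Phi_Psi: "z \<in> W \<Longrightarrow> Phi (Psi z) = z"
  by (simp add: Phi_def inj_Psi)
lemma Psi_Ob: "z \<in> W \<Longrightarrow> Psi z \<in> Ob" by (simp add: Ob_def)
lemma Ob_Om: "y \<in> Ob \<Longrightarrow> y \<in> Om"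
  using box by (auto simp: Ob_def Om_def Pr_def)
lemma zero_notin_Ob: "0 \<notin> Ob" using boundary by (simp add: Ob_def)
lemma fst_pos: "z \<in> W \<Longrightarrow> fst z > 0" using W_sub by (auto simp: kasner_M_def)

lemma linear_dPsi: "z \<in> W \<Longrightarrow> linear (dPsi z)"
  using dPsi has_derivative_linear by blast

lemma dPsi_dPhi: "y \<in> Ob \<Longrightarrow> dPsi (Phi y) (dPhi y v) = v"
  unfolding dPhi_def
  using linear_injective_imp_surjective[OF linear_dPsi inj_dPsi] Phi_W
  by (metis surj_f_inv_f)

lemma dPhi: assumes "y \<in> Ob" shows "(Phi has_derivative dPhi y) (at y)"
proof -
  have "(Phi has_derivative dPhi y) (at (Psi (Phi y)))"
    by (rule has_derivative_inverse_strong[OF W_open Phi_W[OF assms] continuous_Psi Phi_Psi dPsi[OF Phi_W[OF assms]]])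
      (use dPsi_dPhi[OF assms] in auto)
  then show ?thesis by (simp add: Psi_Phi assms)
qed

lemma continuous_Phi: "continuous_on Ob Phi"
  by (meson continuous_at_imp_continuous_on dPhi has_derivative_continuous)

lemma l_ne_0: assumes "z \<in> W" "kasner_g p z a a < 0" shows "l (dPsi z a) \<noteq> 0"
proof
  assume "l (dPsi z a) = 0"
  moreover have "b4 * (norm (dPsi z a - l (dPsi z a) *\<^sub>R w))\<^sup>2 \<ge> 0" using pos by simp
  ultimately show False using g_lower[OF assms(1), of a] assms(2) by simp
qed

text \<open>After \<open>dPsi z\<close>, the functional \<open>l\<close> vanishes on no timelike
  vector and is positive on the Kasner time direction. If it were nonpositive at \<open>a\<close>, a
  combination of the two with nonnegative coefficients would be future timelike with value
  0.\<close>

lemma l_pos: assumes z: "z \<in> W" and a: "future_timelike p (fst z) a" shows "l (dPsi z a) > 0"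
proof (rule ccontr)
  assume "\<not> l (dPsi z a) > 0"
  define x where "x = l (dPsi z (1, 0))"
  define y where "y = - l (dPsi z a)"
  have xy: "x > 0" "y \<ge> 0" using orient[OF z] \<open>\<not> _\<close> by (auto simp: x_def y_def)
  define b where "b = x *\<^sub>R a + y *\<^sub>R (1, 0)"
  have le: "(x * fst a)\<^sup>2 \<le> (fst b)\<^sup>2"
    by (rule power_mono) (use xy a in \<open>auto simp: b_def future_timelike_def\<close>)
  have xa: "future_timelike p (fst z) (x *\<^sub>R a)" using future_timelike_scale xy a by blast
  then have "(\<Sum>i\<in>UNIV. fst z powr (2 * p i) * (snd b $ i)\<^sup>2) < (x * fst a)\<^sup>2"
    by (simp add: b_def future_timelike_def)
  from order.strict_trans2[OF this le] have "future_timelike p (fst z) b"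
    using xa xy by (auto simp: future_timelike_def b_def)
  then have "l (dPsi z b) \<noteq> 0" by (intro l_ne_0[OF z]) (simp add: future_timelike_iff_kasner_g)
  moreover have "l (dPsi z b) = 0"
  proof -
    have "dPsi z b = x *\<^sub>R dPsi z a + y *\<^sub>R dPsi z (1, 0)"
      unfolding b_def linear_add[OF linear_dPsi[OF z]] linear_scale[OF linear_dPsi[OF z]] ..
    then show ?thesis by (simp add: lP_simps x_def y_def)
  qed
  ultimately show False by simp
qed

lemma wide_cone: assumes z: "z \<in> W" and a: "future_timelike p (fst z) a"
  shows "norm (Pr (dPsi z a)) < K * l (dPsi z a)"
proof -
  have "b4 * (norm (Pr (dPsi z a)))\<^sup>2 < b3 * (l (dPsi z a))\<^sup>2"
    using g_lower[OF z, of a] a by (simp add: future_timelike_iff_kasner_g Pr_def)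
  then have "(norm (Pr (dPsi z a)))\<^sup>2 < (K * l (dPsi z a))\<^sup>2"
    using pos by (simp add: K_def power_mult_distrib field_simps)
  then show ?thesis using l_pos[OF z a] K_pos by (auto intro: power2_less_imp_less[of _ "K * l (dPsi z a)"])
qed

lemma narrow_cone: assumes y: "y \<in> Ob" and v: "l v > 0" "norm (Pr v) \<le> \<kappa> * l v"
  shows "future_timelike p (fst (Phi y)) (dPhi y v)"
proof -
  define a where "a = dPhi y v"
  have a: "dPsi (Phi y) a = v" using dPsi_dPhi[OF y] by (simp add: a_def)
  have W: "Phi y \<in> W" by (rule Phi_W[OF y])
  have "(norm (Pr v))\<^sup>2 \<le> (\<kappa> * l v)\<^sup>2" by (rule power_mono) (use v in auto)
  also have "\<dots> \<le> (sqrt (b1 / (2 * b2)) * l v)\<^sup>2"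
    by (intro power_mono mult_right_mono) (use v kappa_pos in \<open>auto simp: \<kappa>_def\<close>)
  also have "\<dots> = b1 / (2 * b2) * (l v)\<^sup>2" using pos by (simp add: power_mult_distrib)
  finally have "b2 * (norm (Pr v))\<^sup>2 \<le> b1 / 2 * (l v)\<^sup>2" using pos by (simp add: field_simps)
  moreover have "b1 * (l v)\<^sup>2 > 0" using pos v by simp
  ultimately have g: "kasner_g p (Phi y) a a < 0"
    using g_upper[OF W, of a] by (simp add: a Pr_def)
  \<comment> \<open>A past directed \<open>a\<close> would make \<open>- a\<close> future timelike,
    with \<open>l\<close> negative on its image, against \<open>l_pos\<close>.\<close>
  have "fst a > 0"
  proof (rule ccontr)
    assume "\<not> fst a > 0"
    then have "fst (- a) > 0" using kasner_g_neg_fst[OF g] by simp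
    moreover have "kasner_g p (Phi y) (- a) (- a) < 0" using g kasner_g_scale[of p "Phi y" "-1" a] by simp
    ultimately have "future_timelike p (fst (Phi y)) (- a)" by (simp add: future_timelike_iff_kasner_g)
    from l_pos[OF W this] show False
      using a v linear_dPsi[OF W] by (simp add: linear_neg l.neg)
  qed
  then show ?thesis using g by (simp add: future_timelike_iff_kasner_g a_def)
qed

lemma future_timelike_w: "y \<in> Ob \<Longrightarrow> future_timelike p (fst (Phi y)) (dPhi y w)"
  by (rule narrow_cone) (use kappa_pos in auto)

text \<open>Compactness on the Kasner side yields a convergent subsequence of preimages, and
  \<open>limit_in_W\<close> keeps its limit in the chart. Thus a limit in the box that is missing
  from \<open>Ob\<close> can only be approached by sequences leaving every compact part of the
  Kasner spacetime.\<close>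

lemma limit_in_Ob:
  assumes Y: "\<And>k::nat. Y k \<in> Ob" "Y \<longlonglongrightarrow> y" "y \<in> Om" and C: "compact C" "C \<subseteq> kasner_M" "\<And>k. Phi (Y k) \<in> C"
  shows "y \<in> Ob"
proof -
  obtain r z where r: "z \<in> C" "strict_mono (r::nat\<Rightarrow>nat)" "((\<lambda>k. Phi (Y k)) \<circ> r) \<longlonglongrightarrow> z"
    using C(1,3) unfolding compact_def by meson
  have L: "(\<lambda>k. Psi (Phi (Y (r k)))) \<longlonglongrightarrow> y"
    using LIMSEQ_subseq_LIMSEQ[OF Y(2) r(2)] by (simp add: Psi_Phi Y o_def)
  have z: "z \<in> W"
    by (rule limit_in_W[of "\<lambda>k. Phi (Y (r k))", OF _ _ _ L])
      (use r C Y in \<open>auto simp: Phi_W o_def Om_def Pr_def\<close>)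
  have "(\<lambda>k. Psi (Phi (Y (r k)))) \<longlonglongrightarrow> Psi z"
    by (rule continuous_on_tendsto_compose[OF continuous_Psi]) (use r z Y in \<open>auto simp: Phi_W o_def\<close>)
  then have "y = Psi z" using L LIMSEQ_unique by blast
  then show ?thesis using z by (simp add: Ob_def)
qed

text \<open>The mirror image of \<open>limit_in_Ob\<close>: now the chart images are confined, and
  the limit is taken in Kasner coordinates.\<close>

lemma limit_in_W_compact:
  assumes Z: "\<And>k::nat. Z k \<in> W" "Z \<longlonglongrightarrow> z" "z \<in> kasner_M" and C: "compact C" "C \<subseteq> Om" "\<And>k. Psi (Z k) \<in> C"
  shows "z \<in> W"
proof -
  obtain r y where r: "y \<in> C" "strict_mono (r::nat\<Rightarrow>nat)" "((\<lambda>k. Psi (Z k)) \<circ> r) \<longlonglongrightarrow> y"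
    using C(1,3) unfolding compact_def by meson
  show ?thesis
    by (rule limit_in_W[of "Z \<circ> r" z y])
      (use r Z C LIMSEQ_subseq_LIMSEQ[OF Z(2) r(2)] in \<open>auto simp: o_def Om_def Pr_def\<close>)
qed

lemma chart_curve_causal_bound:
  assumes ab: "a \<le> b" and c: "continuous_on {a..b} c" "\<And>t. t \<in> {a..b} \<Longrightarrow> c t \<in> Ob"
    and der: "\<And>t. a \<le> t \<Longrightarrow> t < b \<Longrightarrow> \<exists>v. (c has_vector_derivative v) (at t within {t..}) \<and> l v > 0 \<and> norm (Pr v) \<le> \<kappa> * l v"
  shows "causal_bound p (Phi (c a)) (Phi (c b))"
proof (rule causal_bound_along_curve[of p a b "\<lambda>t. Phi (c t)", OF p_less ab])
  show "continuous_on {a..b} (\<lambda>t. Phi (c t))"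
    by (rule continuous_on_compose2[OF continuous_Phi c(1)]) (use c in auto)
  show "fst (Phi (c t)) > 0" if "t \<in> {a..b}" for t using c that by (simp add: Phi_W fst_pos)
  fix t assume t: "a \<le> t" "t < b"
  then obtain v where v: "(c has_vector_derivative v) (at t within {t..})" "l v > 0" "norm (Pr v) \<le> \<kappa> * l v"
    using der by blast
  have O: "c t \<in> Ob" using c t by auto
  have "(Phi \<circ> c has_vector_derivative dPhi (c t) v) (at t within {t..})"
    by (rule vector_derivative_diff_chain_within[OF v(1) has_derivative_at_withinI[OF dPhi[OF O]]])
  then have "((\<lambda>t. Phi (c t)) has_vector_derivative dPhi (c t) v) (at t within {t..})" by (simp add: o_def)
  with narrow_cone[OF O v(2,3)]
  show "\<exists>v. ((\<lambda>t. Phi (c t)) has_vector_derivative v) (at t within {t..}) \<and> future_timelike p (fst (Phi (c t))) v"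
    by blast
qed

lemma vertical_causal_bound:
  assumes "0 \<le> T" "\<And>s. s \<in> {0..T} \<Longrightarrow> a + s *\<^sub>R w \<in> Ob"
  shows "causal_bound p (Phi a) (Phi (a + T *\<^sub>R w))"
proof -
  have "causal_bound p (Phi (a + 0 *\<^sub>R w)) (Phi (a + T *\<^sub>R w))"
  proof (rule chart_curve_causal_bound[of 0 T "\<lambda>s. a + s *\<^sub>R w"])
    fix t assume "0 \<le> t" "t < T"
    have "((\<lambda>s. a + s *\<^sub>R w) has_vector_derivative w) (at t within {t..})"
      by (auto intro!: derivative_eq_intros)
    then show "\<exists>v. ((\<lambda>s. a + s *\<^sub>R w) has_vector_derivative v) (at t within {t..}) \<and> l v > 0 \<and> norm (Pr v) \<le> \<kappa> * l v"
      using kappa_pos by (intro exI[of _ w]) auto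
  qed (use assms in \<open>auto intro!: continuous_intros\<close>)
  then show ?thesis by simp
qed

section \<open>Increments in the wide cone and the two homotopy arguments\<close>

definition Cone :: "'n spt set" where "Cone = {v. norm (Pr v) \<le> K * l v}"

lemma closed_Cone: "closed Cone"
  unfolding Cone_def by (intro closed_Collect_le continuous_intros)

lemma Cone_add: "x \<in> Cone \<Longrightarrow> y \<in> Cone \<Longrightarrow> x + y \<in> Cone"
  using norm_triangle_ineq[of "Pr x" "Pr y"] by (simp add: Cone_def lP_simps algebra_simps)

text \<open>By \<open>wide_cone\<close> the lifted velocities lie in the open cone of slope
  \<open>K\<close>; the closed convex cone collects the increments, corners included.\<close>

lemma timelike_graph_lift_Cone:
  assumes ab: "a \<le> b" and y: "timelike_graph p y a b" and W: "\<And>t. t \<in> {a..b} \<Longrightarrow> (t, y t) \<in> W"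
  shows "Psi (b, y b) - Psi (a, y a) \<in> Cone"
proof (rule convex_cone_increment[of a b "\<lambda>t. Psi (t, y t)", OF ab _ closed_Cone])
  show "continuous_on {a..b} (\<lambda>t. Psi (t, y t))"
    by (rule continuous_on_compose2[OF continuous_Psi])
      (use y W in \<open>auto simp: timelike_graph_def intro!: continuous_intros\<close>)
  show "0 \<in> Cone" by (simp add: Cone_def lP_simps)
  fix t assume t: "a \<le> t" "t < b"
  obtain v where v: "((\<lambda>t. (t, y t)) has_vector_derivative (1, v)) (at t within {t..})" "future_timelike p t (1, v)"
    using timelike_graph_has_derivative[OF y t] by blast
  have tW: "(t, y t) \<in> W" using W t by auto
  have 1: "(Psi \<circ> (\<lambda>t. (t, y t)) has_vector_derivative dPsi (t, y t) (1, v)) (at t within {t..})"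
    by (rule vector_derivative_diff_chain_within[OF v(1) has_derivative_at_withinI[OF dPsi[OF tW]]])
  have "open {v. norm (Pr v) < K * l v}"
    by (intro open_Collect_less continuous_intros)
  from right_derivative_eventually[OF 1 this, of Cone]
  show "\<forall>\<^sub>F t' in at_right t. Psi (t', y t') - Psi (t, y t) \<in> Cone"
    using wide_cone[OF tW] v(2) by (simp add: Cone_def lP_simps)
qed (rule Cone_add)

lemma Om_norm: "x \<in> Om \<Longrightarrow> norm x \<le> h * norm w + h"
proof -
  assume x: "x \<in> Om"
  have "norm x \<le> norm (l x *\<^sub>R w) + norm (Pr x)" by (metis decomp norm_triangle_ineq)
  also have "\<dots> \<le> h * norm w + h"
    using x mult_right_mono[of "\<bar>l x\<bar>" h "norm w"] by (simp add: Om_def)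
  finally show ?thesis .
qed

lemma Cone_l: "v \<in> Cone \<Longrightarrow> 0 \<le> l v"
  using K_pos norm_ge_zero[of "Pr v"] unfolding Cone_def mem_Collect_eq
  by (metis dual_order.trans linorder_not_less mult_pos_neg)

lemma bounded_Om: "bounded Om"
  unfolding bounded_iff using Om_norm by blast

text \<open>Along the homotopy the Kasner images of the curves have common endpoints, hence stay in a
  compact set; so a limit of such curves cannot meet the boundary.\<close>
lemma diamond_curve:
  assumes T: "T > 0" and seg: "\<And>s. s \<in> {0..T} \<Longrightarrow> a + s *\<^sub>R w \<in> Ob"
    and u: "l u = 0" "norm u \<le> \<kappa> * T"
    and om: "\<And>r s. r \<in> {0..1} \<Longrightarrow> s \<in> {0..1} \<Longrightarrow> a + (s * T) *\<^sub>R w + (r * (s * (1 - s))) *\<^sub>R u \<in> Om"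
    and s: "s \<in> {0..1}"
  shows "a + (s * T) *\<^sub>R w + (s * (1 - s)) *\<^sub>R u \<in> Ob"
proof -
  \<comment> \<open>A parabolic bump with fixed ends. The derivative of \<open>s * (1 - s)\<close>
    has modulus at most 1 on the unit interval, so \<open>norm u \<le> \<kappa> * T\<close> keeps
    all velocities in the narrow cone.\<close>
  define H where "H r s = a + (s * T) *\<^sub>R w + (r * (s * (1 - s))) *\<^sub>R u" for r s
  define S where "S = {r. \<forall>s\<in>{0..1}. H r s \<in> Ob}"
  have deriv: "(H r has_vector_derivative T *\<^sub>R w + (r * (1 - 2 * s)) *\<^sub>R u) (at s within {s..})" for r s
    unfolding H_def by (auto intro!: derivative_eq_intros simp: algebra_simps)
  have vel: "l (T *\<^sub>R w + (r * (1 - 2 * s)) *\<^sub>R u) > 0 \<and>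
     norm (Pr (T *\<^sub>R w + (r * (1 - 2 * s)) *\<^sub>R u)) \<le> \<kappa> * l (T *\<^sub>R w + (r * (1 - 2 * s)) *\<^sub>R u)"
    if "r \<in> {0..1}" "s \<in> {0..1}" for r s
  proof -
    have "\<bar>r * (1 - 2 * s)\<bar> \<le> 1 * 1" unfolding abs_mult by (rule mult_mono) (use that in auto)
    then have "\<bar>r * (1 - 2 * s)\<bar> * norm u \<le> 1 * norm u" by (intro mult_right_mono) auto
    then show ?thesis using T u by (simp add: lP_simps Pr_eq)
  qed
  have dv: "\<exists>v. (H r has_vector_derivative v) (at s within {s..}) \<and> l v > 0 \<and> norm (Pr v) \<le> \<kappa> * l v"
    if "r \<in> {0..1}" "s \<in> {0..1}" for r s
    using deriv vel[OF that] by blast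
  have "{0..1} \<subseteq> S"
  proof (rule unit_interval_clopen)
    show "0 \<in> S"
    proof -
      have "s * T \<in> {0..T}" if "s \<in> {0..1}" for s using that T by (auto simp: mult_left_le_one_le)
      then show ?thesis using seg by (auto simp: S_def H_def)
    qed
    show "open S" unfolding S_def
      by (rule open_Ball_compact[OF compact_Icc open_Ob])
        (auto simp: H_def case_prod_unfold intro!: continuous_intros)
    fix X x assume X: "\<And>n. X n \<in> S \<inter> {0..1}" and lim: "X \<longlonglongrightarrow> x" and x: "x \<in> {0..1::real}"
    define t2 where "t2 = fst (Phi (a + T *\<^sub>R w))"
    \<comment> \<open>All curves run from \<open>a\<close> to \<open>a + T *\<^sub>R w\<close>; the
      Kasner times of these ends and the causal bound from \<open>a\<close> confine every image to
      this box.\<close>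
    define C where "C = {fst (Phi a)..t2} \<times> cball (snd (Phi a)) (\<Sum>i\<in>UNIV. t2 powr (1 - p i) / (1 - p i))"
    have aO: "a \<in> Ob" using seg[of 0] T by simp
    have a0: "fst (Phi a) > 0" using aO by (simp add: Phi_W fst_pos)
    have "H x s \<in> Ob" if s: "s \<in> {0..1}" for s
    proof (rule limit_in_Ob[of "\<lambda>n. H (X n) s" _ C])
      show O: "H (X k) s \<in> Ob" for k using X[of k] s by (auto simp: S_def)
      show "(\<lambda>n. H (X n) s) \<longlonglongrightarrow> H x s" unfolding H_def by (intro tendsto_intros lim)
      show "H x s \<in> Om" using om x s by (simp add: H_def)
      show "compact C" "C \<subseteq> kasner_M" unfolding C_def by (rule spatial_box_compact[OF a0])+
      fix k
      have c: "continuous_on A (H (X k))" for A unfolding H_def by (intro continuous_intros)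
      have 1: "causal_bound p (Phi (H (X k) 0)) (Phi (H (X k) s))"
        by (rule chart_curve_causal_bound[OF _ c _ dv]) (use s X[of k] in \<open>auto simp: S_def\<close>)
      have 2: "causal_bound p (Phi (H (X k) s)) (Phi (H (X k) 1))"
        by (rule chart_curve_causal_bound[OF _ c _ dv]) (use s X[of k] in \<open>auto simp: S_def\<close>)
      have ends: "H (X k) 0 = a" "H (X k) 1 = a + T *\<^sub>R w" by (simp_all add: H_def)
      have le: "fst (Phi (H (X k) s)) \<le> t2" using 2 by (simp add: causal_bound_def t2_def ends)
      have ge: "fst (Phi a) \<le> fst (Phi (H (X k) s))" using 1 by (simp add: causal_bound_def ends)
      have "norm (snd (Phi (H (X k) s)) - snd (Phi a)) \<le> (\<Sum>i\<in>UNIV. t2 powr (1 - p i) / (1 - p i))"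
        using causal_bound_bounded_spatial[OF p_less 1 _ le] a0 by (simp add: ends)
      then show "Phi (H (X k) s) \<in> C" using le ge
        by (simp add: C_def mem_Times_iff dist_norm norm_minus_commute)
    qed
    then show "x \<in> S" by (simp add: S_def)
  qed
  then have "1 \<in> S" by auto
  then show ?thesis using s by (auto simp: S_def H_def)
qed

text \<open>\<open>z\<close> lies on one bumped curve from \<open>a\<close> to the top of the
  segment: its parameter is \<open>s = l (z - a) / T\<close>, and dividing \<open>Pr (z - a)\<close>
  by \<open>s * (1 - s)\<close> gives the bump \<open>u\<close>. The quadratic hypothesis is the
  resulting bound on \<open>u\<close>; \<open>wide\<close> keeps the bumps in the box.\<close>

lemma diamond:
  assumes T: "T > 0" and seg: "\<And>s. s \<in> {0..T} \<Longrightarrow> a + s *\<^sub>R w \<in> Ob"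
    and z: "0 < l (z - a)" "l (z - a) < T" "norm (Pr (z - a)) \<le> \<kappa> * (l (z - a) * (T - l (z - a)) / T)"
    and wide: "norm (Pr a) + \<kappa> * T < h"
  shows "z \<in> Ob"
proof -
  define r where "r = l (z - a)"
  define s where "s = r / T"
  define q where "q = s * (1 - s)"
  have s: "0 < s" "s < 1" using z T by (auto simp: s_def r_def)
  have q: "q > 0" "q = r * (T - r) / T\<^sup>2" using s T by (auto simp: q_def s_def field_simps power2_eq_square)
  define u where "u = (1 / q) *\<^sub>R Pr (z - a)"
  have "norm (Pr (z - a)) \<le> \<kappa> * T * q"
    using z(3) T unfolding q(2) r_def[symmetric] by (simp add: power2_eq_square)
  then have u: "norm u \<le> \<kappa> * T" using q(1) by (simp add: u_def field_simps)
  have lu: "l u = 0" by (simp add: u_def lP_simps)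
  have "a + (s * T) *\<^sub>R w + (s * (1 - s)) *\<^sub>R u \<in> Ob"
  proof (rule diamond_curve[OF T seg lu u])
    fix r' s' :: real assume rs: "r' \<in> {0..1}" "s' \<in> {0..1}"
    have aT: "\<bar>l a\<bar> < h" "\<bar>l a + T\<bar> < h"
      using seg[of 0] seg[of T] T by (auto dest!: Ob_Om simp: Om_def lP_simps)
    have "0 \<le> s' * T" "s' * T \<le> T" using rs T by (auto simp: mult_left_le_one_le)
    with aT have 1: "\<bar>l a + s' * T\<bar> < h" by linarith
    have "s' * (1 - s') \<le> 1 * 1" by (rule mult_mono) (use rs in auto)
    then have "\<bar>r' * (s' * (1 - s'))\<bar> \<le> 1 * 1" unfolding abs_mult[of r'] by (intro mult_mono) (use rs in auto)
    then have "\<bar>r' * (s' * (1 - s'))\<bar> * norm u \<le> 1 * norm u" by (intro mult_right_mono) auto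
    then have "norm (Pr a + (r' * (s' * (1 - s'))) *\<^sub>R u) \<le> norm (Pr a) + \<kappa> * T"
      using u norm_triangle_ineq[of "Pr a" "(r' * (s' * (1 - s'))) *\<^sub>R u"] by simp
    with 1 wide show "a + (s' * T) *\<^sub>R w + (r' * (s' * (1 - s'))) *\<^sub>R u \<in> Om"
      by (simp add: Om_def lP_simps lu Pr_eq)
  qed (use s in auto)
  moreover have "a + (s * T) *\<^sub>R w + (s * (1 - s)) *\<^sub>R u = z"
  proof -
    have "(s * (1 - s)) *\<^sub>R u = Pr (z - a)" using q(1) by (simp add: q_def[symmetric] u_def)
    moreover have "s * T = l (z - a)" using T by (simp add: s_def r_def)
    ultimately show ?thesis by (simp add: Pr_def)
  qed
  ultimately show ?thesis by simp
qed

text \<open>All curves of the straight-line homotopy share their start, so their lifts stay in the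
  wide cone above it, and below height \<open>L\<close> because \<open>l\<close> increases up to the
  end. By \<open>om\<close> this closed region lies in the bounded box, hence is compact. The end
  may move within \<open>W\<close>, which \<open>comoving_stays\<close> exploits.\<close>

lemma homotopy_in_W:
  assumes t: "0 < t1" "t1 \<le> t2" and c: "timelike_graph p c t1 t2" and k: "timelike_graph p k t1 t2" and start: "c t1 = k t1"
    and cW: "\<And>t. t \<in> {t1..t2} \<Longrightarrow> (t, c t) \<in> W"
    and endW: "\<And>r. r \<in> {0..1} \<Longrightarrow> (t2, c t2 + r *\<^sub>R (k t2 - c t2)) \<in> W"
    and end_le: "\<And>r. r \<in> {0..1} \<Longrightarrow> l (Psi (t2, c t2 + r *\<^sub>R (k t2 - c t2))) \<le> L"
    and om: "\<And>x. x - Psi (t1, c t1) \<in> Cone \<Longrightarrow> l x \<le> L \<Longrightarrow> x \<in> Om"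
    and s: "s \<in> {t1..t2}"
  shows "(s, k s) \<in> W"
proof -
  define H where "H r t = (t, c t + r *\<^sub>R (k t - c t))" for r t
  define S where "S = {r. \<forall>s\<in>{t1..t2}. H r s \<in> W}"
  define C where "C = {x. x - Psi (t1, c t1) \<in> Cone \<and> l x \<le> L}"
  have "closed C" unfolding C_def Cone_def mem_Collect_eq
    by (intro closed_Collect_conj closed_Collect_le continuous_intros)
  moreover have "C \<subseteq> Om" using om by (auto simp: C_def)
  ultimately have C: "compact C" "C \<subseteq> Om"
    using bounded_Om bounded_subset by (auto simp: compact_eq_bounded_closed)
  have "{0..1} \<subseteq> S"
  proof (rule unit_interval_clopen)
    show "0 \<in> S" using cW by (simp add: S_def H_def)
    have "continuous_on (UNIV \<times> {t1..t2}) (\<lambda>x. c (snd x))" "continuous_on (UNIV \<times> {t1..t2}) (\<lambda>x. k (snd x))"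
      using c k by (auto simp: timelike_graph_def intro!: continuous_on_compose2[of "{t1..t2}" _ _ snd] continuous_intros)
    then show "open S" unfolding S_def
      by (intro open_Ball_compact[OF compact_Icc W_open])
        (auto simp: H_def case_prod_unfold intro!: continuous_intros)
    fix X x assume X: "\<And>n. X n \<in> S \<inter> {0..1}" and lim: "X \<longlonglongrightarrow> x" and x: "x \<in> {0..1::real}"
    have "H x s \<in> W" if s: "s \<in> {t1..t2}" for s
    proof (rule limit_in_W_compact[of "\<lambda>n. H (X n) s" _ C])
      show "H (X n) s \<in> W" for n using X[of n] s by (auto simp: S_def)
      show "(\<lambda>n. H (X n) s) \<longlonglongrightarrow> H x s" unfolding H_def by (intro tendsto_intros lim)
      show "H x s \<in> kasner_M" using s t by (simp add: H_def kasner_M_def)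
      show "compact C" "C \<subseteq> Om" by fact+
      fix n
      define y where "y = (\<lambda>t. c t + X n *\<^sub>R (k t - c t))"
      have y: "timelike_graph p y t1 t2" unfolding y_def using X[of n] by (intro timelike_graph_convex c k) auto
      have yW: "(t, y t) \<in> W" if "t \<in> {t1..t2}" for t using X[of n] that by (auto simp: S_def H_def y_def)
      have "Psi (s, y s) - Psi (t1, y t1) \<in> Cone"
        by (rule timelike_graph_lift_Cone[OF _ timelike_graph_subset[OF y]]) (use s yW in auto)
      moreover have "l (Psi (t2, y t2) - Psi (s, y s)) \<ge> 0"
        by (rule Cone_l, rule timelike_graph_lift_Cone[OF _ timelike_graph_subset[OF y]]) (use s yW in auto)
      moreover have "l (Psi (t2, y t2)) \<le> L" using end_le[of "X n"] X[of n] by (simp add: y_def)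
      moreover have "y t1 = c t1" using start by (simp add: y_def)
      moreover have "H (X n) s = (s, y s)" by (simp add: H_def y_def)
      ultimately show "Psi (H (X n) s) \<in> C" by (simp add: C_def l.diff)
    qed
    then show "x \<in> S" by (simp add: S_def)
  qed
  then have "1 \<in> S" by auto
  then show ?thesis using s by (auto simp: S_def H_def)
qed

text \<open>Kasner time increases strictly along the segment, so it can replace the chart parameter.
  Two-sided derivatives are kept because \<open>delayed_curve\<close> reparametrises the
  result.\<close>

lemma vertical_timelike_graph:
  assumes T: "T > 0" and seg: "\<And>s. s \<in> {0..T} \<Longrightarrow> a + s *\<^sub>R w \<in> Ob"
  obtains Y where "fst (Phi a) < fst (Phi (a + T *\<^sub>R w))"
    "\<And>t. t \<in> {fst (Phi a)..fst (Phi (a + T *\<^sub>R w))} \<Longrightarrow> \<exists>s\<in>{0..T}. Phi (a + s *\<^sub>R w) = (t, Y t)"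
    "Y (fst (Phi a)) = snd (Phi a)" "Y (fst (Phi (a + T *\<^sub>R w))) = snd (Phi (a + T *\<^sub>R w))"
    "\<And>t. t \<in> {fst (Phi a)..fst (Phi (a + T *\<^sub>R w))} \<Longrightarrow>
       \<exists>v. (Y has_vector_derivative v) (at t) \<and> future_timelike p t (1, v)"
proof -
  \<comment> \<open>The parameter interval is enlarged to an open \<open>I\<close>, so that the
    inverse function theorem also applies at the two ends.\<close>
  have op: "open {s. a + s *\<^sub>R w \<in> Ob}"
    using open_Ob by (intro open_vimage[of Ob, unfolded vimage_def] continuous_intros)
  obtain e where e: "e > 0" "(\<Union>s\<in>{0..T}. ball s e) \<subseteq> {s. a + s *\<^sub>R w \<in> Ob}"
    by (rule compact_subset_open_imp_ball_epsilon_subset[OF compact_Icc op]) (use seg in auto)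
  define I where "I = {-e<..<T+e}"
  have IO: "a + s *\<^sub>R w \<in> Ob" if "s \<in> I" for s
  proof -
    have "s \<in> ball (max 0 (min T s)) e" using that T e by (auto simp: I_def dist_real_def)
    moreover have "max 0 (min T s) \<in> {0..T}" using T by auto
    ultimately show ?thesis using e(2) by blast
  qed
  define f where "f s = fst (Phi (a + s *\<^sub>R w))" for s
  define A where "A s = dPhi (a + s *\<^sub>R w) w" for s
  have dP: "((\<lambda>s. Phi (a + s *\<^sub>R w)) has_vector_derivative A s) (at s)" if "s \<in> I" for s
  proof -
    have "((\<lambda>s. a + s *\<^sub>R w) has_vector_derivative w) (at s)" by (auto intro!: derivative_eq_intros)
    from vector_derivative_diff_chain_within[OF this has_derivative_at_withinI[OF dPhi[OF IO[OF that]]]]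
    show ?thesis by (simp add: o_def A_def)
  qed
  have fA: "future_timelike p (f s) (A s)" if "s \<in> I" for s using future_timelike_w[OF IO[OF that]] by (simp add: A_def f_def)
  then have A0: "fst (A s) > 0" if "s \<in> I" for s using that by (simp add: future_timelike_def)
  have df: "(f has_real_derivative fst (A s)) (at s)" if "s \<in> I" for s
    using bounded_linear.has_vector_derivative[OF bounded_linear_fst dP[OF that]]
    by (simp add: has_real_derivative_iff_has_vector_derivative f_def[abs_def])
  have mono: "f x < f y" if "x \<in> I" "y \<in> I" "x < y" for x y
  proof (rule DERIV_pos_imp_increasing[OF that(3)])
    fix s assume "x \<le> s" "s \<le> y"
    then have "s \<in> I" using that by (auto simp: I_def)
    with df A0 show "\<exists>d. (f has_real_derivative d) (at s) \<and> 0 < d" by blast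
  qed
  have inj: "inj_on f I" by (rule inj_onI) (metis linorder_neqE_linordered_idom mono order_less_irrefl)
  have contf: "continuous_on I f" using df by (meson DERIV_isCont continuous_at_imp_continuous_on)
  define g where "g = inv_into I f"
  have gf: "g (f s) = s" if "s \<in> I" for s using that inj by (simp add: g_def)
  have dg: "(g has_vector_derivative 1 / fst (A s)) (at (f s))" if s: "s \<in> I" for s
  proof -
    have "(g has_derivative (\<lambda>x. x / fst (A s))) (at (f s))"
      by (rule has_derivative_inverse_strong[of I s f g "\<lambda>x. fst (A s) * x", OF _ s contf gf])
        (use df[OF s] A0[OF s] in \<open>auto simp: I_def has_field_derivative_def o_def\<close>)
    then show ?thesis by (simp add: has_vector_derivative_def)
  qed
  define Y where "Y t = snd (Phi (a + g t *\<^sub>R w))" for t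
  have I: "{0..T} \<subseteq> I" using e by (auto simp: I_def)
  have 0: "0 \<in> I" "T \<in> I" using e T by (auto simp: I_def)
  have ex: "\<exists>s\<in>{0..T}. f s = t" if "t \<in> {f 0..f T}" for t
    using IVT'[of f 0 t T] that T continuous_on_subset[OF contf I] by auto
  show ?thesis
  proof (rule that[of Y])
    show "fst (Phi a) < fst (Phi (a + T *\<^sub>R w))" using mono[OF 0 T] by (simp add: f_def)
    show "Y (fst (Phi a)) = snd (Phi a)" using gf[OF 0(1)] by (simp add: Y_def f_def)
    show "Y (fst (Phi (a + T *\<^sub>R w))) = snd (Phi (a + T *\<^sub>R w))" using gf[OF 0(2)] by (simp add: Y_def f_def)
    fix t assume t: "t \<in> {fst (Phi a)..fst (Phi (a + T *\<^sub>R w))}"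
    then obtain s where s: "s \<in> {0..T}" "f s = t" using ex[of t] by (auto simp: f_def)
    have sI: "s \<in> I" using s I by auto
    have "Phi (a + s *\<^sub>R w) = (t, Y t)" using s gf[OF sI] by (auto simp: f_def Y_def prod_eq_iff)
    with s show "\<exists>s\<in>{0..T}. Phi (a + s *\<^sub>R w) = (t, Y t)" by blast
    have "((\<lambda>s. Phi (a + s *\<^sub>R w)) has_vector_derivative A s) (at (g t))" using dP[OF sI] gf[OF sI] s by simp
    from bounded_linear.has_vector_derivative[OF bounded_linear_snd this]
    have "((\<lambda>s. snd (Phi (a + s *\<^sub>R w))) has_vector_derivative snd (A s)) (at (g t))" .
    from vector_diff_chain_at[OF dg[OF sI], unfolded s(2), OF this]
    have "(Y has_vector_derivative (1 / fst (A s)) *\<^sub>R snd (A s)) (at t)"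
      by (simp add: o_def Y_def[abs_def])
    moreover have "future_timelike p t ((1 / fst (A s)) *\<^sub>R A s)" using future_timelike_scale[OF _ fA[OF sI]] A0[OF sI] s by simp
    moreover have "(1 / fst (A s)) *\<^sub>R A s = (1, (1 / fst (A s)) *\<^sub>R snd (A s))"
      using A0[OF sI] by (simp add: prod_eq_iff)
    ultimately show "\<exists>v. (Y has_vector_derivative v) (at t) \<and> future_timelike p t (1, v)" by metis
  qed
qed

lemma derivative_timelike_graph:
  assumes "\<And>t. t \<in> {a..b} \<Longrightarrow> \<exists>v. (Y has_vector_derivative v) (at t) \<and> future_timelike p t (1, v)"
  shows "timelike_graph p Y a b"
  unfolding timelike_graph_def
proof (intro conjI allI impI)
  show "continuous_on {a..b} Y"
    by (meson assms continuous_at_imp_continuous_on has_vector_derivative_continuous)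
  show "\<exists>v. (Y has_vector_derivative v) (at t within {t..}) \<and> future_timelike p t (1, v)" if "a \<le> t \<and> t < b" for t
    using assms[of t] that by (auto intro: has_vector_derivative_at_within)
qed

end

section \<open>No boundary points towards the future\<close>

text \<open>Starting earlier by the amount t0 - th, the curve can afford to be slower by a constant
  factor in the time variable t powr (1 + m); its proper length is then of order
  tn powr ((1 - m) / 2).\<close>
lemma delayed_curve:
  fixes Y :: "real \<Rightarrow> real^'n::finite"
  assumes t: "0 < th" "th < t0" "t0 < tn" and m: "0 \<le> m" "\<And>i. - p i \<le> m"
    and Y: "\<And>t. t \<in> {t0..tn} \<Longrightarrow> \<exists>v. (Y has_vector_derivative v) (at t) \<and> future_timelike p t (1, v)"
    and e_def: "e = (t0 powr (1 + m) - th powr (1 + m)) / (tn powr (1 + m) - th powr (1 + m))"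
  shows "\<exists>k. k th = Y t0 \<and> k tn = Y tn \<and>
    (\<forall>t\<in>{th..tn}. \<exists>v. (k has_vector_derivative v) (at t) \<and>
        (\<Sum>i\<in>UNIV. t powr (2 * p i) * (v $ i)\<^sup>2) \<le> 1 - e)"
proof -
  define M where "M = 1 + m"
  \<comment> \<open>Affine in \<open>t powr M\<close> with slope \<open>1 - e\<close> and fixed at
    \<open>tn\<close>. The value of \<open>e\<close> is the one that gives
    \<open>b th = t0 powr M\<close>, so that \<open>th'\<close> maps \<open>th\<close> to
    \<open>t0\<close>.\<close>
  define b where "b t = tn powr M - (1 - e) * (tn powr M - t powr M)" for t
  define th' where "th' t = b t powr (1 / M)" for t
  have M: "M > 0" using m by (simp add: M_def)
  have pw: "th powr M < t0 powr M" "t0 powr M < tn powr M" using t M by (auto intro: powr_less_mono2)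
  have e: "0 < e" "e < 1" using pw by (auto simp: e_def M_def field_simps)
  have bth: "b th = t0 powr M"
  proof -
    have "e * (tn powr M - th powr M) = t0 powr M - th powr M" using pw by (simp add: e_def M_def)
    then show ?thesis by (simp add: b_def algebra_simps)
  qed
  have btn: "b tn = tn powr M" by (simp add: b_def)
  have ends: "th' th = t0" "th' tn = tn" using t M by (simp_all add: th'_def bth btn powr_powr)
  have b_bounds: "t powr M \<le> b t" "t0 powr M \<le> b t" "b t \<le> tn powr M" if "t \<in> {th..tn}" for t
  proof -
    have tM: "th powr M \<le> t powr M" "t powr M \<le> tn powr M" using that t M by (auto intro: powr_mono2)
    have "(1 - e) * (tn powr M - t powr M) \<le> 1 * (tn powr M - t powr M)"
      by (rule mult_right_mono) (use e tM in auto)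
    then show "t powr M \<le> b t" by (simp add: b_def)
    have "(1 - e) * (tn powr M - t powr M) \<le> (1 - e) * (tn powr M - th powr M)"
      by (rule mult_left_mono) (use e tM in auto)
    then show "t0 powr M \<le> b t" unfolding bth[symmetric] by (simp add: b_def)
    show "b t \<le> tn powr M" using e tM by (simp add: b_def)
  qed
  have th_bounds: "t \<le> th' t" "th' t \<in> {t0..tn}" if t': "t \<in> {th..tn}" for t
  proof -
    have 1: "x \<le> th' t" if "x powr M \<le> b t" "x > 0" for x
    proof -
      have "(x powr M) powr (1 / M) \<le> b t powr (1 / M)" using that M by (intro powr_mono2) auto
      then show ?thesis using that M by (simp add: powr_powr th'_def)
    qed
    show "t \<le> th' t" using 1 b_bounds[OF t'] t' t by auto
    have "b t powr (1 / M) \<le> (tn powr M) powr (1 / M)"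
      by (rule powr_mono2) (use b_bounds[OF t'] M order_trans[OF powr_ge_zero b_bounds(2)[OF t']] in auto)
    then have "th' t \<le> tn" using t M by (simp add: powr_powr th'_def)
    then show "th' t \<in> {t0..tn}" using 1[of t0] b_bounds[OF t'] t by auto
  qed
  have dth: "(th' has_real_derivative (1 - e) * t powr m * th' t powr (- m)) (at t)" if t': "t \<in> {th..tn}" for t
  proof -
    have tp: "t > 0" using t' t by auto
    have bp: "b t > 0" using less_le_trans[OF _ b_bounds(1)[OF t'], of 0] tp by simp
    have "(b has_real_derivative (1 - e) * (M * t powr (M - 1))) (at t)"
      unfolding b_def using tp by (auto intro!: derivative_eq_intros simp: powr_diff)
    from DERIV_chain2[OF has_real_derivative_powr[OF bp, of "1 / M"] this]
    have "(th' has_real_derivative 1 / M * b t powr (1 / M - 1) * ((1 - e) * (M * t powr (M - 1)))) (at t)"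
      by (simp add: th'_def[abs_def])
    moreover have "b t powr (1 / M - 1) = th' t powr (- m)"
    proof -
      have "1 / M - 1 = 1 / M * (- m)" using M by (simp add: M_def field_simps)
      then show ?thesis by (simp add: th'_def powr_powr)
    qed
    ultimately show ?thesis using M by (simp add: M_def mult_ac)
  qed
  show ?thesis
  proof (intro exI[of _ "\<lambda>t. Y (th' t)"] conjI ballI)
    show "Y (th' th) = Y t0" "Y (th' tn) = Y tn" by (simp_all add: ends)
    fix t assume t': "t \<in> {th..tn}"
    obtain v where v: "(Y has_vector_derivative v) (at (th' t))" "future_timelike p (th' t) (1, v)"
      using Y[OF th_bounds(2)[OF t']] by blast
    define d where "d = (1 - e) * t powr m * th' t powr (- m)"
    have "(th' has_vector_derivative d) (at t)"
      using dth[OF t'] by (simp add: has_real_derivative_iff_has_vector_derivative d_def)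
    from vector_diff_chain_at[OF this v(1)]
    have 1: "((\<lambda>t. Y (th' t)) has_vector_derivative d *\<^sub>R v) (at t)" by (simp add: o_def)
    have tp: "t > 0" "th' t > 0" using t' t th_bounds(2)[OF t'] by auto
    \<comment> \<open>The slowdown \<open>d\<close> equals
      \<open>(1 - e) * (t / th' t) powr m\<close>. Its square combines with the metric coefficient
      to the power \<open>2 * (p i + m)\<close> of \<open>t\<close>; this exponent is nonnegative
      even for negative \<open>p i\<close>, so \<open>t\<close> may be replaced by the larger
      \<open>th' t\<close>.\<close>
    have tm: "t powr (2 * p i) * ((d *\<^sub>R v) $ i)\<^sup>2 \<le> (1 - e) * (th' t powr (2 * p i) * (v $ i)\<^sup>2)" for i
    proof -
      have "t powr (2 * p i) * d\<^sup>2 = (1 - e)\<^sup>2 * (t powr (2 * (p i + m)) * th' t powr (- (2 * m)))"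
      proof -
        have sq: "(x powr y)\<^sup>2 = x powr (2 * y)" for x y :: real
          unfolding power2_eq_square powr_add[symmetric] by simp
        show ?thesis unfolding d_def power_mult_distrib sq by (simp add: powr_add distrib_left)
      qed
      also have "\<dots> \<le> (1 - e)\<^sup>2 * (th' t powr (2 * (p i + m)) * th' t powr (- (2 * m)))"
        by (intro mult_left_mono mult_right_mono powr_mono2)
          (use m(2)[of i] tp th_bounds(1)[OF t'] in auto)
      also have "\<dots> = (1 - e)\<^sup>2 * th' t powr (2 * p i)" by (simp add: distrib_left flip: powr_add)
      also have "\<dots> \<le> (1 - e) * th' t powr (2 * p i)"
        by (rule mult_right_mono) (use e in \<open>auto simp: power2_eq_square mult_left_le_one_le\<close>)
      finally have "t powr (2 * p i) * d\<^sup>2 * (v $ i)\<^sup>2 \<le> (1 - e) * th' t powr (2 * p i) * (v $ i)\<^sup>2"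
        by (rule mult_right_mono) simp
      then show ?thesis by (simp add: power_mult_distrib mult_ac)
    qed
    have "(\<Sum>i\<in>UNIV. t powr (2 * p i) * ((d *\<^sub>R v) $ i)\<^sup>2) \<le> (1 - e) * (\<Sum>i\<in>UNIV. th' t powr (2 * p i) * (v $ i)\<^sup>2)"
      unfolding sum_distrib_left by (rule sum_mono) (rule tm)
    also have "\<dots> \<le> (1 - e) * 1" by (rule mult_left_mono) (use v(2) e in \<open>auto simp: future_timelike_def\<close>)
    finally show "\<exists>v. ((\<lambda>t. Y (th' t)) has_vector_derivative v) (at t) \<and>
        (\<Sum>i\<in>UNIV. t powr (2 * p i) * (v $ i)\<^sup>2) \<le> 1 - e"
      using 1 by auto
  qed
qed

context kasner_chart
begin

text \<open>The slack \<open>e\<close> forces \<open>b3 * (l b)\<^sup>2 \<ge> e\<close> for the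
  lifted velocity \<open>b\<close>, so the height grows at rate at least
  \<open>sqrt (e / b3)\<close> per unit of Kasner time. Half of this rate is claimed, to have a
  strictly positive derivative.\<close>

lemma lift_length:
  assumes t: "t1 \<le> t2" "0 < e"
    and k: "\<And>t. t \<in> {t1..t2} \<Longrightarrow> \<exists>v. (k has_vector_derivative v) (at t) \<and> (\<Sum>i\<in>UNIV. t powr (2 * p i) * (v $ i)\<^sup>2) \<le> 1 - e"
    and W: "\<And>t. t \<in> {t1..t2} \<Longrightarrow> (t, k t) \<in> W"
  shows "sqrt (e / b3) / 2 * (t2 - t1) \<le> l (Psi (t2, k t2)) - l (Psi (t1, k t1))"
proof -
  define \<sigma> where "\<sigma> = sqrt (e / b3) / 2"
  have \<sigma>: "\<sigma> < sqrt (e / b3)" using t pos by (simp add: \<sigma>_def)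
  have "l (Psi (t1, k t1)) - \<sigma> * t1 \<le> l (Psi (t2, k t2)) - \<sigma> * t2"
  proof (rule increment_pos_right_derivative[OF t(1), of "\<lambda>t. l (Psi (t, k t)) - \<sigma> * t"])
    have "continuous_on {t1..t2} k"
      by (meson k continuous_at_imp_continuous_on has_vector_derivative_continuous)
    then have "continuous_on {t1..t2} (\<lambda>t. Psi (t, k t))"
      by (intro continuous_on_compose2[OF continuous_Psi]) (use W in \<open>auto intro!: continuous_intros\<close>)
    then show "continuous_on {t1..t2} (\<lambda>t. l (Psi (t, k t)) - \<sigma> * t)" by (intro continuous_intros)
    fix t assume "t1 \<le> t" "t < t2"
    then have t': "t \<in> {t1..t2}" by auto
    obtain v where v: "(k has_vector_derivative v) (at t)" "(\<Sum>i\<in>UNIV. t powr (2 * p i) * (v $ i)\<^sup>2) \<le> 1 - e"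
      using k[OF t'] by blast
    have tW: "(t, k t) \<in> W" using W[OF t'] .
    define b where "b = dPsi (t, k t) (1, v)"
    have "((\<lambda>t. (t, k t)) has_vector_derivative (1, v)) (at t within {t..})"
      by (rule has_vector_derivative_Pair[OF has_vector_derivative_id has_vector_derivative_at_within[OF v(1)]])
    from vector_derivative_diff_chain_within[OF this has_derivative_at_withinI[OF dPsi[OF tW]]]
    have "((\<lambda>t. Psi (t, k t)) has_vector_derivative b) (at t within {t..})" by (simp add: o_def b_def)
    from l.has_vector_derivative[OF this]
    have 1: "((\<lambda>t. l (Psi (t, k t)) - \<sigma> * t) has_vector_derivative l b - \<sigma>) (at t within {t..})"
      by (auto intro!: derivative_eq_intros)
    have g: "kasner_g p (t, k t) (1, v) (1, v) \<le> - e" using v(2) by (simp add: kasner_g_diag)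
    have future_timelike: "future_timelike p t (1, v)" using v(2) t by (simp add: future_timelike_def)
    have lb: "l b > 0" unfolding b_def by (rule l_pos[OF tW]) (simp add: future_timelike)
    have "b4 * (norm (b - l b *\<^sub>R w))\<^sup>2 \<ge> 0" using pos by simp
    then have "e \<le> b3 * (l b)\<^sup>2" using g_lower[OF tW, of "(1, v)"] g by (simp add: b_def)
    then have "e / b3 \<le> (l b)\<^sup>2" using pos by (simp add: divide_le_eq mult.commute)
    then have "sqrt (e / b3) \<le> sqrt ((l b)\<^sup>2)" by (rule real_sqrt_le_mono)
    then have "l b - \<sigma> > 0" using lb \<sigma> by simp
    with 1 show "\<exists>d>0. ((\<lambda>t. l (Psi (t, k t)) - \<sigma> * t) has_vector_derivative d) (at t within {t..})" by blast
  qed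
  then show ?thesis by (simp add: \<sigma>_def[symmetric] algebra_simps)
qed

lemma no_future_boundary:
  assumes s0: "s0 > 0" and axis: "\<And>s. 0 < s \<Longrightarrow> s \<le> s0 \<Longrightarrow> - (s *\<^sub>R w) \<in> Ob"
  shows False
proof -
  \<comment> \<open>A cone of slope \<open>K\<close> and height \<open>2 * s1\<close> has radius at
    most \<open>2 * h / 5\<close>; with a start within \<open>h / 5\<close> of the axis it stays in
    the box.\<close>
  define s1 where "s1 = min s0 (min (h / 5) (h / (5 * K)))"
  have s1: "0 < s1" "s1 \<le> s0" "s1 \<le> h / 5" using s0 pos K_pos by (auto simp: s1_def)
  have "s1 \<le> h / (5 * K)" by (simp add: s1_def)
  then have Ks1: "K * s1 \<le> h / 5" using K_pos by (simp add: field_simps)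
  define q where "q = - (s1 *\<^sub>R w)"
  have q: "q \<in> Ob" using axis s1 by (simp add: q_def)
  define t0 where "t0 = fst (Phi q)"
  define y0 where "y0 = snd (Phi q)"
  have Pq: "Phi q = (t0, y0)" by (simp add: t0_def y0_def)
  have t0: "t0 > 0" using q by (simp add: t0_def Phi_W fst_pos)
  have segq: "q + s *\<^sub>R w \<in> Ob" if "0 \<le> s" "s < s1" for s
    using axis[of "s1 - s"] that s1 by (simp add: q_def algebra_simps)
  \<comment> \<open>Bounded Kasner time along the axis would confine the images to a compact box,
    and \<open>limit_in_Ob\<close> would put the boundary point 0 into \<open>Ob\<close>.\<close>
  have unbounded: "\<exists>s. 0 < s \<and> s < s1 \<and> fst (Phi (- (s *\<^sub>R w))) > N" for N
  proof (rule ccontr)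
    assume "\<not> ?thesis"
    then have le: "fst (Phi (- (s *\<^sub>R w))) \<le> N" if "0 < s" "s < s1" for s using that by force
    \<comment> \<open>Adding 2 keeps the parameter strictly below \<open>s1\<close> already for
      \<open>k = 0\<close>.\<close>
    define y where "y k = - ((s1 / real (k + 2)) *\<^sub>R w)" for k :: nat
    have yk: "0 < s1 / real (k + 2)" "s1 / real (k + 2) < s1" for k
      using s1 mult_strict_left_mono[of 1 "real (k + 2)" s1] by (simp_all add: divide_less_eq)
    have j: "causal_bound p (Phi q) (Phi (y k))" for k
      using vertical_causal_bound[of "s1 - s1 / real (k + 2)" q] segq yk[of k]
      by (simp add: y_def q_def algebra_simps)
    have "0 \<in> Ob"
    proof (rule limit_in_Ob[of y 0 "{t0..N} \<times> cball y0 (\<Sum>i\<in>UNIV. N powr (1 - p i) / (1 - p i))"])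
      show "y k \<in> Ob" for k using axis[of "s1 / real (k + 2)"] yk[of k] s1 by (simp add: y_def)
      have "(\<lambda>k. s1 / real (k + 2)) \<longlonglongrightarrow> 0"
        using LIMSEQ_ignore_initial_segment[OF lim_const_over_n[of s1], of 2] by simp
      then have "y \<longlonglongrightarrow> - (0 *\<^sub>R w)" unfolding y_def by (intro tendsto_intros)
      then show "y \<longlonglongrightarrow> 0" by simp
      show "0 \<in> Om" using pos by (simp add: Om_def lP_simps)
      show "compact ({t0..N} \<times> cball y0 (\<Sum>i\<in>UNIV. N powr (1 - p i) / (1 - p i)))"
        "{t0..N} \<times> cball y0 (\<Sum>i\<in>UNIV. N powr (1 - p i) / (1 - p i)) \<subseteq> kasner_M"
        by (rule spatial_box_compact[OF t0])+
      fix k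
      have N: "fst (Phi (y k)) \<le> N" using le yk[of k] by (simp add: y_def)
      have "norm (snd (Phi (y k)) - y0) \<le> (\<Sum>i\<in>UNIV. N powr (1 - p i) / (1 - p i))"
        using causal_bound_bounded_spatial[OF p_less j _ N] t0 by (simp add: Pq)
      then show "Phi (y k) \<in> {t0..N} \<times> cball y0 (\<Sum>i\<in>UNIV. N powr (1 - p i) / (1 - p i))"
        using N j[of k] by (simp add: mem_Times_iff dist_norm norm_minus_commute causal_bound_def Pq)
    qed
    then show False using zero_notin_Ob by simp
  qed
  define V where "V = W \<inter> Psi -` {x. \<bar>l x\<bar> < 2 * s1 \<and> norm (Pr x) < h / 5}"
  have "open V" unfolding V_def
    by (rule continuous_open_preimage[OF continuous_Psi W_open])
      (intro open_Collect_conj open_Collect_less continuous_intros)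
  moreover have "(t0, y0) \<in> V"
    using Phi_W[OF q, unfolded Pq] Psi_Phi[OF q, unfolded Pq] s1 pos by (simp add: V_def q_def lP_simps)
  ultimately obtain e where e: "e > 0" "ball (t0, y0) e \<subseteq> V" using open_contains_ball by blast
  \<comment> \<open>The comoving line through the Kasner image of \<open>q\<close> is followed
    backwards a little; this head start is the slack spent in \<open>delayed_curve\<close>.\<close>
  define th where "th = t0 - e / 2"
  have thV: "(t, y0) \<in> V" if "t \<in> {th..t0}" for t
  proof -
    have "(t, y0) \<in> ball (t0, y0) e" using that e by (simp add: th_def dist_Pair_Pair dist_real_def)
    then show ?thesis using e by blast
  qed
  have thW: "(t, y0) \<in> W" if "t \<in> {th..t0}" for t using thV[OF that] by (simp add: V_def)
  have th: "0 < th" "th < t0" using fst_pos[OF thW[of th]] e by (auto simp: th_def)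
  define x1 where "x1 = Psi (th, y0)"
  have x1: "\<bar>l x1\<bar> < 2 * s1" "norm (Pr x1) < h / 5" using thV[of th] th by (auto simp: V_def x1_def)
  obtain m where m: "0 \<le> m" "m < 1" "\<And>i. - p i \<le> m"
  proof (rule that[of "max 0 (Max (range (\<lambda>i. - p i)))"])
    have "Max (range (\<lambda>i. - p i)) < 1" using p_gt by (subst Max_less_iff) (auto simp: minus_less_iff)
    then show "max 0 (Max (range (\<lambda>i. - p i))) < 1" by simp
    show "- p i \<le> max 0 (Max (range (\<lambda>i. - p i)))" for i
      by (rule order_trans[OF Max_ge max.cobounded2]) auto
  qed simp
  define D where "D = t0 powr (1 + m) - th powr (1 + m)"
  have D: "D > 0" using th m by (simp add: D_def powr_less_mono2)
  \<comment> \<open>Chosen so that \<open>tn > X\<close> violates the final estimate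
    \<open>D * tn powr (1 - m) \<le> 4 * b3 * h\<^sup>2\<close>; the power can be inverted because
    \<open>m < 1\<close>.\<close>
  define X where "X = (4 * b3 * h\<^sup>2 / D + 1) powr (1 / (1 - m))"
  obtain s where s: "0 < s" "s < s1" "fst (Phi (- (s *\<^sub>R w))) > max (2 * t0) X"
    using unbounded by blast
  define tn where "tn = fst (Phi (- (s *\<^sub>R w)))"
  have tn: "tn > 2 * t0" "tn > X" using s by (auto simp: tn_def)
  have qs: "q + (s1 - s) *\<^sub>R w = - (s *\<^sub>R w)" by (simp add: q_def algebra_simps)
  obtain Y where Y: "\<And>t. t \<in> {t0..tn} \<Longrightarrow> \<exists>s'\<in>{0..s1 - s}. Phi (q + s' *\<^sub>R w) = (t, Y t)"
    "Y t0 = y0" "Y tn = snd (Phi (- (s *\<^sub>R w)))"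
    "\<And>t. t \<in> {t0..tn} \<Longrightarrow> \<exists>v. (Y has_vector_derivative v) (at t) \<and> future_timelike p t (1, v)"
    by (rule vertical_timelike_graph[of "s1 - s" q, unfolded qs, folded tn_def t0_def y0_def])
      (use s segq in auto)
  define \<epsilon> where "\<epsilon> = (t0 powr (1 + m) - th powr (1 + m)) / (tn powr (1 + m) - th powr (1 + m))"
  have tn0: "t0 < tn" using tn t0 by simp
  obtain k where k: "k th = Y t0" "k tn = Y tn"
    "\<And>t. t \<in> {th..tn} \<Longrightarrow> \<exists>v. (k has_vector_derivative v) (at t) \<and>
        (\<Sum>i\<in>UNIV. t powr (2 * p i) * (v $ i)\<^sup>2) \<le> 1 - \<epsilon>"
    using delayed_curve[OF th tn0 m(1,3) Y(4) \<epsilon>_def] by blast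
  have thtn: "th powr (1 + m) < tn powr (1 + m)" using th tn0 m by (intro powr_less_mono2) auto
  have eps: "\<epsilon> > 0" using D thtn by (simp add: \<epsilon>_def D_def)
  have kc: "timelike_graph p k th tn"
  proof (rule derivative_timelike_graph)
    fix t assume "t \<in> {th..tn}"
    from k(3)[OF this] obtain v where v: "(k has_vector_derivative v) (at t)"
      "(\<Sum>i\<in>UNIV. t powr (2 * p i) * (v $ i)\<^sup>2) \<le> 1 - \<epsilon>" by blast
    then have "future_timelike p t (1, v)" using eps by (simp add: future_timelike_def)
    with v show "\<exists>v. (k has_vector_derivative v) (at t) \<and> future_timelike p t (1, v)" by blast
  qed
  \<comment> \<open>The reference curve with the same ends as \<open>k\<close>: at rest until
    \<open>t0\<close>, then along the Kasner image of the axis. It lies in \<open>W\<close>, and the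
    homotopy carries this over to \<open>k\<close>.\<close>
  define c where "c = (\<lambda>t. if t < t0 then y0 else Y t)"
  have cc: "timelike_graph p c th tn" unfolding c_def
    by (rule timelike_graph_concat[OF timelike_graph_const derivative_timelike_graph[OF Y(4)]]) (use Y th tn0 in auto)
  have endp: "(tn, Y tn) = Phi (- (s *\<^sub>R w))" unfolding Y(3) by (simp add: tn_def)
  have sO: "- (s *\<^sub>R w) \<in> Ob" using axis s s1 by simp
  have kW: "(t, k t) \<in> W" if "t \<in> {th..tn}" for t
  proof (rule homotopy_in_W[OF th(1) _ cc kc, of 0])
    show "c th = k th" using th k Y by (simp add: c_def)
    fix t assume t: "t \<in> {th..tn}"
    show "(t, c t) \<in> W"
    proof (cases "t < t0")
      case True then show ?thesis using thW t by (simp add: c_def)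
    next
      case False
      then obtain s' where "s' \<in> {0..s1 - s}" "Phi (q + s' *\<^sub>R w) = (t, Y t)" using Y(1)[of t] t by auto
      moreover from this have "Phi (q + s' *\<^sub>R w) \<in> W" using segq s by (intro Phi_W) auto
      ultimately show ?thesis using False by (simp add: c_def)
    qed
  next
    fix r :: real
    have *: "c tn + r *\<^sub>R (k tn - c tn) = Y tn" using tn0 k by (simp add: c_def)
    show "(tn, c tn + r *\<^sub>R (k tn - c tn)) \<in> W" unfolding * endp by (rule Phi_W[OF sO])
    show "l (Psi (tn, c tn + r *\<^sub>R (k tn - c tn))) \<le> 0"
      unfolding * endp Psi_Phi[OF sO] using s by (simp add: lP_simps)
  next
    fix x assume x: "x - Psi (th, c th) \<in> Cone" "l x \<le> 0"
    have "c th = y0" using th by (simp add: c_def)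
    then have x: "norm (Pr x - Pr x1) \<le> K * (l x - l x1)" "l x \<le> 0" "0 \<le> l x - l x1"
      using x Cone_l[OF x(1)] by (auto simp: Cone_def x1_def lP_simps)
    have "K * (l x - l x1) \<le> K * (2 * s1)" by (rule mult_left_mono) (use x x1 K_pos in auto)
    then have "norm (Pr x - Pr x1) \<le> 2 * (h / 5)" using x(1) Ks1 by simp
    then have "norm (Pr x) < h" using norm_triangle_sub[of "Pr x" "Pr x1"] x1 pos(1) by linarith
    moreover have "\<bar>l x\<bar> < h" using x x1 s1 pos by linarith
    ultimately show "x \<in> Om" by (simp add: Om_def)
  qed (use that th tn0 in auto)
  \<comment> \<open>The slack \<open>\<epsilon>\<close> is at least
    \<open>D / tn powr (1 + m)\<close>, whereas the squared elapsed time is at least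
    \<open>(tn / 2)\<^sup>2\<close>. As \<open>m < 1\<close>, a height difference of at most
    \<open>h / 2\<close> becomes impossible for large \<open>tn\<close>.\<close>
  have "sqrt (\<epsilon> / b3) / 2 * (tn - th) \<le> l (Psi (tn, k tn)) - l (Psi (th, k th))"
    by (rule lift_length[OF _ eps k(3) kW]) (use th tn0 in auto)
  also have "\<dots> = - s - l x1" using k Y endp Psi_Phi[OF sO] by (simp add: x1_def lP_simps)
  also have "\<dots> \<le> h / 2" using x1 s s1 by linarith
  finally have 1: "sqrt (\<epsilon> / b3) * (tn - th) \<le> h" by simp
  have "(sqrt (\<epsilon> / b3) * (tn - th))\<^sup>2 \<le> h\<^sup>2"
    by (rule power_mono[OF 1]) (use eps pos th tn0 in auto)
  then have "\<epsilon> / b3 * (tn - th)\<^sup>2 \<le> h\<^sup>2" using eps pos by (simp add: power_mult_distrib)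
  then have "b3 * (\<epsilon> / b3 * (tn - th)\<^sup>2) \<le> b3 * h\<^sup>2" using pos by (intro mult_left_mono) auto
  then have 2: "\<epsilon> * (tn - th)\<^sup>2 \<le> b3 * h\<^sup>2" using pos by simp
  have "(tn / 2)\<^sup>2 \<le> (tn - th)\<^sup>2" by (rule power_mono) (use tn th t0 in auto)
  moreover have "D / tn powr (1 + m) \<le> \<epsilon>"
    unfolding \<epsilon>_def D_def[symmetric] by (rule divide_left_mono) (use D thtn th tn0 in \<open>auto intro!: mult_pos_pos\<close>)
  ultimately have "D / tn powr (1 + m) * (tn / 2)\<^sup>2 \<le> \<epsilon> * (tn - th)\<^sup>2"
    by (intro mult_mono) (use eps in auto)
  with 2 have 3: "D / tn powr (1 + m) * (tn / 2)\<^sup>2 \<le> b3 * h\<^sup>2" by linarith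
  have tnp: "tn > 0" using tn0 t0 by simp
  have "tn\<^sup>2 = tn powr (1 - m) * tn powr (1 + m)" using tnp by (simp flip: powr_add)
  then have "D / tn powr (1 + m) * (tn / 2)\<^sup>2 = D * tn powr (1 - m) / 4" using tnp by (simp add: power_divide)
  with 3 have "D * tn powr (1 - m) \<le> 4 * b3 * h\<^sup>2" by linarith
  then have 4: "tn powr (1 - m) \<le> 4 * b3 * h\<^sup>2 / D" using D by (simp add: field_simps)
  have base: "4 * b3 * h\<^sup>2 / D + 1 > 0" using pos D by (simp add: add_nonneg_pos)
  have "X powr (1 - m) \<le> tn powr (1 - m)" by (rule powr_mono2) (use tn m in \<open>auto simp: X_def\<close>)
  moreover have "X powr (1 - m) = 4 * b3 * h\<^sup>2 / D + 1" using base m by (simp add: X_def powr_powr)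
  ultimately show False using 4 by linarith
qed

end

section \<open>No boundary points towards the past\<close>

text \<open>The bound \<open>2 * r \<le> \<kappa> * eta\<close> puts 0 into the narrow diamond
  between heights \<open>- eta\<close> and \<open>eta\<close> over any point of the disc, see
  \<open>D_lower\<close>; the bounds by \<open>h\<close> leave room in the box for diamonds and wide
  cones.\<close>

locale kasner_past = kasner_chart +
  fixes eta r :: real
  assumes eta: "0 < eta" "6 * eta < h" "4 * (K * eta) < h" and r: "0 < r" "2 * r \<le> \<kappa> * eta"
    and slab: "\<And>x. eta \<le> l x \<Longrightarrow> l x \<le> 2 * eta \<Longrightarrow> norm (Pr x) \<le> r \<Longrightarrow> x \<in> Ob"
    and axis: "\<And>s. 0 < s \<Longrightarrow> s \<le> 2 * eta \<Longrightarrow> s *\<^sub>R w \<in> Ob"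
begin

lemma r_le: "2 * r \<le> eta"
  using r mult_right_mono[OF kappa_le, of eta] eta by linarith

text \<open>D is the region below the base disc {l x = 2 * eta, norm (Pr x) < r} reached along vertical
  segments inside the image of the spacetime; the boundary lies at smaller values of l.\<close>
definition D :: "(real \<times> (real ^ 'a)) set" where
  "D = {x. norm (Pr x) < r \<and> l x < 2 * eta \<and> (\<forall>s. l x \<le> s \<and> s \<le> 2 * eta \<longrightarrow> Pr x + s *\<^sub>R w \<in> Ob)}"

lemma Pr_shift: "Pr x + (l x + s) *\<^sub>R w = x + s *\<^sub>R w" by (simp add: Pr_def algebra_simps)

lemma D_bounds: "x \<in> D \<Longrightarrow> norm (Pr x) < r \<and> l x < 2 * eta" by (simp add: D_def)

lemma D_seg: "x \<in> D \<Longrightarrow> 0 \<le> s \<Longrightarrow> l x + s \<le> 2 * eta \<Longrightarrow> x + s *\<^sub>R w \<in> Ob"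
proof -
  assume "x \<in> D" "0 \<le> s" "l x + s \<le> 2 * eta"
  then have "Pr x + (l x + s) *\<^sub>R w \<in> Ob" unfolding D_def by force
  then show ?thesis by (simp add: Pr_shift)
qed

lemma D_Ob: "x \<in> D \<Longrightarrow> x \<in> Ob"
  using D_seg[of x 0] D_bounds[of x] by simp

lemma D_up: "x \<in> D \<Longrightarrow> 0 \<le> s \<Longrightarrow> l x + s < 2 * eta \<Longrightarrow> x + s *\<^sub>R w \<in> D"
  by (auto simp: D_def lP_simps)

lemma D_down:
  assumes x: "x \<in> D" and s: "0 \<le> s" "\<And>s'. 0 \<le> s' \<Longrightarrow> s' \<le> s \<Longrightarrow> x - s' *\<^sub>R w \<in> Ob"
  shows "x - s *\<^sub>R w \<in> D"
proof -
  have "Pr x + s' *\<^sub>R w \<in> Ob" if s': "l x - s \<le> s'" "s' \<le> 2 * eta" for s'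
  proof (cases "l x \<le> s'")
    case True then show ?thesis using x s' by (simp add: D_def)
  next
    case False
    then have "x - (l x - s') *\<^sub>R w \<in> Ob" using s(2)[of "l x - s'"] s' by simp
    then show ?thesis by (simp add: Pr_def algebra_simps)
  qed
  then show ?thesis using x s by (auto simp: D_def lP_simps)
qed

text \<open>Otherwise the vertical segment between heights \<open>- eta\<close> and
  \<open>eta\<close> would lie in \<open>Ob\<close>, and its diamond contains 0: halfway up it has
  radius \<open>\<kappa> * eta / 2\<close>, which is at least \<open>r\<close>.\<close>

lemma D_lower: assumes x: "x \<in> D" shows "- eta < l x"
proof (rule ccontr)
  assume "\<not> - eta < l x"
  then have le: "l x \<le> - eta" by simp
  define a where "a = Pr x - eta *\<^sub>R w"
  have la: "l a = - eta" "Pr a = Pr x" by (simp_all add: a_def lP_simps)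
  have "0 \<in> Ob"
  proof (rule diamond[of "2 * eta" a])
    fix s assume s: "s \<in> {0..2 * eta}"
    have "Pr x + (s - eta) *\<^sub>R w \<in> Ob" using x le s eta by (simp add: D_def)
    then show "a + s *\<^sub>R w \<in> Ob" by (simp add: a_def algebra_simps)
  next
    show "norm (Pr (0 - a)) \<le> \<kappa> * (l (0 - a) * (2 * eta - l (0 - a)) / (2 * eta))"
      using D_bounds[OF x] r eta by (simp add: lP_simps la field_simps)
    have "\<kappa> * (2 * eta) \<le> 1 * (2 * eta)" by (rule mult_right_mono[OF kappa_le]) (use eta in simp)
    then show "norm (Pr a) + \<kappa> * (2 * eta) < h" using D_bounds[OF x] r_le eta unfolding la by linarith
  qed (use eta la in \<open>auto simp: lP_simps\<close>)
  then show False using zero_notin_Ob by simp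
qed

lemma open_D: "open D"
proof -
  \<comment> \<open>The vertical segment is rescaled to the unit interval, so that
    \<open>open_Ball_compact\<close> applies although its length depends on
    \<open>x\<close>.\<close>
  define S where "S = {x. \<forall>s\<in>{0..1}. Pr x + (l x + s * (2 * eta - l x)) *\<^sub>R w \<in> Ob}"
  have "open S" unfolding S_def
    by (rule open_Ball_compact[OF compact_Icc open_Ob])
      (auto simp: case_prod_unfold intro!: continuous_intros)
  moreover have "D = {x. norm (Pr x) < r \<and> l x < 2 * eta} \<inter> S"
  proof (intro equalityI subsetI)
    fix x assume x: "x \<in> D"
    have "Pr x + (l x + s * (2 * eta - l x)) *\<^sub>R w \<in> Ob" if "s \<in> {0..1}" for s
    proof -
      define q where "q = s * (2 * eta - l x)"
      have "0 \<le> q" "q \<le> 2 * eta - l x" unfolding q_def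
        using that D_bounds[OF x] by (auto intro!: mult_nonneg_nonneg mult_left_le_one_le)
      then have "l x \<le> l x + q" "l x + q \<le> 2 * eta" by linarith+
      then show ?thesis using x unfolding D_def q_def[symmetric] by blast
    qed
    then show "x \<in> {x. norm (Pr x) < r \<and> l x < 2 * eta} \<inter> S" using D_bounds[OF x] by (simp add: S_def)
  next
    fix x assume x: "x \<in> {x. norm (Pr x) < r \<and> l x < 2 * eta} \<inter> S"
    have "Pr x + s *\<^sub>R w \<in> Ob" if s: "l x \<le> s" "s \<le> 2 * eta" for s
    proof -
      define q where "q = (s - l x) / (2 * eta - l x)"
      have "q \<in> {0..1}" "l x + q * (2 * eta - l x) = s" using x s by (auto simp: q_def field_simps)
      then show ?thesis using x by (auto simp: S_def)
    qed
    then show "x \<in> D" using x by (auto simp: D_def)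
  qed
  moreover have "open {x. norm (Pr x) < r \<and> l x < 2 * eta}"
    by (intro open_Collect_conj open_Collect_less continuous_intros)
  ultimately show ?thesis by auto
qed

text \<open>The diamond spans less than \<open>3 * eta\<close> in height, and
  \<open>l y \<le> eta\<close> leaves at least \<open>eta\<close> above \<open>y\<close>; hence the
  quadratic expression in \<open>diamond\<close> is at least \<open>\<rho> / 3\<close>.\<close>

lemma D_diamond:
  assumes a: "a \<in> D" and y: "0 < \<rho>" "\<rho> \<le> l (y - a)" "l y \<le> eta" "norm (Pr (y - a)) \<le> \<kappa> * (\<rho> / 3)"
  shows "y \<in> Ob"
proof (rule diamond[of "2 * eta - l a" a])
  have la: "- eta < l a" "l a < 2 * eta" using D_lower[OF a] D_bounds[OF a] by auto
  show "a + s *\<^sub>R w \<in> Ob" if "s \<in> {0..2 * eta - l a}" for s using D_seg[OF a] that by simp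
  show "0 < l (y - a)" "l (y - a) < 2 * eta - l a" "0 < 2 * eta - l a" using y la eta by (auto simp: l.diff)
  have "\<rho> / 3 \<le> l (y - a) * (2 * eta - l a - l (y - a)) / (2 * eta - l a)"
  proof -
    have "\<rho> * (2 * eta - l a) \<le> l (y - a) * (3 * eta)" by (rule mult_mono) (use y la eta in auto)
    also have "\<dots> \<le> l (y - a) * (3 * (2 * eta - l a - l (y - a)))"
      by (rule mult_left_mono) (use y la eta in \<open>auto simp: l.diff\<close>)
    finally show ?thesis using la by (simp add: field_simps)
  qed
  then have "\<kappa> * (\<rho> / 3) \<le> \<kappa> * (l (y - a) * (2 * eta - l a - l (y - a)) / (2 * eta - l a))"
    using kappa_pos by (intro mult_left_mono) auto
  then show "norm (Pr (y - a)) \<le> \<kappa> * (l (y - a) * (2 * eta - l a - l (y - a)) / (2 * eta - l a))"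
    by (rule order_trans[OF y(4)])
  define q where "q = \<kappa> * (2 * eta - l a)"
  have "q \<le> 2 * eta - l a" unfolding q_def
    by (rule mult_left_le_one_le) (use la kappa_pos kappa_le in auto)
  then show "norm (Pr a) + \<kappa> * (2 * eta - l a) < h"
    using D_bounds[OF a] r_le eta la unfolding q_def[symmetric] by linarith
qed

text \<open>A vertical segment could be lost in the limit only by touching the boundary. Moving some
  \<open>X n\<close> slightly down gives a point \<open>a\<close> of \<open>D\<close> whose diamond
  contains the part of the vertical line above \<open>x\<close> up to height \<open>eta\<close>; the
  slab covers the rest.\<close>

lemma D_closed:
  assumes X: "\<And>n::nat. X n \<in> D" "X \<longlonglongrightarrow> x" and x: "x \<in> Ob" "norm (Pr x) < r" "l x < 2 * eta"
  shows "x \<in> D"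
proof -
  obtain e where e: "e > 0" "ball x e \<subseteq> Ob" using open_Ob x open_contains_ball by blast
  define d where "d = e / (2 * (norm w + 1))"
  have d: "d > 0" "d * norm w < e / 2"
    using e by (auto simp: d_def field_simps add_pos_nonneg add_nonneg_pos)
  have "(\<lambda>n. Pr (X n)) \<longlonglongrightarrow> Pr x" "(\<lambda>n. l (X n)) \<longlonglongrightarrow> l x"
    by (intro Pr.tendsto l.tendsto X)+
  then have "\<forall>\<^sub>F n in sequentially. dist (X n) x < e / 2 \<and> dist (Pr (X n)) (Pr x) < \<kappa> * (d / 2 / 3) \<and> dist (l (X n)) (l x) < d / 2"
    using X(2) e d kappa_pos by (intro eventually_conj tendstoD) auto
  then obtain n where n: "dist (X n) x < e / 2" "dist (Pr (X n)) (Pr x) < \<kappa> * (d / 2 / 3)" "dist (l (X n)) (l x) < d / 2"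
    using eventually_happens by force
  define a where "a = X n - d *\<^sub>R w"
  have aD: "a \<in> D" unfolding a_def
  proof (rule D_down[OF X(1)])
    fix s assume s: "0 \<le> s" "s \<le> d"
    have "dist (X n - s *\<^sub>R w) x = norm ((X n - x) - s *\<^sub>R w)" by (simp add: dist_norm algebra_simps)
    also have "\<dots> \<le> dist (X n) x + norm (s *\<^sub>R w)" unfolding dist_norm by (rule norm_triangle_ineq4)
    also have "norm (s *\<^sub>R w) \<le> d * norm w" using s by (simp add: mult_right_mono)
    finally have "dist (X n - s *\<^sub>R w) x < e" using n d by simp
    then show "X n - s *\<^sub>R w \<in> Ob" using e by (auto simp: dist_commute)
  qed (use d in simp)
  have "Pr x + s *\<^sub>R w \<in> Ob" if s: "l x \<le> s" "s \<le> 2 * eta" for s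
  proof (cases "eta \<le> s")
    case True then show ?thesis using s x by (intro slab) (auto simp: lP_simps)
  next
    case False
    show ?thesis
    proof (rule D_diamond[OF aD, of "d / 2"])
      show "d / 2 \<le> l (Pr x + s *\<^sub>R w - a)" 
      proof -
        have "\<bar>l (X n) - l x\<bar> < d / 2" using n(3) by (simp add: dist_real_def)
        then have "d / 2 \<le> s - l (X n) + d" using s by linarith
        then show ?thesis by (simp only: a_def lP_simps l_Pr) simp
      qed
      show "norm (Pr (Pr x + s *\<^sub>R w - a)) \<le> \<kappa> * (d / 2 / 3)"
        using n(2) by (simp add: a_def lP_simps dist_norm norm_minus_commute)
    qed (use False d in \<open>auto simp: lP_simps\<close>)
  qed
  then show ?thesis using x by (simp add: D_def)
qed

section \<open>Kasner time on \<open>D\<close> and its slices\<close>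

lemma compact_box: "compact {x. a \<le> l x \<and> l x \<le> b \<and> norm (Pr x) \<le> c}"
proof -
  have "closed {x. a \<le> l x \<and> l x \<le> b \<and> norm (Pr x) \<le> c}"
    by (intro closed_Collect_conj closed_Collect_le continuous_intros)
  moreover have "bounded {x. a \<le> l x \<and> l x \<le> b \<and> norm (Pr x) \<le> c}"
  proof (rule boundedI)
    fix x assume x: "x \<in> {x. a \<le> l x \<and> l x \<le> b \<and> norm (Pr x) \<le> c}"
    have "norm x \<le> norm (l x *\<^sub>R w) + norm (Pr x)" by (metis decomp norm_triangle_ineq)
    also have "\<dots> \<le> (\<bar>a\<bar> + \<bar>b\<bar>) * norm w + c"
      using x by (intro add_mono) (auto intro!: mult_right_mono)
    finally show "norm x \<le> (\<bar>a\<bar> + \<bar>b\<bar>) * norm w + c" .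
  qed
  ultimately show ?thesis by (simp add: compact_eq_bounded_closed)
qed

lemma slab_image: "compact (Phi ` {x. eta \<le> l x \<and> l x \<le> 2 * eta \<and> norm (Pr x) \<le> r})"
  by (rule compact_continuous_image[OF continuous_on_subset[OF continuous_Phi] compact_box]) (use slab in auto)

lemma slab_time: obtains \<tau> where "\<tau> > 0"
  "\<And>x. eta \<le> l x \<Longrightarrow> l x \<le> 2 * eta \<Longrightarrow> norm (Pr x) \<le> r \<Longrightarrow> \<tau> \<le> fst (Phi x)"
proof -
  define S where "S = {x. eta \<le> l x \<and> l x \<le> 2 * eta \<and> norm (Pr x) \<le> r}"
  have "compact (fst ` Phi ` S)" unfolding S_def
    by (intro compact_continuous_image slab_image continuous_intros)
  moreover have "eta *\<^sub>R w \<in> S" using eta r by (simp add: S_def lP_simps)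
  ultimately obtain t where t: "t \<in> fst ` Phi ` S" "\<And>t'. t' \<in> fst ` Phi ` S \<Longrightarrow> t \<le> t'"
    by (metis compact_attains_inf empty_iff imageI)
  show ?thesis
  proof (rule that[of t])
    show "t > 0" using t(1) slab by (auto simp: S_def Phi_W fst_pos)
    show "t \<le> fst (Phi x)" if "eta \<le> l x" "l x \<le> 2 * eta" "norm (Pr x) \<le> r" for x
      using t(2)[of "fst (Phi x)"] that by (auto simp: S_def)
  qed
qed

text \<open>A vertical segment joins each \<open>X n\<close> to the top of the slab, whose Kasner
  image is compact. The causal bound along it and the lower bound \<open>t\<close> confine the
  images to a compact box. So within the box \<open>D\<close> can approach the boundary only with
  Kasner time tending to 0.\<close>

lemma D_limit:
  assumes X: "\<And>n::nat. X n \<in> D" "X \<longlonglongrightarrow> x" "x \<in> Om" and t: "t > 0" "\<And>n. t \<le> fst (Phi (X n))"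
  shows "x \<in> Ob"
proof -
  obtain B where B: "\<And>z. z \<in> Phi ` {x. eta \<le> l x \<and> l x \<le> 2 * eta \<and> norm (Pr x) \<le> r} \<Longrightarrow> norm z \<le> B"
    using compact_imp_bounded[OF slab_image] unfolding bounded_iff by blast
  define A where "A = (\<Sum>i\<in>UNIV. B powr (1 - p i) / (1 - p i))"
  show ?thesis
  proof (rule limit_in_Ob[of X x "{t..B} \<times> cball 0 (B + A)", OF D_Ob[OF X(1)] X(2,3)])
    show "compact ({t..B} \<times> cball (0::real^'a) (B + A))" "{t..B} \<times> cball (0::real^'a) (B + A) \<subseteq> kasner_M"
      by (rule spatial_box_compact[OF t(1)])+
    fix n
    define y where "y = X n + (2 * eta - l (X n)) *\<^sub>R w"
    have xb: "norm (Pr (X n)) < r" "l (X n) < 2 * eta" using D_bounds[OF X(1)] by auto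
    have "eta \<le> l y \<and> l y \<le> 2 * eta \<and> norm (Pr y) \<le> r"
      using xb eta by (simp add: y_def lP_simps)
    then have yB: "norm (Phi y) \<le> B" by (intro B) blast
    have j: "causal_bound p (Phi (X n)) (Phi y)" unfolding y_def
      by (rule vertical_causal_bound) (use D_seg[OF X(1)] xb in auto)
    have fB: "fst (Phi y) \<le> B" using yB norm_fst_le[of "fst (Phi y)" "snd (Phi y)"] by simp
    have sB: "norm (snd (Phi y)) \<le> B" using yB norm_snd_le[of "snd (Phi y)" "fst (Phi y)"] by simp
    have "norm (snd (Phi y) - snd (Phi (X n))) \<le> A" unfolding A_def
      by (rule causal_bound_bounded_spatial[OF p_less j _ fB]) (use D_Ob[OF X(1)] in \<open>simp add: Phi_W fst_pos\<close>)
    then have "norm (snd (Phi (X n))) \<le> B + A"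
      using sB norm_triangle_ineq4[of "snd (Phi y)" "snd (Phi y) - snd (Phi (X n))"] by simp
    then show "Phi (X n) \<in> {t..B} \<times> cball 0 (B + A)"
      using t(2)[of n] j fB by (auto simp: mem_Times_iff causal_bound_def)
  qed
qed

lemma D_near_zero: assumes t: "t > 0"
  obtains e where "e > 0" "\<And>x. x \<in> D \<Longrightarrow> norm x < e \<Longrightarrow> fst (Phi x) < t"
proof -
  have "\<exists>e>0. \<forall>x. x \<in> D \<and> norm x < e \<longrightarrow> fst (Phi x) < t"
  proof (rule ccontr)
    assume neg: "\<not> ?thesis"
    have "\<exists>x. x \<in> D \<and> norm x < 1 / real (Suc n) \<and> t \<le> fst (Phi x)" for n
    proof -
      have "1 / real (Suc n) > 0" by simp
      with neg show ?thesis by (meson linorder_not_less)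
    qed
    then obtain X where X: "\<And>n. X n \<in> D" "\<And>n. norm (X n) < 1 / real (Suc n)" "\<And>n. t \<le> fst (Phi (X n))"
      by metis
    have "X \<longlonglongrightarrow> 0"
      by (rule LIMSEQ_norm_0) (use X(2) in simp)
    then have "0 \<in> Ob" by (rule D_limit[OF X(1) _ _ t X(3)]) (use pos in \<open>simp add: Om_def lP_simps\<close>)
    then show False using zero_notin_Ob by simp
  qed
  then show ?thesis using that by blast
qed

text \<open>On the vertical line over \<open>u\<close>, let \<open>m\<close> be the infimum of the
  heights in \<open>D\<close>. If the time stayed above \<open>\<tau>\<close>, then
  \<open>D_limit\<close> and \<open>D_closed\<close> would put \<open>m\<close> itself into the open
  set of these heights. So the time drops to \<open>\<tau>\<close> or below, and the intermediate
  value theorem applies.\<close>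

lemma slice_exists:
  assumes \<tau>: "0 < \<tau>" "\<And>x. eta \<le> l x \<Longrightarrow> l x \<le> 2 * eta \<Longrightarrow> norm (Pr x) \<le> r \<Longrightarrow> \<tau> \<le> fst (Phi x)"
    and u: "l u = 0" "norm u < r"
  shows "\<exists>x\<in>D. Pr x = u \<and> fst (Phi x) = \<tau>"
proof -
  define J where "J = {s. u + s *\<^sub>R w \<in> D}"
  have lu: "l (u + s *\<^sub>R w) = s" "Pr (u + s *\<^sub>R w) = u" for s using u by (simp_all add: lP_simps Pr_eq)
  have J_bd: "- eta < s" "s < 2 * eta" if "s \<in> J" for s
    using D_lower[of "u + s *\<^sub>R w"] D_bounds[of "u + s *\<^sub>R w"] that by (auto simp: J_def lu)
  have slabJ: "u + s *\<^sub>R w \<in> Ob" if "eta \<le> s" "s \<le> 2 * eta" for s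
    using that u by (intro slab) (auto simp: lu)
  have etaJ: "eta \<in> J" using u eta slabJ by (auto simp: J_def D_def lu)
  have J_up: "s' \<in> J" if "s \<in> J" "s \<le> s'" "s' < 2 * eta" for s s'
    using D_up[of "u + s *\<^sub>R w" "s' - s"] that by (simp add: J_def lu algebra_simps)
  have "\<exists>s\<in>J. fst (Phi (u + s *\<^sub>R w)) \<le> \<tau>"
  proof (rule ccontr)
    assume "\<not> ?thesis"
    then have gt: "\<tau> \<le> fst (Phi (u + s *\<^sub>R w))" if "s \<in> J" for s using that by force
    have bdd: "bdd_below J" using J_bd by (meson bdd_below.I less_imp_le)
    define m where "m = Inf J"
    have "m \<in> closure J" unfolding m_def by (rule closure_contains_Inf[OF _ bdd]) (use etaJ in auto)
    then obtain S where S: "\<And>n. S n \<in> J" "S \<longlonglongrightarrow> m" by (auto simp: closure_sequential)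
    have m1: "- eta \<le> m" unfolding m_def by (rule cInf_greatest) (use etaJ J_bd less_imp_le in blast)+
    have m2: "m \<le> eta" unfolding m_def by (rule cInf_lower[OF etaJ bdd])
    note m = m1 m2
    have lim: "(\<lambda>n. u + S n *\<^sub>R w) \<longlonglongrightarrow> u + m *\<^sub>R w" by (intro tendsto_intros S)
    have mO: "u + m *\<^sub>R w \<in> Ob"
      by (rule D_limit[OF _ lim _ \<tau>(1) gt[OF S(1)]])
        (use S m eta u r_le in \<open>auto simp: J_def Om_def lu\<close>)
    have "u + m *\<^sub>R w \<in> D"
      by (rule D_closed[OF _ lim mO]) (use S m eta u in \<open>auto simp: J_def lu\<close>)
    then have "m \<in> J" by (simp add: J_def)
    moreover have "open J" unfolding J_def
      by (intro open_vimage[OF open_D, unfolded vimage_def] continuous_intros)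
    ultimately obtain e where e: "e > 0" "ball m e \<subseteq> J" using open_contains_ball by blast
    have "m - e / 2 \<in> J" using e by (intro subsetD[OF e(2)]) (simp add: dist_real_def)
    then have "m \<le> m - e / 2" unfolding m_def by (rule cInf_lower[OF _ bdd])
    then show False using e by simp
  qed
  then obtain s where s: "s \<in> J" "fst (Phi (u + s *\<^sub>R w)) \<le> \<tau>" by blast
  have "\<exists>s'. min s eta \<le> s' \<and> s' \<le> eta \<and> fst (Phi (u + s' *\<^sub>R w)) = \<tau>"
  proof (cases "s \<le> eta")
    case True
    have "continuous_on {s..eta} (\<lambda>s. Phi (u + s *\<^sub>R w))"
    proof (rule continuous_on_compose2[OF continuous_Phi])
      show "(\<lambda>s. u + s *\<^sub>R w) ` {s..eta} \<subseteq> Ob"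
      proof (rule image_subsetI)
        fix s' assume "s' \<in> {s..eta}"
        then have "s' \<in> J" using J_up[OF s(1), of s'] eta by auto
        then show "u + s' *\<^sub>R w \<in> Ob" using D_Ob by (simp add: J_def)
      qed
    qed (intro continuous_intros)
    then have "continuous_on {s..eta} (\<lambda>s. fst (Phi (u + s *\<^sub>R w)))" by (intro continuous_intros)
    then show ?thesis
      using IVT'[of "\<lambda>s. fst (Phi (u + s *\<^sub>R w))" s \<tau> eta] s \<tau>(2)[of "u + eta *\<^sub>R w"] u eta True
      by (auto simp: lu)
  next
    case False
    \<comment> \<open>Inside the slab the time is at least \<open>\<tau>\<close>, so here it equals
      \<open>\<tau>\<close>, and by monotonicity it does so at height \<open>eta\<close>
      too.\<close>
    then have "\<tau> \<le> fst (Phi (u + s *\<^sub>R w))" using J_bd[OF s(1)] u by (intro \<tau>(2)) (auto simp: lu)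
    then have "fst (Phi (u + s *\<^sub>R w)) = \<tau>" using s by simp
    moreover have "causal_bound p (Phi (u + eta *\<^sub>R w)) (Phi ((u + eta *\<^sub>R w) + (s - eta) *\<^sub>R w))"
    proof (rule vertical_causal_bound)
      fix s' assume "s' \<in> {0..s - eta}"
      then show "u + eta *\<^sub>R w + s' *\<^sub>R w \<in> Ob" using slabJ[of "eta + s'"] J_bd[OF s(1)] by (simp add: algebra_simps)
    qed (use False in simp)
    ultimately have "fst (Phi (u + eta *\<^sub>R w)) \<le> \<tau>" by (simp add: causal_bound_def algebra_simps)
    moreover have "\<tau> \<le> fst (Phi (u + eta *\<^sub>R w))" using u eta by (intro \<tau>(2)) (auto simp: lu)
    ultimately show ?thesis using False by (intro exI[of _ eta]) auto
  qed
  then obtain s' where s': "min s eta \<le> s'" "s' \<le> eta" "fst (Phi (u + s' *\<^sub>R w)) = \<tau>" by blast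
  have "s' \<in> J"
  proof (cases "s \<le> eta")
    case True then show ?thesis using J_up[OF s(1), of s'] s' eta by auto
  next
    case False then have "s' = eta" using s' by auto
    then show ?thesis using etaJ by simp
  qed
  then show ?thesis using s' lu by (intro bexI[of _ "u + s' *\<^sub>R w"]) (auto simp: J_def)
qed

text \<open>Vectors tangent to a slice of constant t are spacelike, so the metric bounds their Kasner
  length by the chart length of their horizontal part.\<close>
lemma slice_lipschitz:
  assumes \<tau>: "0 < \<tau>" "\<And>x. eta \<le> l x \<Longrightarrow> l x \<le> 2 * eta \<Longrightarrow> norm (Pr x) \<le> r \<Longrightarrow> \<tau> \<le> fst (Phi x)"
    and x: "x \<in> D" "fst (Phi x) = \<tau>" and x': "x' \<in> D" "fst (Phi x') = \<tau>"
  shows "\<bar>snd (Phi x') $ j - snd (Phi x) $ j\<bar> \<le> sqrt b2 * (2 * r) * \<tau> powr (- p j)"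
proof -
  \<comment> \<open>\<open>F\<close> replaces the height by the Kasner time. It is injective because
    time increases strictly upwards, and so is its differential because the image of
    \<open>w\<close> has positive time component; slices thus become pieces of hyperplanes.\<close>
  define F where "F y = Pr y + fst (Phi y) *\<^sub>R w" for y
  define dF where "dF y v = Pr v + fst (dPhi y v) *\<^sub>R w" for y v
  have lF: "l (F y) = fst (Phi y)" "Pr (F y) = Pr y" for y by (simp_all add: F_def lP_simps)
  have ldF: "l (dF y v) = fst (dPhi y v)" "Pr (dF y v) = Pr v" for y v by (simp_all add: dF_def lP_simps)
  have less: "fst (Phi y) < fst (Phi y')" if y: "y \<in> D" "y' \<in> D" "Pr y = Pr y'" "l y < l y'" for y y'
  proof -
    have eq: "y + (l y' - l y) *\<^sub>R w = y'" using y(3) by (simp add: Pr_def algebra_simps)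
    show ?thesis
      by (rule vertical_timelike_graph[of "l y' - l y" y, unfolded eq])
        (use D_seg[OF y(1)] D_bounds[OF y(2)] y in auto)
  qed
  have inj: "inj_on F D"
  proof (rule inj_onI)
    fix y y' assume y: "y \<in> D" "y' \<in> D" "F y = F y'"
    then have P: "Pr y = Pr y'" and f: "fst (Phi y) = fst (Phi y')" by (metis lF)+
    have "l y = l y'" using less[OF y(1,2) P] less[OF y(2,1) P[symmetric]] f by linarith
    then show "y = y'" using P by (metis decomp)
  qed
  have derF: "(F has_derivative dF y) (at y)" if "y \<in> D" for y
    unfolding F_def dF_def
    by (intro has_derivative_add Pr.has_derivative[OF has_derivative_ident] bounded_linear.has_derivative[OF bounded_linear_scaleR_left]
        bounded_linear.has_derivative[OF bounded_linear_fst] dPhi D_Ob that)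
  have injd: "inj (dF y)" if "y \<in> D" for y
  proof -
    have lin: "linear (dF y)" using derF[OF that] has_derivative_linear by blast
    show ?thesis
    proof (subst linear_injective_0[OF lin], intro allI impI)
      fix v assume "dF y v = 0"
      then have v: "fst (dPhi y v) = 0" "Pr v = 0" using ldF[of y v] by (simp_all add: lP_simps)
      then have "v = l v *\<^sub>R w" using decomp[of v] by simp
      moreover have "linear (dPhi y)" using dPhi[OF D_Ob[OF that]] has_derivative_linear by blast
      ultimately have "fst (dPhi y v) = l v * fst (dPhi y w)" by (metis fst_scaleR linear_scale real_scaleR_def)
      moreover have "fst (dPhi y w) > 0" using future_timelike_w[OF D_Ob[OF that]] by (simp add: future_timelike_def)
      ultimately show "v = 0" using v \<open>v = l v *\<^sub>R w\<close> by auto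
    qed
  qed
  define dG where "dG y = inv (dF y)" for y
  have dF_dG: "dF y (dG y v) = v" if "y \<in> D" for y v
    unfolding dG_def using derF[OF that] has_derivative_linear injd[OF that]
    by (metis linear_injective_imp_surjective surj_f_inv_f)
  have contF: "continuous_on D F"
    by (meson continuous_at_imp_continuous_on derF has_derivative_continuous)
  define G where "G = inv_into D F"
  have GF: "G (F y) = y" if "y \<in> D" for y using that inj by (simp add: G_def)
  have derG: "(G has_derivative dG y) (at (F y))" if "y \<in> D" for y
    by (rule has_derivative_inverse_strong[OF open_D that contF GF derF[OF that]])
      (use dF_dG[OF that] in auto)
  define \<Delta> where "\<Delta> = Pr x' - Pr x"
  \<comment> \<open>A straight segment at level \<open>\<tau>\<close> in the new coordinates; by
    convexity of the disc and \<open>slice_exists\<close> it runs inside the image of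
    \<open>F\<close>.\<close>
  define c where "c q = Pr x + q *\<^sub>R \<Delta> + \<tau> *\<^sub>R w" for q
  have l\<Delta>: "l \<Delta> = 0" "Pr \<Delta> = \<Delta>" by (simp_all add: \<Delta>_def lP_simps)
  have n\<Delta>: "norm \<Delta> \<le> 2 * r" unfolding \<Delta>_def
    using norm_triangle_ineq4[of "Pr x'" "Pr x"] D_bounds[OF x(1)] D_bounds[OF x'(1)] by linarith
  have ends: "c 0 = F x" "c 1 = F x'" by (simp_all add: c_def F_def \<Delta>_def x x')
  define f where "f q = snd (Phi (G (c q))) $ j" for q
  have "\<exists>d. (f has_real_derivative d) (at q within {0..1}) \<and> \<bar>d\<bar> \<le> sqrt b2 * (2 * r) * \<tau> powr (- p j)"
    if q: "q \<in> {0..1}" for q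
  proof -
    have "norm (Pr x + q *\<^sub>R \<Delta>) < r"
    proof -
      have "Pr x + q *\<^sub>R \<Delta> = (1 - q) *\<^sub>R Pr x + q *\<^sub>R Pr x'" by (simp add: \<Delta>_def algebra_simps)
      moreover have "(1 - q) *\<^sub>R Pr x + q *\<^sub>R Pr x' \<in> ball 0 r"
        by (rule convexD[OF convex_ball]) (use q D_bounds[OF x(1)] D_bounds[OF x'(1)] in auto)
      ultimately show ?thesis by simp
    qed
    then obtain y where y: "y \<in> D" "Pr y = Pr x + q *\<^sub>R \<Delta>" "fst (Phi y) = \<tau>"
      using slice_exists[OF \<tau>, of "Pr x + q *\<^sub>R \<Delta>"] by (auto simp: lP_simps l\<Delta>)
    have cy: "c q = F y" by (simp add: c_def F_def y)
    define v where "v = dG y \<Delta>"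
    define a where "a = dPhi y v"
    have v: "Pr v = \<Delta>" "fst a = 0"
      using ldF[of y v] dF_dG[OF y(1), of \<Delta>] l\<Delta> by (simp_all add: v_def a_def)
    have "(c has_vector_derivative \<Delta>) (at q within {0..1})"
      unfolding c_def by (auto intro!: derivative_eq_intros)
    moreover have "(G has_derivative dG y) (at (c q) within c ` {0..1})"
      unfolding cy by (rule has_derivative_at_withinI[OF derG[OF y(1)]])
    ultimately have 1: "(G \<circ> c has_vector_derivative v) (at q within {0..1})"
      unfolding v_def by (rule vector_derivative_diff_chain_within)
    have Gc: "G (c q) = y" using GF[OF y(1)] by (simp add: cy)
    have "(Phi has_derivative dPhi y) (at ((G \<circ> c) q) within (G \<circ> c) ` {0..1})"
      using has_derivative_at_withinI[OF dPhi[OF D_Ob[OF y(1)]]] Gc by simp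
    from vector_derivative_diff_chain_within[OF 1 this]
    have "((\<lambda>q. Phi (G (c q))) has_vector_derivative a) (at q within {0..1})" by (simp add: o_def a_def)
    from bounded_linear.has_vector_derivative[OF bounded_linear_compose[OF bounded_linear_vec_nth[of j] bounded_linear_snd] this]
    have 2: "(f has_real_derivative snd a $ j) (at q within {0..1})"
      by (simp add: f_def[abs_def] has_real_derivative_iff_has_vector_derivative)
    have W: "Phi y \<in> W" using D_Ob[OF y(1)] by (rule Phi_W)
    have dv: "dPsi (Phi y) a = v" unfolding a_def by (rule dPsi_dPhi[OF D_Ob[OF y(1)]])
    have "(\<tau> powr p j * \<bar>snd a $ j\<bar>)\<^sup>2 = \<tau> powr (2 * p j) * (snd a $ j)\<^sup>2"
      using powr_add[of \<tau> "p j" "p j"] by (simp add: power_mult_distrib power2_eq_square[of "\<tau> powr p j"])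
    also have "\<dots> \<le> (\<Sum>i\<in>UNIV. \<tau> powr (2 * p i) * (snd a $ i)\<^sup>2)" by (rule member_le_sum) auto
    also have "\<dots> = kasner_g p (Phi y) a a" by (simp add: kasner_g_diag v y)
    also have "\<dots> \<le> - (b1 * (l v)\<^sup>2) + b2 * (norm \<Delta>)\<^sup>2"
      using g_upper[OF W, of a] unfolding dv Pr_def[symmetric] v .
    also have "\<dots> \<le> b2 * (2 * r)\<^sup>2"
    proof -
      have "b2 * (norm \<Delta>)\<^sup>2 \<le> b2 * (2 * r)\<^sup>2" using n\<Delta> pos by (intro mult_left_mono power_mono) auto
      moreover have "b1 * (l v)\<^sup>2 \<ge> 0" using pos by simp
      ultimately show ?thesis by linarith
    qed
    also have "\<dots> = (sqrt b2 * (2 * r))\<^sup>2" using pos by (simp add: power_mult_distrib)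
    finally have "\<tau> powr p j * \<bar>snd a $ j\<bar> \<le> sqrt b2 * (2 * r)"
      by (rule power2_le_imp_le) (use pos r in simp)
    then have "\<bar>snd a $ j\<bar> \<le> sqrt b2 * (2 * r) * \<tau> powr (- p j)"
      using \<tau>(1) by (simp add: powr_minus field_simps)
    with 2 show ?thesis by blast
  qed
  then obtain d where d: "\<And>q. q \<in> {0..1} \<Longrightarrow> (f has_real_derivative d q) (at q within {0..1})"
    "\<And>q. q \<in> {0..1} \<Longrightarrow> \<bar>d q\<bar> \<le> sqrt b2 * (2 * r) * \<tau> powr (- p j)" by metis
  have "norm (f 1 - f 0) \<le> sqrt b2 * (2 * r) * \<tau> powr (- p j) * norm (1 - 0 :: real)"
    by (rule field_differentiable_bound[of "{0..1}" f d]) (use d in auto)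
  then show ?thesis by (simp add: f_def ends GF x(1) x'(1))
qed

text \<open>Follow the comoving line down to the infimum \<open>m\<close> of the times to which it
  stays good. Heights in \<open>D\<close> are bounded, so compactness keeps the limit point in
  \<open>W\<close> and \<open>D_closed\<close> keeps it in \<open>D\<close>; by openness the only
  condition that can fail there is the one on the radius.\<close>

lemma comoving_exit:
  assumes x: "x \<in> D" "Phi x = (t, y)" and \<rho>: "norm (Pr x) < \<rho>" "\<rho> < r"
    and t': "0 < t'" "t' \<le> t" "\<not> ((t', y) \<in> W \<and> Psi (t', y) \<in> D)"
  shows "\<exists>m. 0 < m \<and> m \<le> t \<and> (\<forall>s\<in>{m..t}. (s, y) \<in> W \<and> Psi (s, y) \<in> D) \<and> norm (Pr (Psi (m, y))) = \<rho>"
proof -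
  define good where "good s \<longleftrightarrow> (s, y) \<in> W \<and> Psi (s, y) \<in> D \<and> norm (Pr (Psi (s, y))) < \<rho>" for s
  define J where "J = {s. s \<le> t \<and> (\<forall>s'\<in>{s..t}. good s')}"
  have Px: "Psi (t, y) = x" "(t, y) \<in> W" using Psi_Phi[OF D_Ob[OF x(1)]] Phi_W[OF D_Ob[OF x(1)]] x(2) by auto
  have tJ: "t \<in> J" using x \<rho> Px by (auto simp: J_def good_def)
  have J_lb: "t' < s" if "s \<in> J" for s
  proof (rule ccontr)
    assume "\<not> t' < s" then have "good t'" using that t' by (auto simp: J_def)
    with t' show False by (simp add: good_def)
  qed
  have bdd: "bdd_below J" using J_lb by (meson bdd_below.I less_imp_le)
  define m where "m = Inf J"
  have mt: "m \<le> t" unfolding m_def by (rule cInf_lower[OF tJ bdd])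
  have m0: "t' \<le> m" unfolding m_def by (rule cInf_greatest) (use tJ J_lb less_imp_le in blast)+
  have mpos: "0 < m" using m0 t' by simp
  have above: "good s" if ms: "m < s" "s \<le> t" for s
  proof -
    obtain s' where "s' \<in> J" "s' < s" using cInf_lessD[of J s] tJ ms(1) unfolding m_def by blast
    then show ?thesis using ms by (auto simp: J_def)
  qed
  have "m \<in> closure J" unfolding m_def by (rule closure_contains_Inf[OF _ bdd]) (use tJ in auto)
  then obtain S where S: "\<And>n. S n \<in> J" "S \<longlonglongrightarrow> m" by (auto simp: closure_sequential)
  have Sg: "good (S n)" "S n \<le> t" "m \<le> S n" for n
    using S(1)[of n] cInf_lower[OF S(1)[of n] bdd] by (auto simp: J_def m_def)
  have lS: "l (Psi (S n, y)) \<le> l x" for n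
  proof -
    have "Psi (t, y) - Psi (S n, y) \<in> Cone"
    proof (rule timelike_graph_lift_Cone[of "S n" t "\<lambda>_. y"])
      fix s assume "s \<in> {S n..t}"
      then show "(s, y) \<in> W" using S(1)[of n] by (auto simp: J_def good_def)
    qed (use Sg timelike_graph_const in auto)
    from Cone_l[OF this] show ?thesis by (simp add: Px l.diff)
  qed
  have lim: "(\<lambda>n. (S n, y)) \<longlonglongrightarrow> (m, y)" by (intro tendsto_intros S)
  have mW: "(m, y) \<in> W"
  proof (rule limit_in_W_compact[OF _ lim _ compact_box[of "- eta" "2 * eta" \<rho>]])
    show "(S k, y) \<in> W" for k using Sg[of k] by (simp add: good_def)
    show "(m, y) \<in> kasner_M" using mpos by (simp add: kasner_M_def)
    show "{x. - eta \<le> l x \<and> l x \<le> 2 * eta \<and> norm (Pr x) \<le> \<rho>} \<subseteq> Om"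
      using eta \<rho> r_le by (auto simp: Om_def)
    show "Psi (S k, y) \<in> {x. - eta \<le> l x \<and> l x \<le> 2 * eta \<and> norm (Pr x) \<le> \<rho>}" for k
      using Sg(1)[of k] D_lower[of "Psi (S k, y)"] D_bounds[of "Psi (S k, y)"] by (auto simp: good_def)
  qed
  have limP: "(\<lambda>n. Psi (S n, y)) \<longlonglongrightarrow> Psi (m, y)"
    by (rule continuous_on_tendsto_compose[OF continuous_Psi lim mW]) (use Sg in \<open>auto simp: good_def\<close>)
  have nP: "norm (Pr (Psi (m, y))) \<le> \<rho>"
    by (rule LIMSEQ_le_const2[OF tendsto_norm[OF Pr.tendsto[OF limP]]])
      (use Sg(1) less_imp_le in \<open>auto simp: good_def\<close>)
  have lP: "l (Psi (m, y)) \<le> l x"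
    by (rule LIMSEQ_le_const2[OF l.tendsto[OF limP]]) (use lS in auto)
  have mD: "Psi (m, y) \<in> D"
    by (rule D_closed[OF _ limP Psi_Ob[OF mW]]) (use Sg nP lP \<rho> D_bounds[OF x(1)] in \<open>auto simp: good_def\<close>)
  have "norm (Pr (Psi (m, y))) = \<rho>"
  proof (rule ccontr)
    assume "norm (Pr (Psi (m, y))) \<noteq> \<rho>"
    then have lt: "norm (Pr (Psi (m, y))) < \<rho>" using nP by simp
    define V where "V = W \<inter> Psi -` (D \<inter> {x. norm (Pr x) < \<rho>})"
    have "open V" unfolding V_def
      by (intro continuous_open_preimage[OF continuous_Psi W_open] open_Int open_D open_Collect_less continuous_intros)
    moreover have "(m, y) \<in> V" using mW mD lt by (simp add: V_def)
    ultimately obtain e where e: "e > 0" "ball (m, y) e \<subseteq> V" using open_contains_ball by blast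
    have "m - e / 2 \<in> J"
    proof -
      have "good s" if "s \<in> {m - e / 2..t}" for s
      proof (cases "m < s")
        case True then show ?thesis using above that by simp
      next
        case False
        then have "(s, y) \<in> ball (m, y) e" using that e by (simp add: dist_Pair_Pair dist_real_def)
        then have "(s, y) \<in> V" using e by blast
        then show ?thesis by (simp add: V_def good_def)
      qed
      then show ?thesis using mt e by (simp add: J_def)
    qed
    then have "m \<le> m - e / 2" unfolding m_def by (rule cInf_lower[OF _ bdd])
    then show False using e by simp
  qed
  moreover have "(s, y) \<in> W \<and> Psi (s, y) \<in> D" if "s \<in> {m..t}" for s
    using above[of s] that mW mD by (cases "s = m") (auto simp: good_def)
  ultimately show ?thesis using mpos mt by blast
qed

text \<open>Since \<open>1 - p i > 0\<close>, the coordinate distance that a timelike curve can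
  cover before time \<open>t\<close> shrinks to zero with \<open>t\<close>: particle horizons
  collapse.\<close>

lemma spatial_radius_tendsto_0:
  "((\<lambda>t. \<Sum>i\<in>UNIV. t powr (1 - p i) / (1 - p i)) \<longlongrightarrow> 0) (at_right 0)"
proof -
  have "((\<lambda>t. \<Sum>i\<in>UNIV. t powr (1 - p i) / (1 - p i)) \<longlongrightarrow> (\<Sum>i\<in>UNIV. 0 powr (1 - p i) / (1 - p i))) (at_right 0)"
    using p_less
    by (intro tendsto_intros tendsto_powr') (auto simp: eventually_at_right_less less_imp_le eventually_at_filter less_le)
  then show ?thesis by simp
qed

text \<open>If comoving lines starting arbitrarily close to the boundary point 0 reached the wall
  norm (Pr x) = r / 2, the wall points z would accumulate at a boundary point with the same past
  endpoint in the Kasner coordinates. A point Q slightly above z would then be causally above points close to 0, although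
  its height l Q is negative.\<close>
lemma comoving_stays:
  obtains e where "e > 0"
    "\<And>x t. x \<in> D \<Longrightarrow> norm x < e \<Longrightarrow> 0 < t \<Longrightarrow> t \<le> fst (Phi x) \<Longrightarrow>
       (t, snd (Phi x)) \<in> W \<and> Psi (t, snd (Phi x)) \<in> D"
proof -
  have "\<exists>e>0. \<forall>x t. x \<in> D \<and> norm x < e \<and> 0 < t \<and> t \<le> fst (Phi x) \<longrightarrow>
       (t, snd (Phi x)) \<in> W \<and> Psi (t, snd (Phi x)) \<in> D"
  proof (rule ccontr)
    assume neg: "\<not> ?thesis"
    define \<rho> where "\<rho> = r / 2"
    \<comment> \<open>The wide cone turns the horizontal gap between \<open>x n\<close> and the
      wall, which exceeds \<open>\<rho> / 2 = 4 * K * \<alpha>\<close>, into a height drop of more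
      than \<open>4 * \<alpha>\<close>; this yields \<open>lz\<close>.\<close>
    define \<alpha> where "\<alpha> = \<rho> / (8 * K)"
    have \<rho>: "0 < \<rho>" "\<rho> < r" using r by (auto simp: \<rho>_def)
    have \<alpha>: "0 < \<alpha>" "K * \<alpha> = \<rho> / 8" using \<rho> K_pos by (auto simp: \<alpha>_def)
    have "open {x. norm (Pr x) < \<rho> / 2 \<and> \<bar>l x\<bar> < \<alpha>}"
      by (intro open_Collect_conj open_Collect_less continuous_intros)
    moreover have "0 \<in> {x. norm (Pr x) < \<rho> / 2 \<and> \<bar>l x\<bar> < \<alpha>}" using \<rho> \<alpha> by (simp add: lP_simps)
    ultimately obtain e0 where e0: "e0 > 0" "ball 0 e0 \<subseteq> {x. norm (Pr x) < \<rho> / 2 \<and> \<bar>l x\<bar> < \<alpha>}"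
      using open_contains_ball by blast
    have "\<exists>x m. x \<in> D \<and> norm x < e0 \<and> norm x < 1 / real (Suc n) \<and> 0 < m \<and> m \<le> fst (Phi x) \<and>
       (\<forall>s\<in>{m..fst (Phi x)}. (s, snd (Phi x)) \<in> W \<and> Psi (s, snd (Phi x)) \<in> D) \<and>
       norm (Pr (Psi (m, snd (Phi x)))) = \<rho>" for n
    proof -
      have "min e0 (1 / real (Suc n)) > 0" using e0 by simp
      with neg obtain x t where x: "x \<in> D" "norm x < min e0 (1 / real (Suc n))" "0 < t" "t \<le> fst (Phi x)"
        "\<not> ((t, snd (Phi x)) \<in> W \<and> Psi (t, snd (Phi x)) \<in> D)" by meson
      have "x \<in> ball 0 e0" using x by simp
      then have "norm (Pr x) < \<rho>" using e0 \<rho> by force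
      from comoving_exit[OF x(1) prod.collapse[symmetric] this \<rho>(2) x(3,4,5)]
      obtain m where m: "0 < m" "m \<le> fst (Phi x)"
        "\<forall>s\<in>{m..fst (Phi x)}. (s, snd (Phi x)) \<in> W \<and> Psi (s, snd (Phi x)) \<in> D"
        "norm (Pr (Psi (m, snd (Phi x)))) = \<rho>" by blast
      have "norm x < e0" "norm x < 1 / real (Suc n)" using x(2) by auto
      then show ?thesis using x(1) m by blast
    qed
    then obtain x m where x: "\<And>n. x n \<in> D" "\<And>n. norm (x n) < e0" "\<And>n. norm (x n) < 1 / real (Suc n)"
      and m: "\<And>n. 0 < m n" "\<And>n. m n \<le> fst (Phi (x n))"
        "\<And>n s. s \<in> {m n..fst (Phi (x n))} \<Longrightarrow> (s, snd (Phi (x n))) \<in> W \<and> Psi (s, snd (Phi (x n))) \<in> D"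
        "\<And>n. norm (Pr (Psi (m n, snd (Phi (x n))))) = \<rho>"
      by metis
    define y where "y n = snd (Phi (x n))" for n
    define z where "z n = Psi (m n, y n)" for n
    have zW: "(m n, y n) \<in> W" and zD: "z n \<in> D" for n using m(3)[of "m n" n] m(2)[of n] by (auto simp: z_def y_def)
    have Pz: "Phi (z n) = (m n, y n)" for n using zW by (simp add: z_def Phi_Psi)
    have zr: "norm (Pr (z n)) = \<rho>" for n using m(4) by (simp add: z_def y_def)
    have xs: "norm (Pr (x n)) < \<rho> / 2" "\<bar>l (x n)\<bar> < \<alpha>" for n
    proof -
      have "x n \<in> ball 0 e0" using x(2) by simp
      then show "norm (Pr (x n)) < \<rho> / 2" "\<bar>l (x n)\<bar> < \<alpha>" using e0 by blast+
    qed
    have Px: "Psi (fst (Phi (x n)), y n) = x n" for n using Psi_Phi[OF D_Ob[OF x(1)]] by (simp add: y_def)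
    have lz: "l (z n) < - 3 * \<alpha>" for n
    proof -
      have "Psi (fst (Phi (x n)), y n) - Psi (m n, y n) \<in> Cone"
        by (rule timelike_graph_lift_Cone[of _ _ "\<lambda>_. y n"]) (use m timelike_graph_const in \<open>auto simp: y_def\<close>)
      then have "norm (Pr (x n) - Pr (z n)) \<le> K * (l (x n) - l (z n))"
        by (simp add: Px z_def[symmetric] Cone_def lP_simps)
      moreover have "norm (Pr (z n)) - norm (Pr (x n)) \<le> norm (Pr (x n) - Pr (z n))"
        by (metis norm_minus_commute norm_triangle_ineq2)
      ultimately have "K * (4 * \<alpha>) < K * (l (x n) - l (z n))" using xs[of n] zr[of n] \<alpha> by simp
      then have "4 * \<alpha> < l (x n) - l (z n)" using K_pos by simp
      then show ?thesis using xs(2)[of n] by linarith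
    qed
    have \<alpha>eta: "3 * \<alpha> < eta" using lz[of 0] D_lower[OF zD[of 0]] by linarith
    have "z n \<in> {x. - eta \<le> l x \<and> l x \<le> - 3 * \<alpha> \<and> norm (Pr x) \<le> \<rho>}" for n
      using lz[of n] D_lower[OF zD[of n]] zr[of n] by simp
    then obtain q zz where q: "zz \<in> {x. - eta \<le> l x \<and> l x \<le> - 3 * \<alpha> \<and> norm (Pr x) \<le> \<rho>}"
      "strict_mono (q::nat\<Rightarrow>nat)" "(z \<circ> q) \<longlonglongrightarrow> zz"
      using compact_box[of "- eta" "- 3 * \<alpha>" \<rho>] unfolding compact_def by meson
    \<comment> \<open>One \<open>\<alpha>\<close> above the limit of the wall points and still at
      height at most \<open>- 2 * \<alpha>\<close>. The limit itself need not lie in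
      \<open>Ob\<close>, but \<open>D_diamond\<close> applied to a late wall point shows that
      \<open>Q\<close> does.\<close>
    define Q where "Q = zz + \<alpha> *\<^sub>R w"
    have lQ: "l Q \<le> - 2 * \<alpha>" using q(1) by (simp add: Q_def lP_simps)
    have "(\<lambda>n. Pr (z (q n))) \<longlonglongrightarrow> Pr zz" "(\<lambda>n. l (z (q n))) \<longlonglongrightarrow> l zz"
      using Pr.tendsto[OF q(3)] l.tendsto[OF q(3)] by (auto simp: o_def)
    then have "\<forall>\<^sub>F n in sequentially. dist (Pr (z (q n))) (Pr zz) < \<kappa> * (\<alpha> / 2 / 3) \<and> dist (l (z (q n))) (l zz) < \<alpha> / 2"
      using \<alpha> kappa_pos by (intro eventually_conj tendstoD) auto
    then obtain n where n: "dist (Pr (z (q n))) (Pr zz) < \<kappa> * (\<alpha> / 2 / 3)" "dist (l (z (q n))) (l zz) < \<alpha> / 2"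
      using eventually_happens by force
    have QO: "Q \<in> Ob"
    proof (rule D_diamond[OF zD[of "q n"], of "\<alpha> / 2"])
      have "\<bar>l (z (q n)) - l zz\<bar> < \<alpha> / 2" using n by (simp add: dist_real_def)
      then show "\<alpha> / 2 \<le> l (Q - z (q n))" unfolding Q_def lP_simps l_w' real_scaleR_def mult_1_right by linarith
      show "norm (Pr (Q - z (q n))) \<le> \<kappa> * (\<alpha> / 2 / 3)"
        using n(1) by (simp add: Q_def lP_simps dist_norm norm_minus_commute)
    qed (use lQ \<alpha> eta in auto)
    define V where "V = W \<inter> Psi -` {x. l x < - \<alpha>}"
    have "open V" unfolding V_def
      by (intro continuous_open_preimage[OF continuous_Psi W_open] open_Collect_less continuous_intros)
    moreover have "Phi Q \<in> V" using Phi_W[OF QO] Psi_Phi[OF QO] lQ \<alpha> by (simp add: V_def)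
    ultimately obtain e where e: "e > 0" "ball (Phi Q) e \<subseteq> V" using open_contains_ball by blast
    have Q0: "fst (Phi Q) > 0" using fst_pos[OF Phi_W[OF QO]] .
    define A where "A t = (\<Sum>i\<in>UNIV. t powr (1 - p i) / (1 - p i))" for t
    have "\<forall>\<^sub>F t in at_right 0. A t < e / 2"
      using order_tendstoD(2)[OF spatial_radius_tendsto_0, of "e / 2"] e by (simp add: A_def)
    moreover have "\<forall>\<^sub>F t in at_right 0. t < fst (Phi Q) / 2"
      unfolding eventually_at_right_field using Q0 by (intro exI[of _ "fst (Phi Q) / 2"]) auto
    ultimately have "\<forall>\<^sub>F t in at_right 0. A t < e / 2 \<and> t < fst (Phi Q) / 2 \<and> 0 < t"
      by (intro eventually_conj eventually_at_right_less)
    \<comment> \<open>Before time \<open>t0\<close> a timelike curve moves less than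
      \<open>e / 2\<close> in x, and \<open>t0\<close> is well before the time of
      \<open>Q\<close>.\<close>
    then obtain t0 where t0: "A t0 < e / 2" "t0 < fst (Phi Q) / 2" "0 < t0"
      using eventually_happens'[OF trivial_limit_at_right_real] by blast
    obtain e1 where e1: "e1 > 0" "\<And>x. x \<in> D \<Longrightarrow> norm x < e1 \<Longrightarrow> fst (Phi x) < t0"
      using D_near_zero[OF t0(3)] by blast
    define Z where "Z n = z (q n) + \<alpha> *\<^sub>R w" for n
    have ZD: "Z n \<in> D" for n
      unfolding Z_def by (rule D_up[OF zD]) (use lz[of "q n"] \<alpha> eta in auto)
    have "Z \<longlonglongrightarrow> Q" unfolding Z_def Q_def using q(3) by (intro tendsto_intros) (simp add: o_def)
    then have "(\<lambda>n. Phi (Z n)) \<longlonglongrightarrow> Phi Q"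
      by (rule continuous_on_tendsto_compose[OF continuous_Phi _ QO]) (use D_Ob[OF ZD] in auto)
    then have "\<forall>\<^sub>F n in sequentially. dist (Phi (Z n)) (Phi Q) < min (e / 2) (fst (Phi Q) / 2)"
      using e Q0 by (intro tendstoD) auto
    moreover have "\<forall>\<^sub>F n in sequentially. norm (x (q n)) < e1"
    proof -
      have "x \<longlonglongrightarrow> 0" by (rule LIMSEQ_norm_0) (use x(3) in simp)
      from LIMSEQ_subseq_LIMSEQ[OF this q(2)] show ?thesis
        using tendstoD[OF _ e1(1)] by (fastforce simp: o_def)
    qed
    ultimately have "\<forall>\<^sub>F n in sequentially. dist (Phi (Z n)) (Phi Q) < min (e / 2) (fst (Phi Q) / 2) \<and> norm (x (q n)) < e1"
      by (rule eventually_conj)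
    then obtain k where k: "dist (Phi (Z k)) (Phi Q) < min (e / 2) (fst (Phi Q) / 2)" "norm (x (q k)) < e1"
      using eventually_happens by force
    define N where "N = q k"
    define tn where "tn = fst (Phi (x N))"
    define T where "T = fst (Phi (Z k))"
    have tn: "tn < t0" unfolding tn_def by (rule e1(2)[OF x(1)]) (use k N_def in simp)
    have "dist (fst (Phi (Z k))) (fst (Phi Q)) \<le> dist (Phi (Z k)) (Phi Q)" by (rule dist_fst_le)
    then have T: "fst (Phi Q) / 2 < T" using k(1) by (auto simp: T_def dist_real_def abs_if split: if_splits)
    have mtn: "m N \<le> tn" using m(2) by (simp add: tn_def)
    have tnT: "tn < T" using tn t0 T by linarith
    have Zk: "z N + \<alpha> *\<^sub>R w = Z k" by (simp add: Z_def N_def)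
    have segz: "z N + s *\<^sub>R w \<in> Ob" if "s \<in> {0..\<alpha>}" for s
      by (rule D_seg[OF zD]) (use that lz[of N] \<alpha> eta in auto)
    obtain c where c: "\<And>t. t \<in> {m N..T} \<Longrightarrow> \<exists>s\<in>{0..\<alpha>}. Phi (z N + s *\<^sub>R w) = (t, c t)"
      "c (m N) = y N" "c T = snd (Phi (Z k))"
      "\<And>t. t \<in> {m N..T} \<Longrightarrow> \<exists>v. (c has_vector_derivative v) (at t) \<and> future_timelike p t (1, v)"
      by (rule vertical_timelike_graph[OF \<alpha>(1) segz, unfolded Zk Pz fst_conv snd_conv, folded T_def]) (assumption, blast)
    have cc: "timelike_graph p c (m N) T" by (rule derivative_timelike_graph[OF c(4)])
    define d where "d = c tn - y N"
    have "causal_bound p (m N, c (m N)) (tn, c tn)"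
      by (rule timelike_graph_causal_bound[OF p_less timelike_graph_subset[OF cc]]) (use mtn tnT m in auto)
    from causal_bound_bounded_spatial[OF p_less this, of t0] have nd: "norm d < e / 2"
      using m(1)[of N] tn t0(1) by (simp add: d_def c(2) A_def)
    \<comment> \<open>The competitor of \<open>c\<close> rests at \<open>y N\<close> until time
      \<open>tn\<close>, where it passes through the image of \<open>x N\<close>, and then follows
      \<open>c\<close> translated by \<open>d\<close>, a symmetry of the Kasner metric. It ends
      within \<open>e\<close> of \<open>Phi Q\<close>, hence below height \<open>- \<alpha>\<close>,
      although heights increase along it and \<open>x N\<close> lies above
      \<open>- \<alpha>\<close>.\<close>
    define kk where "kk = (\<lambda>t. if t < tn then y N else c t - d)"
    have kc: "timelike_graph p kk (m N) T" unfolding kk_def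
      by (rule timelike_graph_concat[OF timelike_graph_const timelike_graph_shift[OF timelike_graph_subset[OF cc]]])
        (use mtn tnT in \<open>auto simp: d_def\<close>)
    have kT: "kk T = c T - d" using tnT by (simp add: kk_def)
    have endV: "(T, c T + s *\<^sub>R (kk T - c T)) \<in> V" if s: "s \<in> {0..1}" for s
    proof -
      have "(T, c T + s *\<^sub>R (kk T - c T)) = Phi (Z k) - (0, s *\<^sub>R d)"
        unfolding kT c(3) by (simp add: T_def prod_eq_iff)
      moreover have "norm (0::real, s *\<^sub>R d) \<le> norm d" using s by (simp add: norm_Pair mult_left_le_one_le)
      moreover have "dist (Phi (Z k) - (0, s *\<^sub>R d)) (Phi Q) \<le> dist (Phi (Z k)) (Phi Q) + norm (0::real, s *\<^sub>R d)"
        unfolding dist_norm using norm_triangle_ineq4[of "Phi (Z k) - Phi Q" "(0, s *\<^sub>R d)"]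
        by (simp add: algebra_simps)
      ultimately have "dist (T, c T + s *\<^sub>R (kk T - c T)) (Phi Q) < e" using k(1) nd by simp
      then show ?thesis using e(2) by (auto simp: dist_commute)
    qed
    have kW: "(t, kk t) \<in> W" if "t \<in> {m N..T}" for t
    proof (rule homotopy_in_W[OF m(1) _ cc kc, of 0])
      show "c (m N) = kk (m N)" using mtn c(2) by (auto simp: kk_def d_def)
      fix t assume "t \<in> {m N..T}"
      then obtain s where s: "s \<in> {0..\<alpha>}" "Phi (z N + s *\<^sub>R w) = (t, c t)" using c(1) by blast
      have "Phi (z N + s *\<^sub>R w) \<in> W" by (rule Phi_W[OF segz[OF s(1)]])
      then show "(t, c t) \<in> W" using s by simp
    next
      fix s :: real assume s: "s \<in> {0..1}"
      show "(T, c T + s *\<^sub>R (kk T - c T)) \<in> W" "l (Psi (T, c T + s *\<^sub>R (kk T - c T))) \<le> 0"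
        using endV[OF s] \<alpha> by (auto simp: V_def)
    next
      fix x' assume x': "x' - Psi (m N, c (m N)) \<in> Cone" "l x' \<le> 0"
      then have a: "norm (Pr x' - Pr (z N)) \<le> K * (l x' - l (z N))" "0 \<le> l x' - l (z N)"
        using Cone_l[OF x'(1)] by (auto simp: Cone_def c(2) z_def lP_simps)
      have "K * (l x' - l (z N)) \<le> K * eta"
        by (rule mult_left_mono) (use x'(2) D_lower[OF zD[of N]] K_pos in auto)
      then have "norm (Pr x') \<le> \<rho> + K * eta"
        using a norm_triangle_sub[of "Pr x'" "Pr (z N)"] zr[of N] by linarith
      then have "norm (Pr x') < h" using eta \<rho> r_le by linarith
      moreover have "\<bar>l x'\<bar> < h" using x' a D_lower[OF zD[of N]] eta by linarith
      ultimately show "x' \<in> Om" by (simp add: Om_def)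
    qed (use that mtn tnT in auto)
    have "Psi (T, kk T) - Psi (tn, kk tn) \<in> Cone"
      by (rule timelike_graph_lift_Cone[OF _ timelike_graph_subset[OF kc]]) (use mtn tnT kW in auto)
    from Cone_l[OF this] have "l (Psi (tn, kk tn)) \<le> l (Psi (T, kk T))" by (simp add: l.diff)
    moreover have "kk tn = y N" by (simp add: kk_def d_def)
    moreover have "l (Psi (T, kk T)) < - \<alpha>" using endV[of 1] by (simp add: V_def)
    moreover have "- \<alpha> < l (x N)" using xs(2)[of N] by linarith
    ultimately show False using Px[of N] by (simp add: tn_def)
  qed
  then show ?thesis using that by blast
qed

lemma past_contradiction: assumes pj: "p j < 0" shows False
proof -
  obtain \<tau>0 where \<tau>0: "\<tau>0 > 0"
    "\<And>x. eta \<le> l x \<Longrightarrow> l x \<le> 2 * eta \<Longrightarrow> norm (Pr x) \<le> r \<Longrightarrow> \<tau>0 \<le> fst (Phi x)"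
    using slab_time by blast
  obtain e where e: "e > 0" "\<And>x t. x \<in> D \<Longrightarrow> norm x < e \<Longrightarrow> 0 < t \<Longrightarrow> t \<le> fst (Phi x) \<Longrightarrow>
       (t, snd (Phi x)) \<in> W \<and> Psi (t, snd (Phi x)) \<in> D"
    using comoving_stays by blast
  define s where "s = min eta (e / (2 * (norm w + 1)))"
  have nw: "0 < norm w + 1" using norm_ge_zero[of w] by linarith
  have "0 < e / (2 * (norm w + 1))" using e(1) nw by (intro divide_pos_pos mult_pos_pos) auto
  then have s: "0 < s" "s \<le> eta" using eta by (auto simp: s_def)
  have "s * norm w \<le> e / (2 * (norm w + 1)) * norm w" by (intro mult_right_mono) (auto simp: s_def)
  also have "\<dots> < e"
  proof -
    have "a < 2 * (a + 1)" if "0 \<le> a" for a :: real using that by simp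
    from this[OF norm_ge_zero[of w]] have "norm w < 2 * (norm w + 1)" .
    then have "e * norm w < e * (2 * (norm w + 1))" using e(1) by (rule mult_strict_left_mono)
    then have "e * norm w / (2 * (norm w + 1)) < e" using nw by (subst pos_divide_less_eq) auto
    then show ?thesis by simp
  qed
  finally have se: "norm (s *\<^sub>R w) < e" using s by simp
  define x where "x = s *\<^sub>R w"
  have xD: "x \<in> D" using s eta r axis by (auto simp: x_def D_def lP_simps)
  define t where "t = fst (Phi x)"
  define y where "y = snd (Phi x)"
  have xW: "(t, y) \<in> W" "Psi (t, y) = x" using Phi_W[OF D_Ob[OF xD]] Psi_Phi[OF D_Ob[OF xD]] by (simp_all add: t_def y_def)
  define V where "V = W \<inter> Psi -` (D \<inter> ball 0 e)"
  have "open V" unfolding V_def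
    by (intro continuous_open_preimage[OF continuous_Psi W_open] open_Int open_D open_ball)
  moreover have "(t, y) \<in> V" using xW xD se by (simp add: V_def x_def)
  ultimately obtain d where d: "d > 0" "ball (t, y) d \<subseteq> V" using open_contains_ball by blast
  \<comment> \<open>Two comoving lines at constant coordinate distance \<open>d / 2\<close> in
    direction \<open>j\<close>; the bound from \<open>slice_lipschitz\<close> is a multiple of
    \<open>\<tau> powr (- p j)\<close> and tends to 0 for negative \<open>p j\<close>.\<close>
  define y' where "y' = y + (d / 2) *\<^sub>R axis j 1"
  have "(t, y') \<in> ball (t, y) d" using d by (simp add: y'_def dist_Pair_Pair dist_norm norm_axis_1)
  then have V': "(t, y') \<in> V" using d by blast
  define x' where "x' = Psi (t, y')"
  have x': "x' \<in> D" "norm x' < e" "Phi x' = (t, y')" using V' by (auto simp: V_def x'_def Phi_Psi)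
  have t: "t > 0" using fst_pos[OF xW(1)] by simp
  have bound: "d / 2 \<le> sqrt b2 * (2 * r) * \<tau> powr (- p j)" if \<tau>: "0 < \<tau>" "\<tau> < min \<tau>0 t" for \<tau>
  proof -
    have 1: "(\<tau>, y) \<in> W" "Psi (\<tau>, y) \<in> D" using e(2)[OF xD, of \<tau>] se \<tau> by (auto simp: x_def[symmetric] t_def y_def)
    have 2: "(\<tau>, y') \<in> W" "Psi (\<tau>, y') \<in> D" using e(2)[OF x'(1,2), of \<tau>] \<tau> by (auto simp: x'(3))
    have "\<bar>snd (Phi (Psi (\<tau>, y'))) $ j - snd (Phi (Psi (\<tau>, y))) $ j\<bar> \<le> sqrt b2 * (2 * r) * \<tau> powr (- p j)"
      by (rule slice_lipschitz[OF \<tau>(1) order_trans[OF _ \<tau>0(2)] 1(2) _ 2(2)])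
        (use \<tau> 1 2 in \<open>auto simp: Phi_Psi\<close>)
    then show ?thesis using 1 2 d by (simp add: Phi_Psi y'_def axis_def)
  qed
  have "((\<lambda>\<tau>. sqrt b2 * (2 * r) * \<tau> powr (- p j)) \<longlongrightarrow> sqrt b2 * (2 * r) * 0 powr (- p j)) (at_right 0)"
    using pj by (intro tendsto_intros tendsto_powr') (auto simp: eventually_at_filter)
  moreover have "\<forall>\<^sub>F \<tau> in at_right 0. d / 2 \<le> sqrt b2 * (2 * r) * \<tau> powr (- p j)"
    unfolding eventually_at_right_field using bound \<tau>0 t by (intro exI[of _ "min \<tau>0 t"]) auto
  ultimately have "d / 2 \<le> sqrt b2 * (2 * r) * 0 powr (- p j)"
    by (intro tendsto_lowerbound[OF _ _ trivial_limit_at_right_real])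
  then show False using d by simp
qed

end

context kasner_chart
begin

lemma no_past_boundary:
  assumes s0: "s0 > 0" and axis: "\<And>s. 0 < s \<Longrightarrow> s \<le> s0 \<Longrightarrow> s *\<^sub>R w \<in> Ob" and pj: "p j < 0"
  shows False
proof -
  \<comment> \<open>The term \<open>h / 7\<close> gives \<open>6 * eta < h\<close>, the term
    \<open>h / (5 * K)\<close> gives \<open>4 * (K * eta) < h\<close>. The slab will be a tube
    around the compact part of the axis between heights \<open>eta\<close> and
    \<open>2 * eta\<close>.\<close>
  define eta where "eta = min (s0 / 2) (min (h / 7) (h / (5 * K)))"
  have eta: "0 < eta" "2 * eta \<le> s0" "6 * eta < h" using s0 pos K_pos by (auto simp: eta_def min_def)
  have "eta \<le> h / (5 * K)" by (simp add: eta_def)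
  then have "5 * (K * eta) \<le> h" using K_pos by (simp add: field_simps)
  then have Ke: "4 * (K * eta) < h" using pos(1) by linarith
  define S where "S = (\<lambda>s. s *\<^sub>R w) ` {eta..2 * eta}"
  have "compact S" unfolding S_def by (intro compact_continuous_image continuous_intros compact_Icc)
  moreover have "S \<subseteq> Ob" using axis eta by (auto simp: S_def)
  ultimately obtain e where e: "e > 0" "(\<Union>x\<in>S. ball x e) \<subseteq> Ob"
    using compact_subset_open_imp_ball_epsilon_subset[OF _ open_Ob] by metis
  define r where "r = min (e / 2) (\<kappa> * eta / 2)"
  have r: "0 < r" "2 * r \<le> \<kappa> * eta" "r < e" using e eta kappa_pos by (auto simp: r_def)
  interpret kasner_past p W Psi dPsi l w h b1 b2 b3 b4 eta r
  proof unfold_locales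
    fix x assume x: "eta \<le> l x" "l x \<le> 2 * eta" "norm (Pr x) \<le> r"
    have "x \<in> ball (l x *\<^sub>R w) e" using x r by (simp add: dist_norm norm_minus_commute Pr_def)
    moreover have "l x *\<^sub>R w \<in> S" using x by (auto simp: S_def)
    ultimately show "x \<in> Ob" using e by blast
  qed (use eta Ke r axis in auto)
  show False by (rule past_contradiction[OF pj])
qed

end

section \<open>Continuous Lorentzian metrics near a point\<close>

text \<open>If \<open>B u u \<le> 0\<close>, then \<open>B\<close> is nonpositive on the plane
  spanned by \<open>u\<close> and \<open>w\<close>, but a dimension count shows that this plane
  meets the positive definite hyperplane nontrivially.\<close>

lemma lorentz_form_orthogonal_pos:
  fixes B :: "'v::euclidean_space \<Rightarrow> 'v \<Rightarrow> real"
  assumes B: "lorentz_form B" and w: "B w w < 0" and u: "B w u = 0" "u \<noteq> 0"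
  shows "B u u > 0"
proof (rule ccontr)
  assume "\<not> B u u > 0"
  then have uu: "B u u \<le> 0" by simp
  interpret B: bounded_bilinear B
    using B by (simp add: lorentz_form_def bilinear_conv_bounded_bilinear)
  obtain S where S: "subspace S" "dim S = DIM('v) - 1" "\<And>x. x \<in> S \<Longrightarrow> x \<noteq> 0 \<Longrightarrow> B x x > 0"
    using B by (auto simp: lorentz_form_def)
  have sym: "B u w = 0" using B u by (simp add: lorentz_form_def)
  have w0: "w \<noteq> 0" using w by (auto simp: B.zero_left)
  have "u \<notin> span {w}"
  proof
    assume "u \<in> span {w}"
    then obtain c where c: "u = c *\<^sub>R w" by (auto simp: span_singleton)
    then have "c * B w w = 0" using u(1) by (simp add: B.scaleR_right)
    then show False using w c u(2) by simp
  qed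
  then have "independent {u, w}" using w0 by (simp add: independent_insert span_base)
  moreover have "u \<noteq> w" using w u by auto
  ultimately have "dim (span {u, w}) = 2" by (simp add: dim_eq_card_independent)
  moreover have "dim {x + y |x y. x \<in> S \<and> y \<in> span {u, w}} + dim (S \<inter> span {u, w}) = dim S + dim (span {u, w})"
    by (rule dim_sums_Int[OF S(1) subspace_span])
  moreover have "dim {x + y |x y. x \<in> S \<and> y \<in> span {u, w}} \<le> DIM('v)" by (rule dim_subset_UNIV)
  moreover have "DIM('v) > 0" by simp
  ultimately have "dim (S \<inter> span {u, w}) \<noteq> 0" using S(2) by linarith
  then obtain x where x: "x \<in> S" "x \<in> span {u, w}" "x \<noteq> 0" by (auto simp: dim_eq_0)
  obtain a b where ab: "x = a *\<^sub>R u + b *\<^sub>R w"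
    using x(2) by (auto simp: span_insert span_singleton algebra_simps)
  have "B x x = a\<^sup>2 * B u u + b\<^sup>2 * B w w"
    by (simp add: ab B.add_left B.add_right B.scaleR_left B.scaleR_right u sym power2_eq_square)
  also have "\<dots> \<le> 0" using uu w by (intro add_nonpos_nonpos mult_nonneg_nonpos) auto
  finally show False using S(3)[OF x(1,3)] by simp
qed

lemma lorentz_form_orthogonal_coercive:
  fixes B :: "'v::euclidean_space \<Rightarrow> 'v \<Rightarrow> real"
  assumes B: "lorentz_form B" and w: "B w w < 0"
  shows "\<exists>m>0. \<forall>u. B w u = 0 \<longrightarrow> m * (norm u)\<^sup>2 \<le> B u u"
proof -
  interpret B: bounded_bilinear B
    using B by (simp add: lorentz_form_def bilinear_conv_bounded_bilinear)
  define S where "S = {u. B w u = 0} \<inter> sphere 0 1"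
  have "closed {u. B w u = 0}" by (intro closed_Collect_eq B.continuous_on continuous_intros)
  then have cS: "compact S" unfolding S_def by (simp add: closed_Int_compact)
  have "\<exists>m>0. \<forall>u\<in>S. m \<le> B u u"
  proof (cases "S = {}")
    case False
    have "continuous_on S (\<lambda>u. B u u)" by (intro B.continuous_on continuous_intros)
    then obtain u where u: "u \<in> S" "\<And>v. v \<in> S \<Longrightarrow> B u u \<le> B v v"
      using continuous_attains_inf[OF cS False] by blast
    have "B u u > 0" by (rule lorentz_form_orthogonal_pos[OF B w]) (use u in \<open>auto simp: S_def\<close>)
    with u show ?thesis by blast
  qed (auto intro: exI[of _ 1])
  then obtain m where m: "m > 0" "\<And>u. u \<in> S \<Longrightarrow> m \<le> B u u" by blast
  have "m * (norm u)\<^sup>2 \<le> B u u" if u: "B w u = 0" for u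
  proof (cases "u = 0")
    case False
    have "(1 / norm u) *\<^sub>R u \<in> S" using False u by (simp add: S_def B.scaleR_right)
    from m(2)[OF this] have "m \<le> (1 / norm u) * ((1 / norm u) * B u u)"
      by (simp add: B.scaleR_right B.scaleR_left)
    then show ?thesis using False by (simp add: field_simps power2_eq_square)
  qed (simp add: B.zero_left)
  with m(1) show ?thesis by blast
qed

lemma bilinear_le_sum_Basis:
  fixes E :: "'v::euclidean_space \<Rightarrow> 'v \<Rightarrow> real"
  assumes E: "bilinear E"
  shows "\<bar>E u v\<bar> \<le> (\<Sum>i\<in>Basis. \<Sum>j\<in>Basis. \<bar>E i j\<bar>) * norm u * norm v"
proof -
  interpret E: bounded_bilinear E using E by (simp add: bilinear_conv_bounded_bilinear)
  have "E u v = E (\<Sum>i\<in>Basis. (u \<bullet> i) *\<^sub>R i) (\<Sum>j\<in>Basis. (v \<bullet> j) *\<^sub>R j)"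
    by (simp add: euclidean_representation)
  also have "\<dots> = (\<Sum>i\<in>Basis. \<Sum>j\<in>Basis. (u \<bullet> i) * ((v \<bullet> j) * E i j))"
    unfolding E.sum_left E.sum_right by (simp add: E.scaleR_left E.scaleR_right sum_distrib_left) (subst sum.swap, simp add: mult.left_commute)
  also have "\<bar>\<dots>\<bar> \<le> (\<Sum>i\<in>Basis. \<Sum>j\<in>Basis. \<bar>(u \<bullet> i) * ((v \<bullet> j) * E i j)\<bar>)"
    by (intro order_trans[OF sum_abs] sum_mono order_refl)
  also have "\<dots> \<le> (\<Sum>i\<in>Basis. \<Sum>j\<in>Basis. norm u * (norm v * \<bar>E i j\<bar>))"
    by (intro sum_mono) (auto simp: abs_mult Basis_le_norm intro!: mult_mono)
  also have "\<dots> = (\<Sum>i\<in>Basis. \<Sum>j\<in>Basis. \<bar>E i j\<bar>) * norm u * norm v"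
    by (simp add: sum_distrib_left sum_distrib_right mult_ac)
  finally show ?thesis .
qed

text \<open>Continuity is given for each pair of vectors separately; bilinearity reduces uniformity
  to the finitely many pairs of basis vectors.\<close>

lemma metric_uniformly_close:
  fixes G :: "'v::euclidean_space \<Rightarrow> 'v \<Rightarrow> 'v \<Rightarrow> real"
  assumes X: "open X" "q \<in> X" and G: "\<And>y. y \<in> X \<Longrightarrow> bilinear (G y)"
    and cont: "\<And>u v. continuous_on X (\<lambda>y. G y u v)" and e: "e > 0"
  shows "\<exists>R>0. ball q R \<subseteq> X \<and> (\<forall>y\<in>ball q R. \<forall>u v. \<bar>G y u v - G q u v\<bar> \<le> e * norm u * norm v)"
proof -
  define F where "F y = (\<Sum>i\<in>Basis. \<Sum>j\<in>Basis. \<bar>G y i j - G q i j\<bar>)" for y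
  have "continuous_on X F" unfolding F_def by (intro continuous_intros cont)
  then have "open (X \<inter> F -` {..<e})" by (rule continuous_open_preimage[OF _ X(1)]) simp
  moreover have "q \<in> X \<inter> F -` {..<e}" using X e by (simp add: F_def)
  ultimately obtain R where R: "R > 0" "ball q R \<subseteq> X \<inter> F -` {..<e}" using open_contains_ball by blast
  have "\<bar>G y u v - G q u v\<bar> \<le> e * norm u * norm v" if "y \<in> ball q R" for y u v
  proof -
    have y: "y \<in> X" "F y < e" using that R(2) by auto
    have "bilinear (\<lambda>u v. G y u v - G q u v)"
      using G[OF y(1)] G[OF X(2)] unfolding bilinear_def
      by (auto intro: linear_compose_sub)
    from bilinear_le_sum_Basis[OF this, of u v]
    have "\<bar>G y u v - G q u v\<bar> \<le> F y * norm u * norm v" by (simp add: F_def)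
    also have "\<dots> \<le> e * norm u * norm v" using y(2) by (intro mult_right_mono) auto
    finally show ?thesis .
  qed
  then show ?thesis using R by auto
qed

lemma lorentz_metric_frame_bounds:
  fixes G :: "'v::euclidean_space \<Rightarrow> 'v \<Rightarrow> 'v \<Rightarrow> real"
  assumes X: "open X" "q \<in> X" and G: "\<And>y. y \<in> X \<Longrightarrow> lorentz_form (G y)"
    and cont: "\<And>u v. continuous_on X (\<lambda>y. G y u v)" and w: "G q w w < 0"
  defines "l \<equiv> \<lambda>v. G q w v / G q w w"
  shows "\<exists>R b1 b2 b3 b4. R > 0 \<and> b1 > 0 \<and> b2 > 0 \<and> b3 > 0 \<and> b4 > 0 \<and> ball q R \<subseteq> X \<and>
    (\<forall>y\<in>ball q R. \<forall>v. G y v v \<le> - (b1 * (l v)\<^sup>2) + b2 * (norm (v - l v *\<^sub>R w))\<^sup>2 \<and>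
       - (b3 * (l v)\<^sup>2) + b4 * (norm (v - l v *\<^sub>R w))\<^sup>2 \<le> G y v v)"
proof -
  have bil: "bilinear (G y)" if "y \<in> X" for y using G[OF that] by (simp add: lorentz_form_def)
  interpret B: bounded_bilinear "G q" using bil[OF X(2)] by (simp add: bilinear_conv_bounded_bilinear)
  have sym: "G q u v = G q v u" for u v using G[OF X(2)] by (simp add: lorentz_form_def)
  obtain m where m: "m > 0" "\<And>u. G q w u = 0 \<Longrightarrow> m * (norm u)\<^sup>2 \<le> G q u u"
    using lorentz_form_orthogonal_coercive[OF G[OF X(2)] w] by blast
  obtain M where M: "M > 0" "\<And>u v. norm (G q u v) \<le> norm u * norm v * M" using B.pos_bounded by blast
  define \<beta> where "\<beta> = - G q w w"
  have \<beta>: "\<beta> > 0" using w by (simp add: \<beta>_def)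
  define N where "N = (norm w)\<^sup>2"
  have w0: "w \<noteq> 0" using w by (auto simp: B.zero_left)
  have N: "N > 0" using w0 by (simp add: N_def)
  \<comment> \<open>Perturbing the metric by \<open>e\<close> costs at most
    \<open>2 * (e * N)\<close> times the squared \<open>w\<close>-coefficient plus
    \<open>2 * e\<close> times the squared norm of the orthogonal part; this choice spends at most
    half of \<open>\<beta>\<close> and half of \<open>m\<close>.\<close>
  define e where "e = min (\<beta> / (4 * N)) (m / 4)"
  have e: "e > 0" "4 * (e * N) \<le> \<beta>" "4 * e \<le> m"
  proof -
    show "e > 0" using \<beta> N m by (simp add: e_def)
    have "e \<le> \<beta> / (4 * N)" by (simp add: e_def)
    then show "4 * (e * N) \<le> \<beta>" using N by (simp add: field_simps)
    show "4 * e \<le> m" by (simp add: e_def)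
  qed
  obtain R where R: "R > 0" "ball q R \<subseteq> X" "\<And>y u v. y \<in> ball q R \<Longrightarrow> \<bar>G y u v - G q u v\<bar> \<le> e * norm u * norm v"
    using metric_uniformly_close[OF X bil cont e(1)] by blast
  have main: "G y v v \<le> - (\<beta> / 2 * (l v)\<^sup>2) + (M + m) * (norm (v - l v *\<^sub>R w))\<^sup>2 \<and>
       - (3 * \<beta> / 2 * (l v)\<^sup>2) + m / 2 * (norm (v - l v *\<^sub>R w))\<^sup>2 \<le> G y v v" if y: "y \<in> ball q R" for y v
  proof -
    define P where "P = v - l v *\<^sub>R w"
    define a where "a = (l v)\<^sup>2"
    define b where "b = (norm P)\<^sup>2"
    have wP: "G q w P = 0" using w by (simp add: P_def B.diff_right B.scaleR_right l_def)
    have v: "v = l v *\<^sub>R w + P" by (simp add: P_def)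
    have "G q v v = G q (l v *\<^sub>R w + P) (l v *\<^sub>R w + P)" using v by simp
    also have "\<dots> = - \<beta> * a + G q P P"
      by (simp add: B.add_left B.add_right B.scaleR_left B.scaleR_right wP sym[of P w] \<beta>_def a_def power2_eq_square)
    finally have Gv: "G q v v = - \<beta> * a + G q P P" .
    have GP: "m * b \<le> G q P P" "G q P P \<le> M * b"
      using m(2)[OF wP] M(2)[of P P] by (auto simp: b_def power2_eq_square mult_ac)
    have "norm v \<le> \<bar>l v\<bar> * norm w + norm P" using norm_triangle_ineq[of "l v *\<^sub>R w" P] v by simp
    then have "(norm v)\<^sup>2 \<le> (\<bar>l v\<bar> * norm w + norm P)\<^sup>2" by (intro power_mono) auto
    also have "\<dots> \<le> 2 * (\<bar>l v\<bar> * norm w)\<^sup>2 + 2 * (norm P)\<^sup>2"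
      using sum_squares_bound[of "\<bar>l v\<bar> * norm w" "norm P"] by (simp add: power2_sum)
    also have "\<dots> = 2 * (N * a) + 2 * b" by (simp add: power_mult_distrib N_def a_def b_def)
    finally have "e * (norm v)\<^sup>2 \<le> e * (2 * (N * a) + 2 * b)" using e(1) by (intro mult_left_mono) auto
    moreover have "\<bar>G y v v - G q v v\<bar> \<le> e * (norm v)\<^sup>2" using R(3)[OF y, of v v] by (simp add: power2_eq_square)
    ultimately have diff: "\<bar>G y v v - G q v v\<bar> \<le> 2 * (e * N) * a + 2 * e * b" by (simp add: algebra_simps)
    have ab: "a \<ge> 0" "b \<ge> 0" by (simp_all add: a_def b_def)
    have "2 * (e * N) * a \<le> \<beta> / 2 * a" using e ab by (intro mult_right_mono) auto
    moreover have "2 * e * b \<le> m / 2 * b" using e ab by (intro mult_right_mono) auto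
    ultimately have "\<bar>G y v v - G q v v\<bar> \<le> \<beta> / 2 * a + m / 2 * b" using diff by linarith
    moreover have "m * b \<ge> 0" using m ab by simp
    moreover have "- \<beta> * a + \<beta> / 2 * a = - (\<beta> / 2 * a)" "- \<beta> * a - \<beta> / 2 * a = - (3 * \<beta> / 2 * a)"
      "M * b + m * b = (M + m) * b" "m * b - m / 2 * b = m / 2 * b" "m / 2 * b \<le> m * b"
      using m ab by (auto simp: algebra_simps)
    ultimately have "G y v v \<le> - (\<beta> / 2 * a) + (M + m) * b" "- (3 * \<beta> / 2 * a) + m / 2 * b \<le> G y v v"
      using Gv GP by linarith+
    then show ?thesis by (simp add: a_def b_def P_def)
  qed
  show ?thesis
    by (rule exI[of _ R], rule exI[of _ "\<beta> / 2"], rule exI[of _ "M + m"], rule exI[of _ "3 * \<beta> / 2"], rule exI[of _ "m / 2"])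
      (use main R \<beta> m M in auto)
qed

section \<open>Boundary points of an extension\<close>

text \<open>Translating \<open>q\<close> to 0 yields an instance of \<open>kasner_chart\<close>.
  Whether \<open>w\<close> points to the Kasner future or past is not known; the sign
  \<open>\<sigma>\<close> turns it to the future and decides whether the axis reaches
  \<open>q\<close> from its past or from its future.\<close>

lemma no_exit_from_chart:
  fixes p :: "'n::finite \<Rightarrow> real" and f :: "'n spt \<Rightarrow> 'n spt"
  assumes p: "\<And>i. p i < 1" "\<And>i. - 1 < p i" "p j < 0"
    and Wf: "open Wf" "Wf \<subseteq> kasner_M" and inj: "inj_on f Wf"
    and df: "\<And>z. z \<in> Wf \<Longrightarrow> (f has_derivative df z) (at z)" "\<And>z. z \<in> Wf \<Longrightarrow> inj (df z)"
      "continuous_on Wf (\<lambda>z. df z (1, 0))"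
    and X: "open X" and G: "\<And>y. y \<in> X \<Longrightarrow> lorentz_form (G y)" "\<And>u v. continuous_on X (\<lambda>y. G y u v)"
    and iso: "\<And>z a. z \<in> Wf \<Longrightarrow> kasner_g p z a a = G (f z) (df z a) (df z a)"
    and lim: "\<And>Z z y. (\<And>k::nat. Z k \<in> Wf) \<Longrightarrow> Z \<longlonglongrightarrow> z \<Longrightarrow> z \<in> kasner_M \<Longrightarrow>
        (\<lambda>k. f (Z k)) \<longlonglongrightarrow> y \<Longrightarrow> y \<in> X \<Longrightarrow> z \<in> Wf"
    and q: "q \<in> X" "q \<notin> f ` Wf" and w: "G q w w < 0"
    and s0: "s0 > 0" "\<And>s. 0 < s \<Longrightarrow> s \<le> s0 \<Longrightarrow> q - s *\<^sub>R w \<in> f ` Wf"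
  shows False
proof -
  define l where "l = (\<lambda>v. G q w v / G q w w)"
  obtain R b1 b2 b3 b4 where R: "R > 0" "ball q R \<subseteq> X" and b: "b1 > 0" "b2 > 0" "b3 > 0" "b4 > 0"
    and bounds: "\<And>y v. y \<in> ball q R \<Longrightarrow> G y v v \<le> - (b1 * (l v)\<^sup>2) + b2 * (norm (v - l v *\<^sub>R w))\<^sup>2"
      "\<And>y v. y \<in> ball q R \<Longrightarrow> - (b3 * (l v)\<^sup>2) + b4 * (norm (v - l v *\<^sub>R w))\<^sup>2 \<le> G y v v"
    using lorentz_metric_frame_bounds[OF X q(1) G w] unfolding l_def by blast
  interpret B: bounded_bilinear "G q"
    using G(1)[OF q(1)] by (simp add: lorentz_form_def bilinear_conv_bounded_bilinear)
  have lin: "bounded_linear l"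
    unfolding l_def by (rule bounded_linear_compose[OF bounded_linear_divide B.bounded_linear_right])
  interpret l: bounded_linear l by (rule lin)
  have lw: "l w = 1" using w by (simp add: l_def)
  \<comment> \<open>Chosen so that the box fits into the ball:
    \<open>h * norm w + h = R - h\<close>.\<close>
  define h where "h = R / (norm w + 2)"
  have nw: "0 < norm w + 2" using norm_ge_zero[of w] by linarith
  have h: "h > 0" "h * norm w + h < R"
  proof -
    show "h > 0" unfolding h_def using R(1) nw by (rule divide_pos_pos)
    moreover have "h * (norm w + 2) = R" using nw by (simp add: h_def)
    ultimately show "h * norm w + h < R" by (simp add: algebra_simps)
  qed
  define bx where "bx = {x. \<bar>l x\<bar> < h \<and> norm (x - l x *\<^sub>R w) < h}"
  have bx_ball: "x + q \<in> ball q R" if "x \<in> bx" for x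
  proof -
    have "norm x \<le> norm (l x *\<^sub>R w) + norm (x - l x *\<^sub>R w)" by (metis add_diff_cancel_left' diff_add_cancel norm_triangle_ineq add.commute)
    also have "\<dots> \<le> h * norm w + h" using that by (auto simp: bx_def intro!: add_mono mult_right_mono)
    finally show ?thesis using h(2) by (simp add: dist_norm)
  qed
  have open_bx: "open bx" unfolding bx_def
    by (intro open_Collect_conj open_Collect_less continuous_intros l.continuous_on)
  have contf: "continuous_on Wf f" by (meson continuous_at_imp_continuous_on df(1) has_derivative_continuous)
  define W1 where "W1 = Wf \<inter> (\<lambda>z. f z - q) -` bx"
  have open_W1: "open W1" unfolding W1_def
    by (rule continuous_open_preimage[OF _ Wf(1) open_bx]) (intro continuous_intros contf)
  have W1: "z \<in> Wf" "f z - q \<in> bx" "f z \<in> ball q R" if "z \<in> W1" for z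
    using that bx_ball[of "f z - q"] by (auto simp: W1_def)
  define ori where "ori z = l (df z (1, 0))" for z
  have cont_ori: "continuous_on Wf ori" unfolding ori_def by (intro l.continuous_on df(3))
  have ori0: "ori z \<noteq> 0" if z: "z \<in> W1" for z
  proof
    assume "ori z = 0"
    then have "b4 * (norm (df z (1, 0) - l (df z (1, 0)) *\<^sub>R w))\<^sup>2 \<le> G (f z) (df z (1, 0)) (df z (1, 0))"
      using bounds(2)[OF W1(3)[OF z], of "df z (1, 0)"] by (simp add: ori_def)
    also have "\<dots> = - 1" unfolding iso[OF W1(1)[OF z], symmetric] by (simp add: kasner_g_diag)
    finally show False using b(4) by (meson mult_nonneg_nonneg not_one_le_zero less_imp_le zero_le_power2 order_trans
        neg_0_le_iff_le)
  qed
  define s1 where "s1 = min s0 (h / 2)"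
  have s1: "0 < s1" "s1 \<le> s0" "s1 < h" using s0 h by (auto simp: s1_def)
  define g where "g = inv_into Wf f"
  have contg: "continuous_on (f ` Wf) g"
    by (rule continuous_on_inverse_open[OF Wf(1) contf]) (auto simp: g_def inj)
  define zs where "zs s = g (q - s *\<^sub>R w)" for s
  have fz: "f (zs s) = q - s *\<^sub>R w" "zs s \<in> W1" if s: "s \<in> {0<..s1}" for s
  proof -
    have im: "q - s *\<^sub>R w \<in> f ` Wf" using s0(2)[of s] s s1 by auto
    show 1: "f (zs s) = q - s *\<^sub>R w" unfolding zs_def g_def by (rule f_inv_into_f[OF im])
    have "zs s \<in> Wf" unfolding zs_def g_def by (rule inv_into_into[OF im])
    moreover have "- (s *\<^sub>R w) \<in> bx" using s s1 h by (simp add: bx_def l.neg l.scaleR lw)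
    ultimately show "zs s \<in> W1" by (simp add: W1_def 1)
  qed
  have "continuous_on {0<..s1} zs" unfolding zs_def
    by (rule continuous_on_compose2[OF contg]) (use s0(2) s1 in \<open>auto intro!: continuous_intros\<close>)
  then have "continuous_on {0<..s1} (\<lambda>s. ori (zs s))"
    by (rule continuous_on_compose2[OF cont_ori]) (use W1(1)[OF fz(2)] in blast)
  then have conn: "connected ((\<lambda>s. ori (zs s)) ` {0<..s1})"
    by (intro connected_continuous_image) auto
  define \<sigma> :: real where "\<sigma> = sgn (ori (zs s1))"
  have s1I: "s1 \<in> {0<..s1}" using s1 by simp
  have \<sigma>: "\<sigma> = 1 \<or> \<sigma> = - 1" using ori0[OF fz(2)[OF s1I]] by (auto simp: \<sigma>_def sgn_if)
  have \<sigma>2: "\<sigma> * \<sigma> = 1" "\<sigma> \<noteq> 0" using \<sigma> by auto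
  have ori_pos: "\<sigma> * ori (zs s) > 0" if s: "s \<in> {0<..s1}" for s
  proof (rule ccontr)
    assume "\<not> \<sigma> * ori (zs s) > 0"
    then have "(ori (zs s) \<le> 0 \<and> 0 \<le> ori (zs s1)) \<or> (ori (zs s1) \<le> 0 \<and> 0 \<le> ori (zs s))"
      using \<sigma> by (auto simp: \<sigma>_def sgn_if split: if_splits)
    then have "0 \<in> (\<lambda>s. ori (zs s)) ` {0<..s1}"
      using connectedD_interval[OF conn, of "ori (zs s)" "ori (zs s1)" 0]
        connectedD_interval[OF conn, of "ori (zs s1)" "ori (zs s)" 0] s s1I by blast
    then obtain s' where "s' \<in> {0<..s1}" "ori (zs s') = 0" by (metis imageE)
    then show False using ori0[OF fz(2)] by blast
  qed
  \<comment> \<open>\<open>ori\<close> may have different signs on different components of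
    \<open>W1\<close>; only points with the sign found on the axis are kept. As \<open>ori\<close>
    has no zeros on \<open>W1\<close>, this restriction is still closed under limits in
    \<open>W1\<close>.\<close>
  define W where "W = W1 \<inter> (\<lambda>z. \<sigma> * ori z) -` {0<..}"
  have W_W1: "z \<in> W1" "\<sigma> * ori z > 0" if "z \<in> W" for z using that by (auto simp: W_def)
  have proj: "v - (\<sigma> * l v) *\<^sub>R (\<sigma> *\<^sub>R w) = v - l v *\<^sub>R w" "(\<sigma> * l v)\<^sup>2 = (l v)\<^sup>2" "\<bar>\<sigma> * l v\<bar> = \<bar>l v\<bar>" for v
    using \<sigma> by auto
  interpret C: kasner_chart p W "\<lambda>z. f z - q" df "\<lambda>v. \<sigma> * l v" "\<sigma> *\<^sub>R w" h b1 b2 b3 b4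
  proof (unfold_locales, unfold proj)
    show "p i < 1" "- 1 < p i" for i by (rule p)+
    show "open W" unfolding W_def
      by (rule continuous_open_preimage[OF _ open_W1])
        (auto intro!: continuous_intros continuous_on_subset[OF cont_ori] simp: W1_def)
    show "W \<subseteq> kasner_M" using W_W1 W1 Wf by blast
    show "inj_on (\<lambda>z. f z - q) W" using inj W_W1(1) W1(1) by (auto simp: inj_on_def)
    show "((\<lambda>z. f z - q) has_derivative df z) (at z)" if "z \<in> W" for z
      using has_derivative_diff[OF df(1)[OF W1(1)[OF W_W1(1)[OF that]]] has_derivative_const[of q]] by simp
    show "inj (df z)" if "z \<in> W" for z using df(2) W1 W_W1 that by blast
    show "(\<sigma> * l (\<sigma> *\<^sub>R w)) = 1" using \<sigma>2 by (simp add: l.scaleR lw)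
    show "\<sigma> * l (x + y) = \<sigma> * l x + \<sigma> * l y" "\<sigma> * l (r *\<^sub>R x) = r *\<^sub>R (\<sigma> * l x)" for x y r
      by (simp_all add: l.add l.scaleR algebra_simps)
    show "\<exists>K. \<forall>x. norm (\<sigma> * l x) \<le> norm x * K" using l.bounded proj by simp
    show "0 < h" "0 < b1" "0 < b2" "0 < b3" "0 < b4" by (rule h b)+
    show "\<bar>l (f z - q)\<bar> < h \<and> norm (f z - q - l (f z - q) *\<^sub>R w) < h" if "z \<in> W" for z
      using W1(2)[OF W_W1(1)[OF that]] by (simp add: bx_def)
    show "kasner_g p z a a \<le> - (b1 * (l (df z a))\<^sup>2) + b2 * (norm (df z a - l (df z a) *\<^sub>R w))\<^sup>2"
      "- (b3 * (l (df z a))\<^sup>2) + b4 * (norm (df z a - l (df z a) *\<^sub>R w))\<^sup>2 \<le> kasner_g p z a a" if "z \<in> W" for z a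
      unfolding iso[OF W1(1)[OF W_W1(1)[OF that]]] by (rule bounds[OF W1(3)[OF W_W1(1)[OF that]]])+
    show "0 < \<sigma> * l (df z (1, 0))" if "z \<in> W" for z using W_W1(2)[OF that] by (simp add: ori_def)
    show "0 \<notin> (\<lambda>z. f z - q) ` W" using q(2) W_W1(1) W1(1) by auto
    fix Z :: "nat \<Rightarrow> 'n spt" and z y
    assume Z: "\<And>k. Z k \<in> W" "Z \<longlonglongrightarrow> z" "z \<in> kasner_M" "(\<lambda>k. f (Z k) - q) \<longlonglongrightarrow> y"
      and y: "\<bar>l y\<bar> < h" "norm (y - l y *\<^sub>R w) < h"
    have yb: "y \<in> bx" using y by (simp add: bx_def)
    have ZW: "Z k \<in> Wf" for k using Z(1) W_W1 W1 by blast
    have fZ: "(\<lambda>k. f (Z k)) \<longlonglongrightarrow> y + q" using tendsto_add[OF Z(4) tendsto_const[of q]] by simp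
    have zW: "z \<in> Wf" by (rule lim[OF ZW Z(2,3) fZ]) (use bx_ball[OF yb] R in blast)
    have "(\<lambda>k. f (Z k)) \<longlonglongrightarrow> f z"
      by (rule continuous_on_tendsto_compose[OF contf Z(2) zW]) (use ZW in auto)
    then have "f z = y + q" using LIMSEQ_unique fZ by blast
    then have z1: "z \<in> W1" using zW yb by (simp add: W1_def)
    have "(\<lambda>k. \<sigma> * ori (Z k)) \<longlonglongrightarrow> \<sigma> * ori z"
      by (intro tendsto_intros continuous_on_tendsto_compose[OF cont_ori Z(2) zW]) (use ZW in auto)
    then have "0 \<le> \<sigma> * ori z"
      by (rule LIMSEQ_le_const) (use W_W1(2)[OF Z(1)] less_imp_le in blast)
    then have "0 < \<sigma> * ori z" using ori0[OF z1] \<sigma>2 by (simp add: order_le_less)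
    then show "z \<in> W" using z1 by (simp add: W_def)
  qed
  have ax: "- (s *\<^sub>R w) \<in> C.Ob" if "0 < s" "s \<le> s1" for s
  proof -
    have s: "s \<in> {0<..s1}" using that by simp
    have "zs s \<in> W" using fz(2)[OF s] ori_pos[OF s] by (simp add: W_def)
    then have "f (zs s) - q \<in> C.Ob" by (rule C.Psi_Ob)
    then show ?thesis by (simp add: fz(1)[OF s])
  qed
  from \<sigma> show False
  proof
    assume "\<sigma> = 1"
    then show False using C.no_future_boundary[OF s1(1)] ax by simp
  next
    assume "\<sigma> = - 1"
    then show False using C.no_past_boundary[OF s1(1) _ p(3)] ax by simp
  qed
qed

section \<open>Timelike segments leaving an open set\<close>

lemma segment_exit:
  fixes a v :: "'v::real_normed_vector"
  assumes V: "open V" "a \<in> V" "a + d *\<^sub>R v \<notin> V" "d > 0"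
  shows "\<exists>s. 0 < s \<and> s \<le> d \<and> a + s *\<^sub>R v \<notin> V \<and> (\<forall>s'. 0 < s' \<and> s' \<le> s \<longrightarrow> a + s *\<^sub>R v - s' *\<^sub>R v \<in> V)"
proof -
  define S where "S = {0..d} \<inter> (\<lambda>s. a + s *\<^sub>R v) -` (- V)"
  have "compact S" unfolding S_def
    by (intro compact_Int_closed compact_Icc closed_vimage continuous_intros) (use V in auto)
  moreover have "d \<in> S" using V by (simp add: S_def)
  ultimately obtain s where s: "s \<in> S" "\<And>s'. s' \<in> S \<Longrightarrow> s \<le> s'" using compact_attains_inf by (metis empty_iff)
  have "s \<noteq> 0" using s(1) V by (auto simp: S_def)
  moreover have "a + s *\<^sub>R v - s' *\<^sub>R v \<in> V" if "0 < s'" "s' \<le> s" for s'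
  proof (rule ccontr)
    assume "a + s *\<^sub>R v - s' *\<^sub>R v \<notin> V"
    then have "s - s' \<in> S" using that s(1) by (auto simp: S_def algebra_simps)
    then show False using s(2) that by force
  qed
  ultimately show ?thesis using s(1) by (intro exI[of _ s]) (auto simp: S_def)
qed

text \<open>Walk from \<open>y0\<close> a little along a timelike \<open>e\<close> to
  \<open>z\<close>. If \<open>z\<close> lies in \<open>V\<close>, the way back to \<open>y0\<close>
  leaves \<open>V\<close>; otherwise the segment to \<open>z\<close> from a nearby point
  \<open>a\<close> of \<open>V\<close> does. The first exit \<open>q\<close> need not be
  \<open>y0\<close>.\<close>

lemma timelike_exit:
  fixes G :: "'v::euclidean_space \<Rightarrow> 'v \<Rightarrow> 'v \<Rightarrow> real"
  assumes X: "open X" "y0 \<in> X" and G: "\<And>y. y \<in> X \<Longrightarrow> lorentz_form (G y)" "\<And>u v. continuous_on X (\<lambda>y. G y u v)"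
    and V: "open V" "y0 \<notin> V" "y0 \<in> closure V"
  shows "\<exists>q w s0. q \<in> X \<and> q \<notin> V \<and> G q w w < 0 \<and> 0 < s0 \<and> (\<forall>s. 0 < s \<and> s \<le> s0 \<longrightarrow> q - s *\<^sub>R w \<in> V)"
proof -
  have bil: "bilinear (G y)" if "y \<in> X" for y using G(1)[OF that] by (simp add: lorentz_form_def)
  interpret B: bounded_bilinear "G y0" using bil[OF X(2)] by (simp add: bilinear_conv_bounded_bilinear)
  obtain e where e: "G y0 e e < 0" using G(1)[OF X(2)] by (auto simp: lorentz_form_def)
  define m where "m = - G y0 e e"
  have m: "m > 0" using e by (simp add: m_def)
  have "open {v. G y0 v v < - m / 2 \<and> norm v < norm e + 1}"
    by (intro open_Collect_conj open_Collect_less B.continuous_on continuous_intros)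
  moreover have "e \<in> {v. G y0 v v < - m / 2 \<and> norm v < norm e + 1}" using m by (simp add: m_def)
  ultimately obtain \<rho> where \<rho>: "\<rho> > 0" "ball e \<rho> \<subseteq> {v. G y0 v v < - m / 2 \<and> norm v < norm e + 1}"
    using open_contains_ball by blast
  define c where "c = m / (2 * (norm e + 1)\<^sup>2)"
  have ne: "0 < norm e + 1" using norm_ge_zero[of e] by linarith
  have c: "c > 0" "c * (norm e + 1)\<^sup>2 = m / 2" using m ne by (auto simp: c_def)
  obtain R where R: "R > 0" "ball y0 R \<subseteq> X" "\<And>y u v. y \<in> ball y0 R \<Longrightarrow> \<bar>G y u v - G y0 u v\<bar> \<le> c * norm u * norm v"
    using metric_uniformly_close[OF X bil G(2) c(1)] by blast
  have timelike: "G y v v < 0" if y: "y \<in> ball y0 R" and v: "v \<in> ball e \<rho>" for y v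
  proof -
    have v': "G y0 v v < - m / 2" "norm v < norm e + 1" using v \<rho> by auto
    have "c * norm v * norm v \<le> c * (norm e + 1)\<^sup>2"
      using v'(2) c(1) unfolding power2_eq_square mult.assoc by (intro mult_left_mono mult_mono) auto
    then show ?thesis using R(3)[OF y, of v v] v' c(2) by (simp add: abs_le_iff)
  qed
  obtain d where d: "d > 0" "d * (norm e + 1 + \<rho>) < R / 2"
  proof -
    define k where "k = norm e + 1 + \<rho>"
    have k: "k > 0" using ne \<rho> by (simp add: k_def)
    have "R / (3 * k) > 0" "R / (3 * k) * k < R / 2" using k R by auto
    then show ?thesis using that unfolding k_def by blast
  qed
  obtain a where a: "a \<in> V" "dist a y0 < d * \<rho>"
    using V(3) d \<rho> unfolding closure_approachable by (metis mult_pos_pos)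
  define z where "z = y0 + d *\<^sub>R e"
  show ?thesis
  proof (cases "z \<in> V")
    case True
    have "z + d *\<^sub>R (- e) \<notin> V" using V by (simp add: z_def)
    from segment_exit[OF V(1) True this d(1)]
    obtain s where s: "0 < s" "s \<le> d" "z + s *\<^sub>R (- e) \<notin> V"
      "\<forall>s'. 0 < s' \<and> s' \<le> s \<longrightarrow> z + s *\<^sub>R (- e) - s' *\<^sub>R (- e) \<in> V" by blast
    have "dist y0 (z + s *\<^sub>R (- e)) = (d - s) * norm e"
      using s by (simp add: z_def dist_norm algebra_simps flip: scaleR_diff_left)
    also have "\<dots> \<le> d * (norm e + 1 + \<rho>)" using s \<rho> by (intro mult_mono) auto
    finally have qR: "z + s *\<^sub>R (- e) \<in> ball y0 R" using d R(1) by simp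
    have "G (z + s *\<^sub>R (- e)) e e < 0" by (rule timelike[OF qR]) (use \<rho> in simp)
    moreover have "G (z + s *\<^sub>R (- e)) (- e) (- e) = G (z + s *\<^sub>R (- e)) e e"
      using bil[OF subsetD[OF R(2) qR]] by (simp add: bilinear_lneg bilinear_rneg)
    ultimately have "G (z + s *\<^sub>R (- e)) (- e) (- e) < 0" by simp
    then show ?thesis using s qR R(2) by blast
  next
    case False
    \<comment> \<open>The vector from \<open>a\<close> to \<open>z\<close> divided by
      \<open>d\<close>. As \<open>a\<close> is within \<open>d * \<rho>\<close> of
      \<open>y0\<close>, it differs from \<open>e\<close> by less than \<open>\<rho>\<close> and is
      timelike near \<open>y0\<close>.\<close>
    define v where "v = e + (1 / d) *\<^sub>R (y0 - a)"
    have "norm ((1 / d) *\<^sub>R (y0 - a)) < \<rho>"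
      using a(2) d by (simp add: dist_norm norm_minus_commute divide_less_eq mult.commute)
    then have v: "v \<in> ball e \<rho>" by (simp add: v_def dist_norm)
    have av: "a + d *\<^sub>R v = z" using d by (simp add: v_def z_def algebra_simps)
    from segment_exit[OF V(1) a(1) _ d(1), of v]
    obtain s where s: "0 < s" "s \<le> d" "a + s *\<^sub>R v \<notin> V"
      "\<forall>s'. 0 < s' \<and> s' \<le> s \<longrightarrow> a + s *\<^sub>R v - s' *\<^sub>R v \<in> V" using False av by auto
    have nv: "norm v < norm e + 1" using v \<rho> by auto
    have "dist y0 (a + s *\<^sub>R v) \<le> dist y0 a + norm (s *\<^sub>R v)"
      using norm_triangle_ineq4[of "y0 - a" "s *\<^sub>R v"] by (simp add: dist_norm algebra_simps)
    also have "norm (s *\<^sub>R v) \<le> d * (norm e + 1)" using s nv by (auto intro!: mult_mono)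
    also have "dist y0 a + d * (norm e + 1) < d * \<rho> + d * (norm e + 1)" using a by (simp add: dist_commute)
    also have "\<dots> < R" using d R(1) by (simp add: algebra_simps)
    finally have qR: "a + s *\<^sub>R v \<in> ball y0 R" by simp
    have "G (a + s *\<^sub>R v) v v < 0" by (rule timelike[OF qR v])
    then show ?thesis using s qR R(2) by blast
  qed
qed

section \<open>From an abstract extension to a single chart\<close>

lemma smooth_on_frechet:
  assumes "smooth_on S f"
  shows "\<And>z. z \<in> S \<Longrightarrow> (f has_derivative frechet_derivative f (at z)) (at z)"
    and "continuous_on S (\<lambda>z. frechet_derivative f (at z) v)"
proof -
  have "Ck_on (Suc 0) S f" using assms unfolding smooth_on_def by blast
  then show "\<And>z. z \<in> S \<Longrightarrow> (f has_derivative frechet_derivative f (at z)) (at z)"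
    "continuous_on S (\<lambda>z. frechet_derivative f (at z) v)"
    by (simp_all add: frechet_derivative_works[symmetric])
qed

theorem theorem4p3:
  fixes p :: "'n::finite \<Rightarrow> real"
  assumes "CARD('n) \<ge> 3"
    and "(\<Sum>i\<in>UNIV. p i) = 1"
    and "(\<Sum>i\<in>UNIV. (p i)^2) = 1"
    and "\<exists>i. p i < 0"
  shows "\<not> (\<exists>(T :: 'a topology) A G \<iota>. is_C0_extension kasner_M (kasner_g p) T A G \<iota>)"
proof (intro notI, elim exE)
  fix T :: "'a topology" and A :: "('a set \<times> ('a \<Rightarrow> 'n spt)) set" and GG and \<iota> :: "'n spt \<Rightarrow> 'a"
  assume ext: "is_C0_extension kasner_M (kasner_g p) T A GG \<iota>"
  obtain j where pj: "p j < 0" using assms(4) by blast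
  note pb = kasner_exponent_bounds[OF assms(2-4)]
  have man: "smooth_manifold T A" and met: "continuous_lorentzian_metric T A GG"
    and emb: "embedding_map (top_of_set kasner_M) T \<iota>"
    and smooth: "\<And>U \<phi>. (U, \<phi>) \<in> A \<Longrightarrow> smooth_on (kasner_M \<inter> \<iota> -` U) (\<phi> \<circ> \<iota>)"
    and inj_d: "\<And>U \<phi> z. (U, \<phi>) \<in> A \<Longrightarrow> z \<in> kasner_M \<inter> \<iota> -` U \<Longrightarrow> inj (frechet_derivative (\<phi> \<circ> \<iota>) (at z))"
    and isom: "\<And>U \<phi> z u v. (U, \<phi>) \<in> A \<Longrightarrow> z \<in> kasner_M \<inter> \<iota> -` U \<Longrightarrow> kasner_g p z u v =
       GG (U, \<phi>) (\<phi> (\<iota> z)) (frechet_derivative (\<phi> \<circ> \<iota>) (at z) u) (frechet_derivative (\<phi> \<circ> \<iota>) (at z) v)"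
    and fr: "T frontier_of (\<iota> ` kasner_M) \<noteq> {}"
    using ext unfolding is_C0_extension_def by fast+
  obtain pt where pt: "pt \<in> T closure_of (\<iota> ` kasner_M)" "pt \<notin> T interior_of (\<iota> ` kasner_M)"
    using fr by (auto simp: frontier_of_def)
  have "pt \<in> topspace T" using pt(1) by (simp add: in_closure_of)
  moreover have cover: "\<Union>(fst ` A) = topspace T" and Hd: "Hausdorff_space T"
    and charts: "\<forall>(U,\<phi>)\<in>A. openin T U \<and> open (\<phi> ` U) \<and>
        homeomorphic_map (subtopology T U) (top_of_set (\<phi> ` U)) \<phi>"
    using man unfolding smooth_manifold_def by simp_all
  ultimately obtain ch where "ch \<in> A" "pt \<in> fst ch" by blast
  then obtain U \<phi> where U: "(U, \<phi>) \<in> A" "pt \<in> U" by (cases ch) simp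
  have chart: "openin T U" "open (\<phi> ` U)" "homeomorphic_map (subtopology T U) (top_of_set (\<phi> ` U)) \<phi>"
    using bspec[OF charts U(1)] by simp_all
  define X where "X = \<phi> ` U"
  define f where "f = \<phi> \<circ> \<iota>"
  define Wf where "Wf = kasner_M \<inter> \<iota> -` U"
  define df where "df z = frechet_derivative f (at z)" for z
  define G where "G = GG (U, \<phi>)"
  have open_M: "open (kasner_M :: 'n spt set)" unfolding kasner_M_def
    by (intro open_Collect_less continuous_intros)
  have UT: "U \<subseteq> topspace T" using chart(1) by (rule openin_subset)
  have inj_phi: "inj_on \<phi> U" using homeomorphic_imp_injective_map[OF chart(3)] UT by (simp add: Int_absorb1)
  have cphi: "continuous_map (subtopology T U) (top_of_set X) \<phi>"
    using homeomorphic_imp_continuous_map[OF chart(3)] by (simp add: X_def)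
  obtain \<psi> where \<psi>: "continuous_map (top_of_set X) (subtopology T U) \<psi>" "\<And>x. x \<in> U \<Longrightarrow> \<psi> (\<phi> x) = x"
    using chart(3) UT unfolding homeomorphic_map_maps homeomorphic_maps_def X_def by (auto simp: Int_absorb1)
  have emb': "homeomorphic_map (top_of_set kasner_M) (subtopology T (\<iota> ` kasner_M)) \<iota>"
    using emb by (simp add: embedding_map_def)
  have ciota: "continuous_map (top_of_set kasner_M) T \<iota>"
    using homeomorphic_imp_continuous_map[OF emb'] continuous_map_in_subtopology by blast
  have inj_iota: "inj_on \<iota> kasner_M" using homeomorphic_imp_injective_map[OF emb'] by simp
  have "openin (top_of_set kasner_M) {z \<in> topspace (top_of_set kasner_M). \<iota> z \<in> U}"
    by (rule openin_continuous_map_preimage[OF ciota chart(1)])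
  then have open_Wf: "open Wf"
    using openin_open_trans[OF _ open_M] by (simp add: Wf_def vimage_def Int_def)
  have inj_f: "inj_on f Wf" using inj_phi inj_iota by (auto simp: inj_on_def f_def Wf_def)
  have df: "(f has_derivative df z) (at z)" if "z \<in> Wf" for z
    unfolding df_def f_def by (rule smooth_on_frechet(1)[OF smooth[OF U(1)]]) (use that in \<open>simp add: Wf_def\<close>)
  have dfc: "continuous_on Wf (\<lambda>z. df z (1, 0))"
    unfolding df_def f_def Wf_def by (rule smooth_on_frechet(2)[OF smooth[OF U(1)]])
  have dfi: "inj (df z)" if "z \<in> Wf" for z
    unfolding df_def f_def by (rule inj_d[OF U(1)]) (use that in \<open>simp add: Wf_def\<close>)
  have iso: "kasner_g p z a a = G (f z) (df z a) (df z a)" if "z \<in> Wf" for z a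
    using isom[OF U(1), of z a a] that by (simp add: Wf_def G_def f_def df_def)
  have X: "open X" using chart(2) by (simp add: X_def)
  have GL: "lorentz_form (G y)" if "y \<in> X" for y
    using met U(1) that unfolding continuous_lorentzian_metric_def X_def G_def by blast
  have GC: "continuous_on X (\<lambda>y. G y u v)" for u v
    using met U(1) unfolding continuous_lorentzian_metric_def X_def G_def by blast
  have contf: "continuous_on Wf f" by (meson continuous_at_imp_continuous_on df has_derivative_continuous)
  have open_f: "open (f ` Wf)" by (rule invariance_of_domain[OF contf open_Wf inj_f])
  have pre: "openin T {x \<in> U. \<phi> x \<in> V}" if "open V" for V
  proof -
    have "openin (top_of_set X) (X \<inter> V)" using that by (rule openin_open_Int)
    from openin_continuous_map_preimage[OF cphi this]
    have "openin (subtopology T U) {x \<in> topspace (subtopology T U). \<phi> x \<in> X \<inter> V}" .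
    moreover have "{x \<in> topspace (subtopology T U). \<phi> x \<in> X \<inter> V} = {x \<in> U. \<phi> x \<in> V}"
      using UT by (auto simp: X_def)
    ultimately show ?thesis using openin_trans_full[OF _ chart(1)] by simp
  qed
  define y0 where "y0 = \<phi> pt"
  have y0X: "y0 \<in> X" using U(2) by (simp add: y0_def X_def)
  \<comment> \<open>If \<open>y0\<close> were in the open image, its preimage under the chart would
    be a neighbourhood of \<open>pt\<close> inside the image of the spacetime, making
    \<open>pt\<close> an interior point.\<close>
  have y0f: "y0 \<notin> f ` Wf"
  proof
    assume "y0 \<in> f ` Wf"
    then have "pt \<in> {x \<in> U. \<phi> x \<in> f ` Wf}" using U(2) by (simp add: y0_def)
    moreover have "{x \<in> U. \<phi> x \<in> f ` Wf} \<subseteq> \<iota> ` kasner_M"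
      using inj_phi by (auto simp: f_def Wf_def inj_on_def)
    ultimately show False using pt(2) interior_of_maximal[OF _ pre[OF open_f]] by blast
  qed
  have y0c: "y0 \<in> closure (f ` Wf)"
    unfolding closure_approachable
  proof (intro allI impI)
    fix e :: real assume "e > 0"
    then have "pt \<in> {x \<in> U. \<phi> x \<in> ball y0 e}" using U(2) by (simp add: y0_def)
    moreover have "\<forall>V. pt \<in> V \<and> openin T V \<longrightarrow> (\<exists>y. y \<in> \<iota> ` kasner_M \<and> y \<in> V)"
      using pt(1) unfolding in_closure_of by (rule conjunct2)
    ultimately obtain x where "x \<in> \<iota> ` kasner_M" and x: "x \<in> {x \<in> U. \<phi> x \<in> ball y0 e}"
      using pre[OF open_ball, of y0 e] by meson
    then obtain z where z: "z \<in> kasner_M" "x = \<iota> z" by blast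
    have "z \<in> Wf" "dist (f z) y0 < e" using x z by (simp_all add: Wf_def f_def dist_commute)
    then show "\<exists>y\<in>f ` Wf. dist y y0 < e" by (intro bexI[of _ "f z"] imageI)
  qed
  \<comment> \<open>The Hausdorff property enters here: \<open>\<iota> z\<close> and the point of
    \<open>U\<close> with chart value \<open>y\<close> are limits of the same sequence, so they
    agree and \<open>z\<close> is seen by the chart.\<close>
  have lim: "z \<in> Wf" if Z: "\<And>k::nat. Z k \<in> Wf" "Z \<longlonglongrightarrow> z" "z \<in> kasner_M"
    and y: "(\<lambda>k. f (Z k)) \<longlonglongrightarrow> y" "y \<in> X" for Z z y
  proof -
    have "limitin (top_of_set kasner_M) Z z sequentially" using Z open_M by simp
    from continuous_map_limit[OF ciota this] have 1: "limitin T (\<iota> \<circ> Z) (\<iota> z) sequentially" .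
    have "limitin (top_of_set X) (\<lambda>k. f (Z k)) y sequentially" using y X by simp
    from continuous_map_limit[OF \<psi>(1) this] have "limitin (subtopology T U) (\<psi> \<circ> (\<lambda>k. f (Z k))) (\<psi> y) sequentially" .
    moreover have "\<psi> \<circ> (\<lambda>k. f (Z k)) = \<iota> \<circ> Z" using \<psi>(2) Z(1) by (auto simp: f_def Wf_def)
    ultimately have 2: "limitin T (\<iota> \<circ> Z) (\<psi> y) sequentially" "\<psi> y \<in> U" by (auto simp: limitin_subtopology)
    have "\<iota> z = \<psi> y" by (rule limitin_Hausdorff_unique[OF 1 2(1) _ Hd]) simp
    then show ?thesis using 2(2) Z(3) by (simp add: Wf_def)
  qed
  obtain q w s0 where q: "q \<in> X" "q \<notin> f ` Wf" "G q w w < 0" "0 < s0"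
    "\<And>s. 0 < s \<Longrightarrow> s \<le> s0 \<Longrightarrow> q - s *\<^sub>R w \<in> f ` Wf"
    using timelike_exit[OF X y0X GL GC open_f y0f y0c] by blast
  show False
    by (rule no_exit_from_chart[OF pb pj open_Wf _ inj_f df dfi dfc X GL GC iso lim q(1-4) q(5)])
      (auto simp: Wf_def)
qed

end
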